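(* There is a randomized data structure that, for a dynamic graph on $n$ vertices undergoing edge insertions and deletions (against an oblivious adversary), maintains an explicit and adaptive $O(\alpha\log n)$-coloring with expected amortized update time $O(\log^2 n)$, where $\alpha$ is the current arboricity of the graph.
   Context: A dynamic graph has a fixed vertex set $V$ with $|V|=n$, initially has no edges, and undergoes a sequence of updates, each inserting or deleting a single edge. The arboricity of a graph is the minimum number of forests into which its edge set can be partitioned. A $C$-coloring assigns to each vertex a color in $\{1,\dots,C\}$; it is proper if adjacent vertices receive different colors, and all colorings maintained are required to be proper after every update. A coloring is explicit if after each update the data structure stores an array $\mathcal{C}$ of length $n$ with $\mathcal{C}[u]$ the color of vertex $u$. The coloring is adaptive if after each update the number of colors used is bounded in terms of the arboricity $\alpha$ of the current graph (not the maximum arboricity over the whole update sequence). The adversary is oblivious: the update sequence is fixed before the algorithm runs. *)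

theory Defs
  imports "HOL-Probability.Probability" "HOL-Probability.SPMF"
begin

section \<open>Graphs, arboricity and colorings\<close>

text \<open>Simple graphs on the vertex set \<open>{0..<n}\<close> are given by their edge sets;
  an edge is a two-element set of vertices.\<close>

definition cycle_in :: "'a set set \<Rightarrow> 'a list \<Rightarrow> bool" where
  "cycle_in E vs \<longleftrightarrow> length vs \<ge> 3 \<and> distinct vs \<and>
     (\<forall>i < length vs. {vs ! i, vs ! (Suc i mod length vs)} \<in> E)"

definition is_forest :: "'a set set \<Rightarrow> bool" where
  "is_forest E \<longleftrightarrow> (\<nexists>vs. cycle_in E vs)"

definition forest_partition :: "'a set set \<Rightarrow> nat \<Rightarrow> ('a set \<Rightarrow> nat) \<Rightarrow> bool" where
  "forest_partition E k f \<longleftrightarrow>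
     (\<forall>e \<in> E. f e < k) \<and> (\<forall>i < k. is_forest {e \<in> E. f e = i})"

definition arboricity :: "'a set set \<Rightarrow> nat" where
  "arboricity E = (LEAST k. \<exists>f. forest_partition E k f)"

definition proper_coloring :: "nat \<Rightarrow> nat set set \<Rightarrow> nat \<Rightarrow> (nat \<Rightarrow> nat) \<Rightarrow> bool" where
  "proper_coloring n E C col \<longleftrightarrow>
     (\<forall>u < n. col u \<in> {1..C}) \<and> (\<forall>u v. {u, v} \<in> E \<longrightarrow> col u \<noteq> col v)"

lemma is_forest_singleton: "is_forest E" if "E \<subseteq> {e}"
  unfolding is_forest_def
proof
  assume "\<exists>vs. cycle_in E vs"
  then obtain vs where vs: "length vs \<ge> 3" "distinct vs"
    "\<And>i. i < length vs \<Longrightarrow> {vs ! i, vs ! (Suc i mod length vs)} \<in> E"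
    unfolding cycle_in_def by blast
  have "{vs ! 0, vs ! 1} = e" "{vs ! 1, vs ! 2} = e"
    using vs(1) vs(3)[of 0] vs(3)[of 1] that by (fastforce simp: numeral_2_eq_2)+
  then have "vs ! 0 = vs ! 2"
    by (auto simp: doubleton_eq_iff)
  then show False
    using nth_eq_iff_index_eq[OF vs(2), of 0 2] vs(1) by linarith
qed

lemma arboricity_attained:
  assumes "finite E"
  shows "\<exists>f. forest_partition E (arboricity E) f"
proof -
  obtain f :: "'a set \<Rightarrow> nat" where f: "inj_on f E" "f ` E = {0..<card E}"
    using ex_bij_betw_finite_nat[OF assms] by (auto simp: bij_betw_def)
  have "is_forest {e \<in> E. f e = i}" for i
  proof (cases "\<exists>e \<in> E. f e = i")
    case True
    then obtain e where "e \<in> E" "f e = i" by blast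
    with f(1) have "{e \<in> E. f e = i} \<subseteq> {e}" by (auto dest: inj_onD)
    then show ?thesis by (rule is_forest_singleton)
  next
    case False
    then have "{e \<in> E. f e = i} \<subseteq> {undefined}" by blast
    then show ?thesis by (rule is_forest_singleton)
  qed
  moreover have "f e < card E" if "e \<in> E" for e
    using f(2) that by (metis atLeastLessThan_iff imageI)
  ultimately have "forest_partition E (card E) f"
    by (simp add: forest_partition_def)
  then have "\<exists>k f. forest_partition E k f"
    by blast
  from LeastI_ex[OF this] show ?thesis
    by (simp only: arboricity_def)
qed


section \<open>Update sequences\<close>

datatype update = Insert nat nat | Delete nat nat

fun apply_update :: "update \<Rightarrow> nat set set \<Rightarrow> nat set set" where
  "apply_update (Insert u v) E = insert {u, v} E"
| "apply_update (Delete u v) E = E - {{u, v}}"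

fun valid_update :: "nat \<Rightarrow> nat set set \<Rightarrow> update \<Rightarrow> bool" where
  "valid_update n E (Insert u v) \<longleftrightarrow> u < n \<and> v < n \<and> u \<noteq> v \<and> {u, v} \<notin> E"
| "valid_update n E (Delete u v) \<longleftrightarrow> u < n \<and> v < n \<and> {u, v} \<in> E"

fun valid_updates :: "nat \<Rightarrow> nat set set \<Rightarrow> update list \<Rightarrow> bool" where
  "valid_updates n E [] \<longleftrightarrow> True"
| "valid_updates n E (x # xs) \<longleftrightarrow> valid_update n E x \<and> valid_updates n (apply_update x E) xs"

definition graph_after :: "update list \<Rightarrow> nat set set" where
  "graph_after us = fold apply_update us {}"


section \<open>Randomized word RAM programs\<close>

text \<open>A structured language for a randomized word RAM. The storage consists of scalar registers
  and of arrays of words; a program text mentions only finitely many register names and array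
  names, so this is the usual RAM with its memory divided into a constant number of arrays.
  All storage is initially zero. The parameter \<open>M\<close> of the semantics is the number of
  different words: results of operations are reduced modulo \<open>M\<close>, except that subtraction is
  truncated at zero. Every operation, array access, assignment and random draw takes unit time,
  and so does every evaluation of a guard.\<close>

datatype aexp =
    Const nat
  | Reg nat
  | Read nat aexp
  | Plus aexp aexp
  | Minus aexp aexp
  | Times aexp aexp
  | Quot aexp aexp
  | Rem aexp aexp

datatype bexp =
    Less aexp aexp
  | Equal aexp aexp
  | Neg bexp
  | Conj bexp bexp

datatype com =
    Skip
  | Assign nat aexp
  | Store nat aexp aexp
  | Random nat aexp
  | Seq com com
  | Cond bexp com com
  | While bexp com

record state =
  regs :: "nat \<Rightarrow> nat"
  arrays :: "nat \<Rightarrow> nat \<Rightarrow> nat"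
  time :: nat

primrec aval :: "nat \<Rightarrow> state \<Rightarrow> aexp \<Rightarrow> nat" where
  "aval M s (Const k) = k mod M"
| "aval M s (Reg r) = regs s r"
| "aval M s (Read a e) = arrays s a (aval M s e)"
| "aval M s (Plus e1 e2) = (aval M s e1 + aval M s e2) mod M"
| "aval M s (Minus e1 e2) = aval M s e1 - aval M s e2"
| "aval M s (Times e1 e2) = (aval M s e1 * aval M s e2) mod M"
| "aval M s (Quot e1 e2) = aval M s e1 div aval M s e2"
| "aval M s (Rem e1 e2) = aval M s e1 mod aval M s e2"

primrec acost :: "aexp \<Rightarrow> nat" where
  "acost (Const k) = 1"
| "acost (Reg r) = 1"
| "acost (Read a e) = 1 + acost e"
| "acost (Plus e1 e2) = 1 + acost e1 + acost e2"
| "acost (Minus e1 e2) = 1 + acost e1 + acost e2"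
| "acost (Times e1 e2) = 1 + acost e1 + acost e2"
| "acost (Quot e1 e2) = 1 + acost e1 + acost e2"
| "acost (Rem e1 e2) = 1 + acost e1 + acost e2"

primrec bval :: "nat \<Rightarrow> state \<Rightarrow> bexp \<Rightarrow> bool" where
  "bval M s (Less e1 e2) \<longleftrightarrow> aval M s e1 < aval M s e2"
| "bval M s (Equal e1 e2) \<longleftrightarrow> aval M s e1 = aval M s e2"
| "bval M s (Neg b) \<longleftrightarrow> \<not> bval M s b"
| "bval M s (Conj b1 b2) \<longleftrightarrow> bval M s b1 \<and> bval M s b2"

primrec bcost :: "bexp \<Rightarrow> nat" where
  "bcost (Less e1 e2) = 1 + acost e1 + acost e2"
| "bcost (Equal e1 e2) = 1 + acost e1 + acost e2"
| "bcost (Neg b) = 1 + bcost b"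
| "bcost (Conj b1 b2) = 1 + bcost b1 + bcost b2"

definition tick :: "nat \<Rightarrow> state \<Rightarrow> state" where
  "tick k s = s\<lparr>time := time s + k\<rparr>"

definition set_reg :: "nat \<Rightarrow> nat \<Rightarrow> state \<Rightarrow> state" where
  "set_reg r x s = s\<lparr>regs := (regs s)(r := x)\<rparr>"

definition set_cell :: "nat \<Rightarrow> nat \<Rightarrow> nat \<Rightarrow> state \<Rightarrow> state" where
  "set_cell a i x s = s\<lparr>arrays := (arrays s)(a := (arrays s a)(i := x))\<rparr>"

text \<open>Executions are subprobability distributions on final states; the missing probability mass
  is the probability of nontermination.\<close>

partial_function (spmf) loop :: "('s \<Rightarrow> bool) \<Rightarrow> ('s \<Rightarrow> 's spmf) \<Rightarrow> 's \<Rightarrow> 's spmf" where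
  "loop g f s = (if g s then bind_spmf (f s) (loop g f) else return_spmf s)"

primrec exec :: "nat \<Rightarrow> com \<Rightarrow> state \<Rightarrow> state spmf" where
  "exec M Skip s = return_spmf (tick 1 s)"
| "exec M (Assign r e) s = return_spmf (tick (1 + acost e) (set_reg r (aval M s e) s))"
| "exec M (Store a i e) s =
     return_spmf (tick (1 + acost i + acost e) (set_cell a (aval M s i) (aval M s e) s))"
| "exec M (Random r e) s =
     map_spmf (\<lambda>x. tick (1 + acost e) (set_reg r x s))
       (if aval M s e = 0 then return_spmf 0 else spmf_of_set {0..<aval M s e})"
| "exec M (Seq c1 c2) s = bind_spmf (exec M c1 s) (exec M c2)"
| "exec M (Cond b c1 c2) s =
     (if bval M s b then exec M c1 (tick (bcost b) s) else exec M c2 (tick (bcost b) s))"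
| "exec M (While b c) s =
     loop (\<lambda>s. bval M s b) (\<lambda>s. map_spmf (tick (bcost b)) (exec M c s)) (tick (bcost b) s)"

definition expected_time :: "state spmf \<Rightarrow> ennreal" where
  "expected_time p =
     (if lossless_spmf p then (\<integral>\<^sup>+ s. of_nat (time s) \<partial>measure_spmf p) else \<infinity>)"


section \<open>Dynamic graph data structures\<close>

text \<open>The two programs and the constant \<open>word_factor\<close> do not depend on the number \<open>n\<close> of
  vertices: the words have \<open>word_factor\<close> times as many bits as are needed to write down \<open>n\<close>.\<close>

record data_structure =
  init_prog :: com
  update_prog :: com
  word_factor :: nat

definition num_words :: "data_structure \<Rightarrow> nat \<Rightarrow> nat" where
  "num_words D n = 2 ^ (word_factor D * nat \<lceil>log 2 (real n + 1)\<rceil>)"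

definition start_state :: "nat \<Rightarrow> state" where
  "start_state n = \<lparr>regs = (\<lambda>_. 0)(0 := n), arrays = (\<lambda>_ _. 0), time = 0\<rparr>"

fun load_update :: "update \<Rightarrow> state \<Rightarrow> state" where
  "load_update (Insert u v) s = set_reg 0 1 (set_reg 1 u (set_reg 2 v s))"
| "load_update (Delete u v) s = set_reg 0 0 (set_reg 1 u (set_reg 2 v s))"

definition initialize :: "data_structure \<Rightarrow> nat \<Rightarrow> state spmf" where
  "initialize D n = exec (num_words D n) (init_prog D) (start_state n)"

primrec process :: "data_structure \<Rightarrow> nat \<Rightarrow> update list \<Rightarrow> state \<Rightarrow> state spmf" where
  "process D n [] s = return_spmf s"
| "process D n (x # xs) s =
     bind_spmf (exec (num_words D n) (update_prog D) (load_update x s)) (process D n xs)"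

text \<open>The clock is reset after the initialization, so that it measures the time
  spent on the updates only.\<close>

definition run :: "data_structure \<Rightarrow> nat \<Rightarrow> update list \<Rightarrow> state spmf" where
  "run D n us = bind_spmf (initialize D n) (\<lambda>s. process D n us (s\<lparr>time := 0\<rparr>))"

text \<open>The color of vertex \<open>u\<close> is stored explicitly, in cell \<open>u\<close> of array \<open>0\<close>.\<close>

definition color_array :: "state \<Rightarrow> nat \<Rightarrow> nat" where
  "color_array s = arrays s 0"

text \<open>Quantifying over all valid update sequences covers all their prefixes, so the coloring is
  required after each update, in every outcome of the random choices. The palette \<open>{1..C}\<close> is
  bounded in terms of the arboricity of the current graph only. (An edgeless graph has arboricity
  \<open>0\<close> but needs a color; instances of \<open>f\<close> have to allow for this.) The update sequence is fixed
  before the random choices are made: the adversary is oblivious.\<close>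

definition maintains_coloring :: "data_structure \<Rightarrow> (nat \<Rightarrow> nat \<Rightarrow> real) \<Rightarrow> bool" where
  "maintains_coloring D f \<longleftrightarrow>
     (\<forall>n \<ge> 2. \<forall>us. valid_updates n {} us \<longrightarrow>
        (\<forall>s \<in> set_spmf (run D n us).
           \<exists>C. real C \<le> f n (arboricity (graph_after us)) \<and>
               proper_coloring n (graph_after us) C (color_array s)))"

definition expected_init_time :: "data_structure \<Rightarrow> (nat \<Rightarrow> real) \<Rightarrow> bool" where
  "expected_init_time D f \<longleftrightarrow>
     (\<forall>n \<ge> 2. expected_time (initialize D n) \<le> ennreal (f n))"

definition expected_amortized_update_time :: "data_structure \<Rightarrow> (nat \<Rightarrow> real) \<Rightarrow> bool" where
  "expected_amortized_update_time D f \<longleftrightarrow>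
     (\<forall>n \<ge> 2. \<forall>us. valid_updates n {} us \<longrightarrow>
        expected_time (run D n us) \<le> ennreal (real (length us) * f n))"

end

theory Submission
  imports Defs
begin

text \<open>
  Every vertex has a level in \<open>0, \<dots>, L\<^sup>2\<close>, where \<open>L\<close> is about \<open>log n\<close>, and the threshold of
  level \<open>l\<close> is \<open>T l = 2 ^ (l div L)\<close>. A vertex moves up when it has more than \<open>3 * T l\<close>
  neighbours on its own level \<open>l\<close> or above, and down when it has fewer than \<open>T (l - 1)\<close> neighbours
  on level \<open>l - 1\<close> or above. A potential that charges every edge for the distance of its lower end
  from the top, and every vertex for the neighbours it lacks on lower levels, pays for all moves with
  \<open>O(L\<^sup>2)\<close> per update. In a group of \<open>L\<close> levels with \<open>T l \<ge> 4 * \<alpha>\<close> the number of vertices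
  above halves with every level, so that all vertices stay on levels with \<open>T l = O(\<alpha>)\<close>. Giving
  each level a palette of its own with \<open>4 * T l\<close> colors makes \<open>O(\<alpha> * L)\<close> colors in all.

  Recoloring a vertex means choosing uniformly among the at least \<open>T l\<close> colors of the palette
  that its neighbours do not use, in time \<open>O(T l)\<close>. The moves of the levels do not depend on
  the random choices. An inserted edge whose ends agree causes a recoloring, so it has to be unlikely
  that two vertices of level \<open>l\<close> agree. Besides resolving conflicts, each update therefore recolors an
  end of its edge with probability \<open>2 / T l\<close>. Then the probability \<open>p\<close> that two given vertices
  of level \<open>l\<close> agree always stays below \<open>2 / T l\<close>, since an update changes it to at most
  \<open>(1 - 2 / T l) * p + (2 / T l + 2 / T l) / T l\<close>.
\<close>

section \<open>Reasoning about programs\<close>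

text \<open>The difficulty is dependence. A recoloring triggered by a conflict depends on the very
  colors whose collision probabilities are to be bounded, so after a few updates no color is uniform
  given the others. The proof keeps only unconditional bounds for single pairs of vertices. They can
  be averaged over all outcomes because every outcome has the same levels: the program for the
  levels neither reads nor writes what the coloring programs write, which is a noninterference
  property of the program text. The fixed update sequence enters here too, since the pair that an
  update joins is chosen without regard to the colors. The constant 2 appears twice, as refresh rate
  and as bound. With rate \<open>r / T\<close> and bound \<open>q / T\<close> the recurrence closes
  iff \<open>q + r \<le> q * r\<close>, that is \<open>1 \<le> (q - 1) * (r - 1)\<close>; the
  balanced solution is \<open>q = r = 2\<close>. The expected cost of a refresh is then constant,
  since a recoloring takes time \<open>O(T)\<close>.\<close>

lemma regs_simps [simp]:
  "regs (tick k s) = regs s" "regs (set_reg r x s) = (regs s)(r := x)" "regs (set_cell a i x s) = regs s"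
  by (simp_all add: tick_def set_reg_def set_cell_def)

lemma arrays_simps [simp]:
  "arrays (tick k s) = arrays s" "arrays (set_reg r x s) = arrays s"
  "arrays (set_cell a i x s) = (arrays s)(a := (arrays s a)(i := x))"
  by (simp_all add: tick_def set_reg_def set_cell_def)

lemma time_simps [simp]:
  "time (tick k s) = time s + k" "time (set_reg r x s) = time s" "time (set_cell a i x s) = time s"
  by (simp_all add: tick_def set_reg_def set_cell_def)

lemma aval_tick [simp]: "aval M (tick k s) e = aval M s e"
  by (induction e) simp_all

lemma bval_tick [simp]: "bval M (tick k s) b = bval M s b"
  by (induction b) simp_all

lemma bind_spmf_map_spmf: "bind_spmf (map_spmf f p) g = bind_spmf p (\<lambda>x. g (f x))"
  by (simp add: map_spmf_conv_bind_spmf)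

text \<open>The semantics pays for the next guard at the end of the body, so \<open>loop\<close>
  runs on states whose guard is already paid for. Shifting this tick to the front of the next round
  gives the usual unfolding.\<close>

lemma exec_While:
  "exec M (While b c) s =
     (if bval M s b then bind_spmf (exec M c (tick (bcost b) s)) (exec M (While b c))
      else return_spmf (tick (bcost b) s))"
proof -
  define h where "h = (\<lambda>s. map_spmf (tick (bcost b)) (exec M c s))"
  have eq: "exec M (While b c) = (\<lambda>s. loop (\<lambda>s. bval M s b) h (tick (bcost b) s))"
    by (rule ext) (simp add: h_def)
  have "exec M (While b c) s = (if bval M s b
      then bind_spmf (h (tick (bcost b) s)) (loop (\<lambda>s. bval M s b) h)
      else return_spmf (tick (bcost b) s))"
    unfolding eq by (subst loop.simps) simp
  then show ?thesis
    unfolding eq by (simp add: h_def bind_spmf_map_spmf)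
qed

declare exec.simps(7) [simp del]

text \<open>Total correctness for a loop with deterministic body: a decreasing measure yields a
  point distribution. The last guard evaluation stays outside of \<open>I\<close>, so that
  invariants can bound the clock by completed rounds.\<close>

lemma exec_while_det:
  fixes m :: "state \<Rightarrow> nat"
  assumes "I s"
  assumes "\<And>s. I s \<Longrightarrow> bval M s b \<Longrightarrow>
    \<exists>s'. exec M c (tick (bcost b) s) = return_spmf s' \<and> I s' \<and> m s' < m s"
  shows "\<exists>s'. exec M (While b c) s = return_spmf (tick (bcost b) s') \<and> I s' \<and> \<not> bval M s' b"
  using assms(1)
proof (induction "m s" arbitrary: s rule: less_induct)
  case less
  show ?case
  proof (cases "bval M s b")
    case True
    from assms(2)[OF less.prems True] obtain s'
      where "exec M c (tick (bcost b) s) = return_spmf s'" "I s'" "m s' < m s" by blast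
    with less.hyps[of s'] True show ?thesis by (simp add: exec_While[of _ _ _ s])
  next
    case False
    with less.prems show ?thesis by (auto simp: exec_While[of _ _ _ s])
  qed
qed

section \<open>What a program text reads and writes\<close>

fun areads :: "aexp \<Rightarrow> nat set" where
  "areads (Const k) = {}"
| "areads (Reg r) = {}"
| "areads (Read a e) = insert a (areads e)"
| "areads (Plus e1 e2) = areads e1 \<union> areads e2"
| "areads (Minus e1 e2) = areads e1 \<union> areads e2"
| "areads (Times e1 e2) = areads e1 \<union> areads e2"
| "areads (Quot e1 e2) = areads e1 \<union> areads e2"
| "areads (Rem e1 e2) = areads e1 \<union> areads e2"

fun aregs :: "aexp \<Rightarrow> nat set" where
  "aregs (Const k) = {}"
| "aregs (Reg r) = {r}"
| "aregs (Read a e) = aregs e"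
| "aregs (Plus e1 e2) = aregs e1 \<union> aregs e2"
| "aregs (Minus e1 e2) = aregs e1 \<union> aregs e2"
| "aregs (Times e1 e2) = aregs e1 \<union> aregs e2"
| "aregs (Quot e1 e2) = aregs e1 \<union> aregs e2"
| "aregs (Rem e1 e2) = aregs e1 \<union> aregs e2"

fun breads :: "bexp \<Rightarrow> nat set" where
  "breads (Less e1 e2) = areads e1 \<union> areads e2"
| "breads (Equal e1 e2) = areads e1 \<union> areads e2"
| "breads (Neg b) = breads b"
| "breads (Conj b1 b2) = breads b1 \<union> breads b2"

fun bregs :: "bexp \<Rightarrow> nat set" where
  "bregs (Less e1 e2) = aregs e1 \<union> aregs e2"
| "bregs (Equal e1 e2) = aregs e1 \<union> aregs e2"
| "bregs (Neg b) = bregs b"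
| "bregs (Conj b1 b2) = bregs b1 \<union> bregs b2"

fun used_arrays :: "com \<Rightarrow> nat set" where
  "used_arrays Skip = {}"
| "used_arrays (Assign r e) = areads e"
| "used_arrays (Store a i e) = insert a (areads i \<union> areads e)"
| "used_arrays (Random r e) = areads e"
| "used_arrays (Seq c1 c2) = used_arrays c1 \<union> used_arrays c2"
| "used_arrays (Cond b c1 c2) = breads b \<union> used_arrays c1 \<union> used_arrays c2"
| "used_arrays (While b c) = breads b \<union> used_arrays c"

fun used_regs :: "com \<Rightarrow> nat set" where
  "used_regs Skip = {}"
| "used_regs (Assign r e) = insert r (aregs e)"
| "used_regs (Store a i e) = aregs i \<union> aregs e"
| "used_regs (Random r e) = insert r (aregs e)"
| "used_regs (Seq c1 c2) = used_regs c1 \<union> used_regs c2"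
| "used_regs (Cond b c1 c2) = bregs b \<union> used_regs c1 \<union> used_regs c2"
| "used_regs (While b c) = bregs b \<union> used_regs c"

fun written_arrays :: "com \<Rightarrow> nat set" where
  "written_arrays Skip = {}"
| "written_arrays (Assign r e) = {}"
| "written_arrays (Store a i e) = {a}"
| "written_arrays (Random r e) = {}"
| "written_arrays (Seq c1 c2) = written_arrays c1 \<union> written_arrays c2"
| "written_arrays (Cond b c1 c2) = written_arrays c1 \<union> written_arrays c2"
| "written_arrays (While b c) = written_arrays c"

fun written_regs :: "com \<Rightarrow> nat set" where
  "written_regs Skip = {}"
| "written_regs (Assign r e) = {r}"
| "written_regs (Store a i e) = {}"
| "written_regs (Random r e) = {r}"
| "written_regs (Seq c1 c2) = written_regs c1 \<union> written_regs c2"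
| "written_regs (Cond b c1 c2) = written_regs c1 \<union> written_regs c2"
| "written_regs (While b c) = written_regs c"

text \<open>Fixpoint induction over the approximations of \<open>loop\<close> needs no termination,
  so the invariant holds in every outcome even if the loop diverges with positive
  probability.\<close>

lemma loop_invariant:
  assumes "P s" "\<And>s s'. P s \<Longrightarrow> s' \<in> set_spmf (f s) \<Longrightarrow> P s'"
  shows "\<forall>s' \<in> set_spmf (loop g f s). P s'"
proof -
  have "\<forall>s. P s \<longrightarrow> (\<forall>s' \<in> set_spmf (loop g f s). P s')"
  proof (induction rule: loop.fixp_induct)
    case 1
    show ?case by (intro admissible_all) simp
  next
    case 2
    show ?case by simp
  next
    case (3 loop')
    show ?case
    proof (intro allI impI ballI)
      fix s s' assume "P s" and s': "s' \<in> set_spmf (if g s then bind_spmf (f s) (loop' g f) else return_spmf s)"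
      show "P s'"
      proof (cases "g s")
        case True
        with s' obtain t where t: "t \<in> set_spmf (f s)" "s' \<in> set_spmf (loop' g f t)"
          by (auto simp: set_bind_spmf)
        have "P t" by (rule assms(2)[OF \<open>P s\<close> t(1)])
        with 3 t(2) show ?thesis by blast
      next
        case False
        with s' \<open>P s\<close> show ?thesis by simp
      qed
    qed
  qed
  with assms(1) show ?thesis by blast
qed

text \<open>Spares many preservation clauses later on: the constants of the structure, the operands
  of an update and, during the level phase, the colors survive because the program text does not
  write to them.\<close>

lemma exec_frame:
  assumes "s' \<in> set_spmf (exec M c s)"
  shows "(\<forall>r. r \<notin> written_regs c \<longrightarrow> regs s' r = regs s r) \<and>
         (\<forall>a. a \<notin> written_arrays c \<longrightarrow> arrays s' a = arrays s a)"
  using assms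
proof (induction c arbitrary: s s')
  case (Seq c1 c2)
  from Seq.prems obtain t where t: "t \<in> set_spmf (exec M c1 s)" "s' \<in> set_spmf (exec M c2 t)"
    by (auto simp: set_bind_spmf)
  from Seq.IH(1)[OF t(1)] Seq.IH(2)[OF t(2)] show ?case by simp
next
  case (While b c)
  define P where "P = (\<lambda>s' :: state. (\<forall>r. r \<notin> written_regs (While b c) \<longrightarrow> regs s' r = regs s r) \<and>
         (\<forall>a. a \<notin> written_arrays (While b c) \<longrightarrow> arrays s' a = arrays s a))"
  have "\<forall>s' \<in> set_spmf (loop (\<lambda>s. bval M s b)
      (\<lambda>s. map_spmf (tick (bcost b)) (exec M c s)) (tick (bcost b) s)). P s'"
  proof (rule loop_invariant)
    show "P (tick (bcost b) s)" by (simp add: P_def)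
    fix t t' assume "P t" "t' \<in> set_spmf (map_spmf (tick (bcost b)) (exec M c t))"
    then obtain t'' where "t'' \<in> set_spmf (exec M c t)" "t' = tick (bcost b) t''" by auto
    with While.IH[OF this(1)] \<open>P t\<close> show "P t'" by (auto simp: P_def)
  qed
  with While.prems show ?case by (auto simp: P_def exec.simps(7))
qed (auto split: if_splits)

text \<open>Noninterference: a program commutes with replacing the storage it does not use.\<close>

definition overlay :: "nat set \<Rightarrow> nat set \<Rightarrow> state \<Rightarrow> nat \<Rightarrow> state \<Rightarrow> state" where
  "overlay RS AS t k s = \<lparr>regs = (\<lambda>r. if r \<in> RS then regs s r else regs t r),
     arrays = (\<lambda>a. if a \<in> AS then arrays s a else arrays t a), time = time s + k\<rparr>"

lemma overlay_sel [simp]: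
  "regs (overlay RS AS t k s) = (\<lambda>r. if r \<in> RS then regs s r else regs t r)"
  "arrays (overlay RS AS t k s) = (\<lambda>a. if a \<in> AS then arrays s a else arrays t a)"
  "time (overlay RS AS t k s) = time s + k"
  by (simp_all add: overlay_def)

lemma state_eqI: "regs s = regs t \<Longrightarrow> arrays s = arrays t \<Longrightarrow> time s = time t \<Longrightarrow> s = (t :: state)"
  by (cases s; cases t) auto

lemma overlay_tick [simp]: "overlay RS AS t k (tick j s) = tick j (overlay RS AS t k s)"
  by (rule state_eqI) auto

lemma overlay_set_reg: "r \<in> RS \<Longrightarrow> overlay RS AS t k (set_reg r x s) = set_reg r x (overlay RS AS t k s)"
  by (rule state_eqI) auto

lemma overlay_set_cell: "a \<in> AS \<Longrightarrow> overlay RS AS t k (set_cell a i x s) = set_cell a i x (overlay RS AS t k s)"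
  by (rule state_eqI) auto

lemma aval_overlay:
  "aregs e \<subseteq> RS \<Longrightarrow> areads e \<subseteq> AS \<Longrightarrow> aval M (overlay RS AS t k s) e = aval M s e"
  by (induction e) auto

lemma bval_overlay:
  "bregs b \<subseteq> RS \<Longrightarrow> breads b \<subseteq> AS \<Longrightarrow> bval M (overlay RS AS t k s) b = bval M s b"
  by (induction b) (auto simp: aval_overlay)

text \<open>\<open>loop\<close> is a least fixed point, so the equation is split into two
  approximation orders. In each, fixpoint induction on one side is matched with one unfolding
  (\<open>A\<close> or \<open>B\<close>) of the other.\<close>

lemma loop_map:
  assumes g: "\<And>s. g (h s) = g s" and f: "\<And>s. f (h s) = map_spmf h (f s)"
  shows "loop g f (h s) = map_spmf h (loop g f s)"
proof (rule spmf.leq_antisym)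
  define A where "A = (\<lambda>s. loop g f (h s))"
  define B where "B = (\<lambda>s. map_spmf h (loop g f s))"
  have A: "A s = (if g s then bind_spmf (f s) A else return_spmf (h s))" for s
    unfolding A_def by (subst loop.simps) (simp add: f g bind_spmf_map_spmf)
  have B: "B s = (if g s then bind_spmf (f s) B else return_spmf (h s))" for s
    unfolding B_def by (subst loop.simps) (simp add: map_spmf_bind_spmf o_def)
  have "\<forall>s. ord_spmf (=) (loop g f (h s)) (B s)"
  proof (induction rule: loop.fixp_induct)
    case (3 loop')
    then show ?case
      by (subst B) (simp add: g f bind_spmf_map_spmf ord_spmf_bind_reflI)
  qed simp_all
  then show "ord_spmf (=) (loop g f (h s)) (map_spmf h (loop g f s))" by (simp add: B_def)
  have "\<forall>s. ord_spmf (=) (map_spmf h (loop g f s)) (A s)"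
  proof (induction rule: loop.fixp_induct)
    case (3 loop')
    then show ?case
      by (subst A) (simp add: map_spmf_bind_spmf o_def ord_spmf_bind_reflI)
  qed simp_all
  then show "ord_spmf (=) (map_spmf h (loop g f s)) (loop g f (h s))" by (simp add: A_def)
qed

lemma exec_overlay:
  assumes "used_regs c \<subseteq> RS" "used_arrays c \<subseteq> AS"
  shows "exec M c (overlay RS AS t k s) = map_spmf (overlay RS AS t k) (exec M c s)"
  using assms
proof (induction c arbitrary: s)
  case (Random r e)
  then show ?case
    by (auto simp: aval_overlay overlay_set_reg spmf.map_comp o_def)
next
  case (Seq c1 c2)
  then show ?case by (simp add: bind_spmf_map_spmf map_spmf_bind_spmf o_def)
next
  case (Cond b c1 c2)
  then show ?case by (simp add: bval_overlay flip: overlay_tick)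
next
  case (While b c)
  then show ?case
    unfolding exec.simps(7) overlay_tick[symmetric]
    by (intro loop_map) (simp_all add: bval_overlay spmf.map_comp o_def)
qed (auto simp: aval_overlay overlay_set_reg overlay_set_cell)

text \<open>If two states agree on the storage that \<open>c\<close> uses, one is an overlay of the
  other, and by \<open>exec_overlay\<close> so are the results. This will show that the levels are
  the same in all random outcomes.\<close>

lemma exec_low_determined:
  assumes "used_regs c \<subseteq> RS" "used_arrays c \<subseteq> AS"
  assumes "exec M c s = return_spmf s'" "exec M c t = return_spmf t'"
  assumes "\<forall>r\<in>RS. regs s r = regs t r" "\<forall>a\<in>AS. arrays s a = arrays t a"
  shows "(\<forall>r\<in>RS. regs s' r = regs t' r) \<and> (\<forall>a\<in>AS. arrays s' a = arrays t' a)"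
proof -
  \<comment> \<open>An overlay can only advance the clock, so the state with the smaller clock has
    to be the base; the other order follows by symmetry.\<close>
  have *: "(\<forall>r\<in>RS. regs s' r = regs t' r) \<and> (\<forall>a\<in>AS. arrays s' a = arrays t' a)"
    if "time s \<le> time t" "exec M c s = return_spmf s'" "exec M c t = return_spmf t'"
      "\<forall>r\<in>RS. regs s r = regs t r" "\<forall>a\<in>AS. arrays s a = arrays t a" for s t s' t'
  proof -
    have "t = overlay RS AS t (time t - time s) s"
      using that by (intro state_eqI) auto
    then have "exec M c t = map_spmf (overlay RS AS t (time t - time s)) (exec M c s)"
      using exec_overlay[OF assms(1,2)] by metis
    with that(2,3) have "return_spmf t' = return_spmf (overlay RS AS t (time t - time s) s')"
      by simp
    then have "t' = overlay RS AS t (time t - time s) s'" by simp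
    then show ?thesis by simp
  qed
  show ?thesis
  proof (cases "time s \<le> time t")
    case True
    then show ?thesis using * assms by blast
  next
    case False
    have "(\<forall>r\<in>RS. regs t' r = regs s' r) \<and> (\<forall>a\<in>AS. arrays t' a = arrays s' a)"
      using False assms(3-6) by (intro *[of t s]) auto
    then show ?thesis by auto
  qed
qed

section \<open>Indexed sets in arrays\<close>

text \<open>Row-major addressing. Nesting it, \<open>ix N (ix N r b) i\<close>, addresses position
  \<open>i\<close> of set \<open>b\<close> in row \<open>r\<close>, so that a single
  \<open>N\<close> has to exceed rows, sets, elements and positions.\<close>

definition ix :: "nat \<Rightarrow> nat \<Rightarrow> nat \<Rightarrow> nat" where
  "ix N r b = r * N + b"

lemma ix_eq_iff:
  assumes "b < N" "b' < N"
  shows "ix N r b = ix N r' b' \<longleftrightarrow> r = r' \<and> b = b'"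
proof
  assume eq: "ix N r b = ix N r' b'"
  have "ix N r b div N = r" "ix N r b mod N = b" "ix N r' b' div N = r'" "ix N r' b' mod N = b'"
    using assms by (simp_all add: ix_def)
  with eq show "r = r' \<and> b = b'" by metis
qed simp

lemma ix_less:
  assumes "r < A" "b < N"
  shows "ix N r b < A * N"
proof -
  have "r * N + b < Suc r * N" using assms by simp
  also have "\<dots> \<le> A * N" using assms(1) by (intro mult_le_mono1) simp
  finally show ?thesis by (simp add: ix_def)
qed

text \<open>Row \<open>r\<close> is a family of disjoint sets: \<open>bk r w = Some b\<close> says that \<open>w\<close> is in the set
  \<open>b\<close> of the row. The set is listed in \<open>Ls\<close>, with \<open>C\<close> its size, and \<open>P\<close> gives the position of
  \<open>w\<close> in the list. Positions of absent elements are arbitrary, so that a set is cleared by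
  resetting its size.\<close>

definition rep :: "nat \<Rightarrow> nat \<Rightarrow> (nat \<Rightarrow> nat) \<Rightarrow> (nat \<Rightarrow> nat) \<Rightarrow> (nat \<Rightarrow> nat) \<Rightarrow>
    (nat \<Rightarrow> nat \<Rightarrow> nat option) \<Rightarrow> bool" where
  "rep n N C Ls P bk \<longleftrightarrow>
     (\<forall>r<N. \<forall>w b. bk r w = Some b \<longrightarrow>
        w < n \<and> b < N \<and> P (ix N r w) < C (ix N r b) \<and> Ls (ix N (ix N r b) (P (ix N r w))) = w) \<and>
     (\<forall>r<N. \<forall>b<N. \<forall>i<C (ix N r b).
        bk r (Ls (ix N (ix N r b) i)) = Some b \<and> P (ix N r (Ls (ix N (ix N r b) i))) = i)"

context
  fixes n N :: nat and C Ls P :: "nat \<Rightarrow> nat" and bk :: "nat \<Rightarrow> nat \<Rightarrow> nat option"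
  assumes rep: "rep n N C Ls P bk"
begin

lemma rep_bucket:
  assumes "r < N" "bk r w = Some b"
  shows "w < n" "b < N" "P (ix N r w) < C (ix N r b)" "Ls (ix N (ix N r b) (P (ix N r w))) = w"
  using rep assms unfolding rep_def by blast+

lemma rep_index:
  assumes "r < N" "b < N" "i < C (ix N r b)"
  shows "bk r (Ls (ix N (ix N r b) i)) = Some b" "P (ix N r (Ls (ix N (ix N r b) i))) = i"
    "Ls (ix N (ix N r b) i) < n"
  using rep assms rep_bucket(1) unfolding rep_def by blast+

text \<open>The positions invert the list; this turns the stored counter into the cardinality of the
  set.\<close>

lemma rep_bij:
  assumes "r < N" "b < N"
  shows "bij_betw (\<lambda>i. Ls (ix N (ix N r b) i)) {..<C (ix N r b)} {w. bk r w = Some b}"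
proof (rule bij_betwI[where g = "\<lambda>w. P (ix N r w)"])
  show "(\<lambda>i. Ls (ix N (ix N r b) i)) \<in> {..<C (ix N r b)} \<rightarrow> {w. bk r w = Some b}"
    using rep_index[OF assms] by auto
  show "(\<lambda>w. P (ix N r w)) \<in> {w. bk r w = Some b} \<rightarrow> {..<C (ix N r b)}"
    using rep_bucket[OF assms(1)] by auto
qed (use rep_index[OF assms] rep_bucket[OF assms(1)] in auto)

lemma rep_count:
  assumes "r < N" "b < N"
  shows "C (ix N r b) = card {w. bk r w = Some b}" "C (ix N r b) \<le> n" "finite {w. bk r w = Some b}"
proof -
  show *: "C (ix N r b) = card {w. bk r w = Some b}"
    using bij_betw_same_card[OF rep_bij[OF assms]] by simp
  have sub: "{w. bk r w = Some b} \<subseteq> {..<n}" using rep_bucket[OF assms(1)] by auto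
  show "C (ix N r b) \<le> n" using card_mono[OF _ sub] * by simp
  show "finite {w. bk r w = Some b}" using sub finite_subset by blast
qed

text \<open>The sparse set trick: the position of an absent element may be garbage, so it is
  believed only if it lies inside the list and the list entry there points back.\<close>

lemma rep_mem_test:
  assumes "r < N" "b < N" "w < n"
  shows "P (ix N r w) < C (ix N r b) \<and> Ls (ix N (ix N r b) (P (ix N r w))) = w \<longleftrightarrow> bk r w = Some b"
  using rep_bucket(3,4)[OF assms(1), of w b] rep_index(1)[OF assms(1,2), of "P (ix N r w)"] by auto

text \<open>There is one position cell per row and element, not per set; hence the element must be
  in no set of the row.\<close>

lemma rep_add:
  assumes "n < N" "R < N" "W < n" "B < N" "bk R W = None"
  shows "rep n N (C(ix N R B := Suc (C (ix N R B)))) (Ls(ix N (ix N R B) (C (ix N R B)) := W))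
    (P(ix N R W := C (ix N R B))) (bk(R := (bk R)(W := Some B)))" (is "rep n N ?C ?L ?P ?bk")
  unfolding rep_def
proof (intro conjI allI impI)
  have CN: "C (ix N r b) < N" if "r < N" "b < N" for r b
    using rep_count(2)[OF that] assms(1) by simp
  have WN: "W < N" using assms by simp
  { fix r w b assume r: "r < N" and "?bk r w = Some b"
    then have "(r = R \<and> w = W \<and> b = B) \<or> (bk r w = Some b \<and> (r, w) \<noteq> (R, W))"
      by (auto split: if_splits)
    then have "w < n \<and> b < N \<and> ?P (ix N r w) < ?C (ix N r b) \<and> ?L (ix N (ix N r b) (?P (ix N r w))) = w"
    proof (elim disjE conjE)
      assume b: "bk r w = Some b" and ne: "(r, w) \<noteq> (R, W)"
      note bb = rep_bucket[OF r b]
      have wN: "w < N" using bb(1) assms(1) by simp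
      have PN: "P (ix N r w) < N" using bb(3) CN[OF r bb(2)] by simp
      have P: "?P (ix N r w) = P (ix N r w)" using ne ix_eq_iff[OF wN WN] by auto
      have "ix N (ix N r b) (P (ix N r w)) \<noteq> ix N (ix N R B) (C (ix N R B))"
        using ix_eq_iff[OF PN CN[OF assms(2,4)]] bb(3) by auto
      then show ?thesis using bb P by auto
    qed (use assms in auto) }
  then show "?bk r w = Some b \<Longrightarrow> w < n" "?bk r w = Some b \<Longrightarrow> b < N"
    "?bk r w = Some b \<Longrightarrow> ?P (ix N r w) < ?C (ix N r b)"
    "?bk r w = Some b \<Longrightarrow> ?L (ix N (ix N r b) (?P (ix N r w))) = w" if "r < N" for r w b
    using that by blast+
  { fix r b i assume r: "r < N" and b: "b < N" and i: "i < ?C (ix N r b)"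
    have "?bk r (?L (ix N (ix N r b) i)) = Some b \<and> ?P (ix N r (?L (ix N (ix N r b) i))) = i"
    proof (cases "r = R \<and> b = B \<and> i = C (ix N R B)")
      case True
      then show ?thesis by simp
    next
      case False
      have i': "i < C (ix N r b)" using i False ix_eq_iff[OF b assms(4)] by (auto split: if_splits)
      have iN: "i < N" using i' CN[OF r b] by simp
      have L: "?L (ix N (ix N r b) i) = Ls (ix N (ix N r b) i)"
        using ix_eq_iff[OF iN CN[OF assms(2,4)]] ix_eq_iff[OF b assms(4)] False by auto
      note ii = rep_index[OF r b i']
      have ne: "(r, Ls (ix N (ix N r b) i)) \<noteq> (R, W)" using ii(1) assms(5) by auto
      have "Ls (ix N (ix N r b) i) < N" using ii(3) assms(1) by simp
      then have "?P (ix N r (Ls (ix N (ix N r b) i))) = P (ix N r (Ls (ix N (ix N r b) i)))"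
        using ne ix_eq_iff[OF _ WN] by auto
      then show ?thesis using L ii ne by auto
    qed }
  then show "i < ?C (ix N r b) \<Longrightarrow> ?bk r (?L (ix N (ix N r b) i)) = Some b"
    "i < ?C (ix N r b) \<Longrightarrow> ?P (ix N r (?L (ix N (ix N r b) i))) = i"
    if "r < N" "b < N" for r b i using that by blast+
qed

text \<open>The last entry \<open>x\<close> fills the gap. If \<open>W\<close> is itself the last
  entry, then \<open>x = W\<close> and only the counter really changes.\<close>

lemma rep_remove:
  assumes "n < N" "R < N" "bk R W = Some B"
  defines "x \<equiv> Ls (ix N (ix N R B) (C (ix N R B) - 1))"
  shows "rep n N (C(ix N R B := C (ix N R B) - 1)) (Ls(ix N (ix N R B) (P (ix N R W)) := x))
    (P(ix N R x := P (ix N R W))) (bk(R := (bk R)(W := None)))" (is "rep n N ?C ?L ?P ?bk")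
  unfolding rep_def
proof (intro conjI allI impI)
  let ?p = "P (ix N R W)" and ?c = "C (ix N R B)"
  have CN: "C (ix N r b) < N" if "r < N" "b < N" for r b
    using rep_count(2)[OF that] assms(1) by simp
  note W = rep_bucket[OF assms(2,3)]
  have WN: "W < N" and BN: "B < N" using W assms(1) by auto
  have c: "?c - 1 < ?c" "?c < N" using W(3) CN[OF assms(2) BN] by auto
  note x = rep_index[OF assms(2) BN c(1), folded x_def]
  have xN: "x < N" using x(3) assms(1) by simp
  have pN: "?p < N" using W(3) c by simp
  { fix r w b assume r: "r < N" and bk': "?bk r w = Some b"
    then have b: "bk r w = Some b" and ne: "(r, w) \<noteq> (R, W)" by (auto split: if_splits)
    note bb = rep_bucket[OF r b]
    have wN: "w < N" using bb(1) assms(1) by simp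
    have PN: "P (ix N r w) < N" using bb(3) CN[OF r bb(2)] by simp
    have "w < n \<and> b < N \<and> ?P (ix N r w) < ?C (ix N r b) \<and> ?L (ix N (ix N r b) (?P (ix N r w))) = w"
    proof (cases "r = R \<and> w = x")
      case True
      then have bB: "b = B" using b x by auto
      have "?p \<noteq> ?c - 1"
      proof
        assume "?p = ?c - 1"
        then have "x = W" using W(4) by (simp add: x_def)
        then show False using ne True by simp
      qed
      then have "?p < ?c - 1" using W(3) by simp
      then show ?thesis using True bB bb(1) BN by simp
    next
      case False
      have P: "?P (ix N r w) = P (ix N r w)" using False ix_eq_iff[OF wN xN] by auto
      have Pb: "P (ix N r w) < ?c - 1" if "r = R" "b = B"
      proof -
        have "P (ix N r w) \<noteq> ?c - 1" using that False bb(4) by (auto simp: x_def)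
        then show ?thesis using bb(3) that by simp
      qed
      have "ix N (ix N r b) (P (ix N r w)) \<noteq> ix N (ix N R B) ?p"
      proof
        assume "ix N (ix N r b) (P (ix N r w)) = ix N (ix N R B) ?p"
        then have "r = R" "b = B" "P (ix N r w) = ?p"
          using ix_eq_iff[OF PN pN] ix_eq_iff[OF bb(2) BN] by auto
        then have "w = W" using bb(4) W(4) by metis
        then show False using ne \<open>r = R\<close> by simp
      qed
      then show ?thesis using bb P Pb ix_eq_iff[OF bb(2) BN] by auto
    qed }
  then show "?bk r w = Some b \<Longrightarrow> w < n" "?bk r w = Some b \<Longrightarrow> b < N"
    "?bk r w = Some b \<Longrightarrow> ?P (ix N r w) < ?C (ix N r b)"
    "?bk r w = Some b \<Longrightarrow> ?L (ix N (ix N r b) (?P (ix N r w))) = w" if "r < N" for r w b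
    using that by blast+
  { fix r b i assume r: "r < N" and b: "b < N" and i: "i < ?C (ix N r b)"
    have i': "i < C (ix N r b)" using i by (auto split: if_splits)
    have iN: "i < N" using i' CN[OF r b] by simp
    note ii = rep_index[OF r b i']
    have lN: "Ls (ix N (ix N r b) i) < N" using ii(3) assms(1) by simp
    have "?bk r (?L (ix N (ix N r b) i)) = Some b \<and> ?P (ix N r (?L (ix N (ix N r b) i))) = i"
    proof (cases "r = R \<and> b = B \<and> i = ?p")
      case True
      then have "?p < ?c - 1" using i by simp
      have "x \<noteq> W" using x(2) \<open>?p < ?c - 1\<close> by auto
      then show ?thesis using True x by simp
    next
      case False
      have L: "?L (ix N (ix N r b) i) = Ls (ix N (ix N r b) i)"
        using ix_eq_iff[OF iN pN] ix_eq_iff[OF b BN] False by auto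
      have ne: "(r, Ls (ix N (ix N r b) i)) \<noteq> (R, W)"
      proof
        assume "(r, Ls (ix N (ix N r b) i)) = (R, W)"
        then show False using ii assms(3) False by auto
      qed
      have "(r, Ls (ix N (ix N r b) i)) \<noteq> (R, x)"
      proof
        assume eq: "(r, Ls (ix N (ix N r b) i)) = (R, x)"
        then have "b = B" "i = ?c - 1" using ii x by auto
        then show False using i eq by simp
      qed
      then have "?P (ix N r (Ls (ix N (ix N r b) i))) = P (ix N r (Ls (ix N (ix N r b) i)))"
        using ix_eq_iff[OF lN xN] by auto
      then show ?thesis using L ii ne by auto
    qed }
  then show "i < ?C (ix N r b) \<Longrightarrow> ?bk r (?L (ix N (ix N r b) i)) = Some b"
    "i < ?C (ix N r b) \<Longrightarrow> ?P (ix N r (?L (ix N (ix N r b) i))) = i"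
    if "r < N" "b < N" for r b i using that by blast+
qed

lemma rep_clear:
  assumes "n < N" "R < N" "B < N"
  shows "rep n N (C(ix N R B := 0)) Ls P
    (bk(R := (\<lambda>w. if bk R w = Some B then None else bk R w)))" (is "rep n N ?C Ls P ?bk")
  unfolding rep_def
proof (intro conjI allI impI)
  { fix r w b assume r: "r < N" and "?bk r w = Some b"
    then have b: "bk r w = Some b" and ne: "(r, b) \<noteq> (R, B)" by (auto split: if_splits)
    note bb = rep_bucket[OF r b]
    have "w < n \<and> b < N \<and> P (ix N r w) < ?C (ix N r b) \<and> Ls (ix N (ix N r b) (P (ix N r w))) = w"
      using bb ne ix_eq_iff[OF bb(2) assms(3)] by auto }
  then show "?bk r w = Some b \<Longrightarrow> w < n" "?bk r w = Some b \<Longrightarrow> b < N"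
    "?bk r w = Some b \<Longrightarrow> P (ix N r w) < ?C (ix N r b)"
    "?bk r w = Some b \<Longrightarrow> Ls (ix N (ix N r b) (P (ix N r w))) = w" if "r < N" for r w b
    using that by blast+
  { fix r b i assume r: "r < N" and b: "b < N" and i: "i < ?C (ix N r b)"
    then have ne: "(r, b) \<noteq> (R, B)" and i': "i < C (ix N r b)" by (auto split: if_splits)
    from ne rep_index[OF r b i']
    have "?bk r (Ls (ix N (ix N r b) i)) = Some b \<and> P (ix N r (Ls (ix N (ix N r b) i))) = i"
      by auto }
  then show "i < ?C (ix N r b) \<Longrightarrow> ?bk r (Ls (ix N (ix N r b) i)) = Some b"
    "i < ?C (ix N r b) \<Longrightarrow> P (ix N r (Ls (ix N (ix N r b) i))) = i"
    if "r < N" "b < N" for r b i using that by blast+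
qed

end

lemma tick_normal [simp]:
  "set_cell a i x (tick k s) = tick k (set_cell a i x s)"
  "set_reg r x (tick k s) = tick k (set_reg r x s)"
  "tick j (tick k s) = tick (k + j) s"
  "set_reg r x (set_reg r y s) = set_reg r x s"
  by (rule state_eqI; simp)+

section \<open>The programs\<close>

definition row_e :: "nat \<Rightarrow> aexp \<Rightarrow> aexp" where
  "row_e r e = Plus (Times (Reg r) (Reg 4)) e"

definition cnt_e :: "nat \<Rightarrow> nat \<Rightarrow> aexp" where
  "cnt_e r b = Read 2 (row_e r (Reg b))"

definition pos_e :: "nat \<Rightarrow> nat \<Rightarrow> aexp" where
  "pos_e r w = Read 4 (row_e r (Reg w))"

definition slot_e :: "nat \<Rightarrow> nat \<Rightarrow> aexp \<Rightarrow> aexp" where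
  "slot_e r b i = Plus (Times (row_e r (Reg b)) (Reg 4)) i"

definition add_com :: "nat \<Rightarrow> nat \<Rightarrow> nat \<Rightarrow> com" where
  "add_com r b w =
     Seq (Store 3 (slot_e r b (cnt_e r b)) (Reg w))
    (Seq (Store 4 (row_e r (Reg w)) (cnt_e r b))
         (Store 2 (row_e r (Reg b)) (Plus (cnt_e r b) (Const 1))))"

definition remove_com :: "nat \<Rightarrow> nat \<Rightarrow> nat \<Rightarrow> com" where
  "remove_com r b w = (let last = Read 3 (slot_e r b (Minus (cnt_e r b) (Const 1))) in
     Seq (Store 3 (slot_e r b (pos_e r w)) last)
    (Seq (Store 4 (row_e r last) (pos_e r w))
         (Store 2 (row_e r (Reg b)) (Minus (cnt_e r b) (Const 1)))))"

definition insert_com :: "nat \<Rightarrow> nat \<Rightarrow> nat \<Rightarrow> com" where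
  "insert_com r b w =
     Cond (Conj (Less (pos_e r w) (cnt_e r b)) (Equal (Read 3 (slot_e r b (pos_e r w))) (Reg w)))
       Skip (add_com r b w)"

text \<open>Array 1 holds the levels, arrays 2, 3, 4 hold the indexed sets, array 5 the thresholds and
  array 6 the palette offsets of the levels, array 9 is scratch space. An edge is stored, at both
  ends, in the set given by the smaller level of its end points. Row \<open>n\<close> (register 3) is the
  worklist and row \<open>n + 1\<close> (register 6) collects the vertices that have changed their level;
  register 7 is always zero. Vertex \<open>10\<close> moves from level \<open>11\<close> to level \<open>13\<close>.\<close>

definition copy_com :: com where
  "copy_com =
     Seq (Assign 14 (Const 0))
         (While (Less (Reg 14) (Reg 12))
           (Seq (Store 9 (Reg 14) (Read 3 (slot_e 10 11 (Reg 14))))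
                (Assign 14 (Plus (Reg 14) (Const 1)))))"

definition relocate_body :: com where
  "relocate_body =
     Seq (Assign 14 (Minus (Reg 14) (Const 1)))
    (Seq (Assign 15 (Read 9 (Reg 14)))
    (Seq (Assign 16 (Read 1 (Reg 15)))
    (Seq (Cond (Less (Reg 13) (Reg 16)) (Assign 16 (Reg 13)) Skip)
    (Seq (remove_com 10 11 15)
    (Seq (add_com 10 16 15)
    (Seq (remove_com 15 11 10)
    (Seq (add_com 15 16 10)
         (insert_com 3 7 15))))))))"

definition move_com :: com where
  "move_com =
     Seq copy_com
    (Seq (Store 1 (Reg 10) (Reg 13))
    (Seq (insert_com 6 7 10)
    (Seq (insert_com 3 7 10)
         (While (Less (Const 0) (Reg 14)) relocate_body))))"

text \<open>The vertex leaves the worklist before it is tested; \<open>move_com\<close> puts it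
  back, since one step may not be enough to make it stable.\<close>

definition settle_body :: com where
  "settle_body =
     Seq (Assign 10 (Read 3 (slot_e 3 7 (Minus (cnt_e 3 7) (Const 1)))))
    (Seq (remove_com 3 7 10)
    (Seq (Assign 11 (Read 1 (Reg 10)))
    (Seq (Assign 12 (cnt_e 10 11))
    (Seq (Assign 13 (Reg 11))
    (Seq (Cond (Less (Times (Const 3) (Read 5 (Reg 11))) (Reg 12))
           (Assign 13 (Plus (Reg 11) (Const 1)))
           (Cond (Less (Const 0) (Reg 11))
             (Seq (Assign 16 (Minus (Reg 11) (Const 1)))
               (Cond (Less (Plus (Reg 12) (cnt_e 10 16)) (Read 5 (Reg 16)))
                  (Assign 13 (Reg 16)) Skip))
             Skip))
         (Cond (Equal (Reg 13) (Reg 11)) Skip move_com))))))"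

definition settle_com :: com where
  "settle_com = While (Less (Const 0) (cnt_e 3 7)) settle_body"

text \<open>The flags of the previous update are cleared here and not after the recoloring, so that
  between updates a leftover set of flags remains in the books.\<close>

definition edge_com :: com where
  "edge_com =
     Seq (Store 2 (row_e 6 (Reg 7)) (Const 0))
    (Seq (Assign 16 (Read 1 (Reg 1)))
    (Seq (Cond (Less (Read 1 (Reg 2)) (Reg 16)) (Assign 16 (Read 1 (Reg 2))) Skip)
    (Seq (Cond (Equal (Reg 0) (Const 1))
            (Seq (add_com 1 16 2) (add_com 2 16 1))
            (Seq (remove_com 1 16 2) (remove_com 2 16 1)))
    (Seq (insert_com 3 7 1) (insert_com 3 7 2)))))"

text \<open>\<open>L\<close> is the bit length of \<open>n\<close>. A word must hold addresses below
  \<open>N ^ 3 = (n + 1) ^ 6\<close> and colors below \<open>8 * n * N\<close>; the exponent 10 is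
  generous.\<close>

locale level_params =
  fixes n L M :: nat
  assumes n2: "2 \<le> n" and n_less: "n < 2 ^ L" and pow_le: "2 ^ L \<le> 2 * n"
    and M_ge: "(n + 1) ^ 10 \<le> M"
begin

text \<open>Rows go up to \<open>n + 1\<close>, the sets of a vertex are numbered by levels up to
  \<open>K = L * L \<le> n * n\<close>, elements and positions do not exceed \<open>n\<close>; the
  square of \<open>n + 1\<close> is larger than all of them.\<close>

definition N :: nat where "N = (n + 1)\<^sup>2"
definition K :: nat where "K = L * L"
definition T :: "nat \<Rightarrow> nat" where "T l = 2 ^ (l div L)"
definition off :: "nat \<Rightarrow> nat" where "off l = (\<Sum>j<l. 4 * T j)"

lemma L_pos: "0 < L" using n2 n_less by (cases L) auto

lemma L_le: "L \<le> n"
proof (rule ccontr)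
  assume "\<not> L \<le> n"
  then have "2 ^ Suc n \<le> (2 ^ L :: nat)" by (intro power_increasing) auto
  then have "2 ^ n \<le> n" using pow_le by simp
  then show False using less_exp[of n] by simp
qed

lemma n_less_N: "n < N" "n + 1 < N"
proof -
  have "n + 1 < (n + 1) * (n + 1)" using n2 by simp
  then show "n + 1 < N" by (simp only: N_def power2_eq_square)
  then show "n < N" by simp
qed

lemma K_less_N: "K < N" "Suc K < N"
proof -
  have "K \<le> n * n" using L_le by (simp add: K_def mult_le_mono)
  moreover have "Suc (n * n) < N" using n2 by (simp add: N_def power2_eq_square)
  ultimately show "Suc K < N" by linarith
  then show "K < N" by simp
qed

lemma N_pos: "0 < N" using n_less_N by simp

text \<open>The overflow conditions in one place: \<open>100\<close> covers the literals in the
  programs, powers of \<open>N\<close> the addresses, \<open>8 * n * N\<close> the thresholds and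
  palette offsets.\<close>

lemma N3_less_M: "N ^ 3 < M" "100 \<le> M" "N \<le> M" "N * N \<le> M" "N * N * N \<le> M" "8 * n * N < M"
proof -
  have a: "N ^ 3 = (n + 1) ^ 6" by (simp add: N_def flip: power_mult)
  have b: "(n + 1) ^ 6 < (n + 1) ^ 10" using n2 by (intro power_strict_increasing) auto
  show "N ^ 3 < M" using a b M_ge by linarith
  have "3 ^ 10 \<le> (n + 1) ^ 10" using n2 by (intro power_mono) auto
  then show "100 \<le> M" using M_ge by simp
  have 1: "N * N * N \<le> M" using \<open>N ^ 3 < M\<close> by (simp add: power3_eq_cube)
  have 2: "N * N \<le> N * N * N" "N \<le> N * N" using N_pos by auto
  show "N * N * N \<le> M" "N * N \<le> M" "N \<le> M" using 1 2 by linarith+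
  have "8 * n * N \<le> 3 ^ 2 * (n + 1) * N" by (intro mult_le_mono) auto
  also have "\<dots> \<le> (n + 1) ^ 2 * (n + 1) * N" using n2 by (intro mult_le_mono power_mono) auto
  also have "\<dots> = (n + 1) ^ 5"
  proof -
    have "x ^ 2 * x * x ^ 2 = x ^ 5" for x :: nat by (simp add: eval_nat_numeral)
    then show ?thesis by (simp only: N_def)
  qed
  also have "\<dots> < (n + 1) ^ 10" using n2 by (intro power_strict_increasing) auto
  finally show "8 * n * N < M" using M_ge by simp
qed

lemma ix_less_M [simp]: "r < N \<Longrightarrow> b < N \<Longrightarrow> r * N + b < M"
  using ix_less[of r N b N] N3_less_M(4) by (simp add: ix_def)

lemma ix3_less_M [simp]: "r < N \<Longrightarrow> b < N \<Longrightarrow> i < N \<Longrightarrow> (r * N + b) * N + i < M"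
  using ix_less[OF ix_less[of r N b N], of i N] N3_less_M(5) by (simp add: ix_def)

lemma T_pos [simp]: "0 < T l" by (simp add: T_def)

lemma T_mono: "l \<le> l' \<Longrightarrow> T l \<le> T l'"
  by (simp add: T_def div_le_mono)

lemma T_Suc: "T (Suc l) \<le> 2 * T l"
proof -
  have "Suc l div L \<le> Suc (l div L)" by (simp add: div_Suc)
  then have "(2::nat) ^ (Suc l div L) \<le> 2 ^ Suc (l div L)" by (intro power_increasing) auto
  then show ?thesis by (simp add: T_def)
qed

text \<open>Level \<open>K = L * L\<close> opens a group of its own with threshold
  \<open>2 ^ L\<close>, more than any degree. Hence no vertex leaves the top level upwards.\<close>

lemma T_K: "n < T K" using n_less L_pos by (simp add: T_def K_def)

lemma T_le: "l \<le> K \<Longrightarrow> T l \<le> 2 * n"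
proof -
  assume "l \<le> K"
  then have "T l \<le> T K" by (rule T_mono)
  also have "\<dots> \<le> 2 * n" using pow_le L_pos by (simp add: T_def K_def)
  finally show ?thesis .
qed

section \<open>Execution of the set operations\<close>

definition static :: "state \<Rightarrow> bool" where
  "static s \<longleftrightarrow> regs s 3 = n \<and> regs s 4 = N \<and> regs s 6 = n + 1 \<and> regs s 7 = 0 \<and>
     (\<forall>l\<le>K. arrays s 5 l = T l \<and> arrays s 6 l = off l)"

definition repS :: "state \<Rightarrow> (nat \<Rightarrow> nat \<Rightarrow> nat option) \<Rightarrow> bool" where
  "repS s bk = rep n N (arrays s 2) (arrays s 3) (arrays s 4) bk"

definition upd :: "nat \<Rightarrow> state \<Rightarrow> state \<Rightarrow> bool" where
  "upd k s s' \<longleftrightarrow> regs s' = regs s \<and> (\<forall>a. a \<notin> {2, 3, 4} \<longrightarrow> arrays s' a = arrays s a) \<and>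
     time s' \<le> time s + k"

lemma updD:
  assumes "upd k s s'"
  shows "regs s' = regs s" "arrays s' 0 = arrays s 0" "arrays s' 1 = arrays s 1"
    "arrays s' (Suc 0) = arrays s (Suc 0)"
    "arrays s' 5 = arrays s 5" "arrays s' 6 = arrays s 6" "arrays s' 9 = arrays s 9"
    "time s' \<le> time s + k"
  using assms by (auto simp: upd_def)

lemma static_upd: "upd k s s' \<Longrightarrow> static s' = static s"
  by (simp add: static_def upd_def)

lemma static_simps [simp]:
  "static (tick k s) = static s"
  "r \<notin> {3, 4, 6, 7} \<Longrightarrow> static (set_reg r x s) = static s"
  "a \<notin> {5, 6} \<Longrightarrow> static (set_cell a i x s) = static s"
  by (auto simp: static_def)

lemma repS_simps [simp]:
  "repS (tick k s) bk = repS s bk"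
  "repS (set_reg r x s) bk = repS s bk"
  "a \<notin> {2, 3, 4} \<Longrightarrow> repS (set_cell a i x s) bk = repS s bk"
  by (auto simp: repS_def)

lemma mod_ix:
  "r < N \<Longrightarrow> b < N \<Longrightarrow> (r * N mod M + b) mod M = ix N r b"
  "r < N \<Longrightarrow> b < N \<Longrightarrow> i < N \<Longrightarrow> (ix N r b * N mod M + i) mod M = ix N (ix N r b) i"
  by (simp_all only: mod_add_left_eq ix_def mod_less ix_less_M ix3_less_M)

lemma aval_row:
  assumes "regs s 4 = N" "regs s r < N" "aval M s e < N"
  shows "aval M s (row_e r e) = ix N (regs s r) (aval M s e)"
  using assms by (simp add: row_e_def mod_ix)

lemma aval_row_reg:
  assumes "regs s 4 = N" "regs s r < N" "regs s b < N"
  shows "aval M s (row_e r (Reg b)) = ix N (regs s r) (regs s b)"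
  using aval_row[of s r "Reg b"] assms by simp

lemma aval_set:
  assumes "regs s 4 = N" "regs s r < N" "regs s b < N"
  shows "aval M s (cnt_e r b) = arrays s 2 (ix N (regs s r) (regs s b))"
    "aval M s (pos_e r b) = arrays s 4 (ix N (regs s r) (regs s b))"
    "aval M s e < N \<Longrightarrow> aval M s (slot_e r b e) = ix N (ix N (regs s r) (regs s b)) (aval M s e)"
  using assms by (simp_all add: cnt_e_def pos_e_def slot_e_def aval_row mod_ix)

lemma Const_M [simp]: "k < 100 \<Longrightarrow> k mod M = k"
  using N3_less_M(2) by simp

lemma M_neq [simp]: "M \<noteq> Suc 0" "Suc 0 \<noteq> M" "M \<noteq> 0" "1 < M"
  using N3_less_M(2) by auto

lemma set_costs [simp]: "acost (row_e r e) = 4 + acost e" "acost (cnt_e r b) = 6" "acost (pos_e r b) = 6" "acost (slot_e r b e) = 8 + acost e"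
  by (simp_all add: row_e_def cnt_e_def pos_e_def slot_e_def)

lemma exec_add:
  assumes st: "static s" and rp: "repS s bk"
    and r: "regs s r < N" and b: "regs s b < N" and w: "regs s w < n"
    and none: "bk (regs s r) (regs s w) = None"
  shows "\<exists>s'. exec M (add_com r b w) s = return_spmf s' \<and> upd 100 s s' \<and>
    repS s' (bk(regs s r := (bk (regs s r))(regs s w := Some (regs s b))))"
proof -
  have N4: "regs s 4 = N" using st by (simp add: static_def)
  have wN: "regs s w < N" using w n_less_N by simp
  note rp' = rp[unfolded repS_def]
  have c: "arrays s 2 (ix N (regs s r) (regs s b)) < N"
    using rep_count(2)[OF rp' r b] n_less_N by simp
  have c': "Suc (arrays s 2 (ix N (regs s r) (regs s b))) < M"
    using rep_count(2)[OF rp' r b] n_less_N N3_less_M(3) by simp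
  show ?thesis
    using rep_add[OF rp' n_less_N(1) r w b none] c c' wN
    by (simp add: add_com_def aval_set aval_row_reg N4 r b c upd_def repS_def)
qed

lemma exec_remove:
  assumes st: "static s" and rp: "repS s bk"
    and r: "regs s r < N" and some: "bk (regs s r) (regs s w) = Some (regs s b)"
  shows "\<exists>s'. exec M (remove_com r b w) s = return_spmf s' \<and> upd 100 s s' \<and>
    repS s' (bk(regs s r := (bk (regs s r))(regs s w := None)))"
proof -
  have N4: "regs s 4 = N" using st by (simp add: static_def)
  note rp' = rp[unfolded repS_def]
  note W = rep_bucket[OF rp' r some]
  have wN: "regs s w < N" using W(1) n_less_N by simp
  have b: "regs s b < N" using W(2) .
  let ?R = "regs s r" and ?B = "regs s b" and ?W = "regs s w"
  let ?c = "arrays s 2 (ix N ?R ?B)" and ?p = "arrays s 4 (ix N ?R ?W)"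
  have cn: "?c < N" using rep_count(2)[OF rp' r b] n_less_N by simp
  have c: "?c - Suc 0 < ?c" "?c - Suc 0 < N" "?p < N" using W(3) cn by auto
  let ?x = "arrays s 3 (ix N (ix N ?R ?B) (?c - Suc 0))"
  have x: "?x < N" using rep_index(3)[OF rp' r b c(1)] n_less_N by simp
  let ?last = "Read 3 (slot_e r b (Minus (cnt_e r b) (Const 1)))"
  let ?s1 = "set_cell 3 (ix N (ix N ?R ?B) ?p) ?x s"
  let ?s2 = "set_cell 4 (ix N ?R ?x) ?p ?s1"
  have a1: "aval M s (slot_e r b (pos_e r w)) = ix N (ix N ?R ?B) ?p"
    and a2: "aval M s ?last = ?x"
    \<comment> \<open>\<open>last\<close> is evaluated a second time after the first store. It is
      still \<open>?x\<close>: that store writes \<open>?x\<close>, so even if it hits the last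
      entry nothing changes.\<close>
    and a3: "aval M ?s1 ?last = ?x" "aval M ?s1 (pos_e r w) = ?p"
    and a5: "aval M ?s2 (row_e r (Reg b)) = ix N ?R ?B" "aval M ?s2 (cnt_e r b) = ?c"
    by (simp_all add: aval_set aval_row_reg N4 r b c wN)
  have a4: "aval M ?s1 (row_e r ?last) = ix N ?R ?x"
    using aval_row[of ?s1 r ?last] x by (simp only: a3 N4 r regs_simps)
  have "exec M (remove_com r b w) s = return_spmf (tick 74 (set_cell 2 (ix N ?R ?B) (?c - 1) ?s2))"
    using a2 a3(1) a4 by (simp add: remove_com_def Let_def a1 a3(2) a5 del: aval.simps(3))
  then show ?thesis
    using rep_remove[OF rp' n_less_N(1) r some] by (simp add: upd_def repS_def)
qed

lemma exec_insert:
  assumes st: "static s" and rp: "repS s bk"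
    and r: "regs s r < N" and b: "regs s b < N" and w: "regs s w < n"
    and none: "bk (regs s r) (regs s w) \<in> {None, Some (regs s b)}"
  shows "\<exists>s'. exec M (insert_com r b w) s = return_spmf s' \<and> upd 200 s s' \<and>
    repS s' (bk(regs s r := (bk (regs s r))(regs s w := Some (regs s b))))"
proof -
  have N4: "regs s 4 = N" using st by (simp add: static_def)
  have wN: "regs s w < N" using w n_less_N by simp
  note rp' = rp[unfolded repS_def]
  let ?R = "regs s r" and ?B = "regs s b" and ?W = "regs s w"
  let ?c = "Conj (Less (pos_e r w) (cnt_e r b)) (Equal (Read 3 (slot_e r b (pos_e r w))) (Reg w))"
  have cn: "arrays s 2 (ix N ?R ?B) < N" using rep_count(2)[OF rp' r b] n_less_N by simp
  \<comment> \<open>Only a position that passes the first comparison is known to be small enough for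
    an address without overflow; hence the case split.\<close>
  have test: "bval M s ?c \<longleftrightarrow> bk ?R ?W = Some ?B"
  proof (cases "arrays s 4 (ix N ?R ?W) < arrays s 2 (ix N ?R ?B)")
    case True
    then have "arrays s 4 (ix N ?R ?W) < N" using cn by simp
    then show ?thesis
      using rep_mem_test[OF rp' r b w] by (simp add: aval_set N4 r b wN)
  next
    case False
    then show ?thesis
      using rep_mem_test[OF rp' r b w] by (simp add: aval_set N4 r b wN)
  qed
  show ?thesis
  proof (cases "bk ?R ?W = Some ?B")
    case True
    then have "bk(?R := (bk ?R)(?W := Some ?B)) = bk" by (auto simp: fun_eq_iff)
    with True test rp show ?thesis
      by (simp add: insert_com_def upd_def)
  next
    case False
    obtain s' where s': "exec M (add_com r b w) (tick (bcost ?c) s) = return_spmf s'"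
      "upd 100 (tick (bcost ?c) s) s'"
      "repS s' (bk(?R := (bk ?R)(?W := Some ?B)))"
      using exec_add[of "tick (bcost ?c) s" bk r b w] assms False by auto
    have "upd 200 s s'" using s'(2) by (simp add: upd_def)
    moreover have "\<not> bval M s ?c" using False test by blast
    ultimately show ?thesis
      using s'(1,3) by (simp only: insert_com_def exec.simps if_False) blast
  qed
qed

lemma exec_insert':
  assumes "static s" "repS s bk" "regs s r = R" "R < N" "regs s b = B" "B < N" "regs s w = W" "W < n"
    and "bk R W \<in> {None, Some B}"
  shows "\<exists>s'. exec M (insert_com r b w) s = return_spmf s' \<and> upd 200 s s' \<and>
    repS s' (bk(R := (bk R)(W := Some B)))"
  using exec_insert[OF assms(1,2), of r b w] assms by simp

end

section \<open>Moving a vertex to another level\<close>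

definition graph_on :: "nat \<Rightarrow> nat set set \<Rightarrow> bool" where
  "graph_on n E \<longleftrightarrow> (\<forall>e\<in>E. \<exists>u v. e = {u, v} \<and> u < n \<and> v < n \<and> u \<noteq> v)"

lemma graph_onD:
  assumes "graph_on n E" "{u, v} \<in> E"
  shows "u < n" "v < n" "u \<noteq> v"
  using assms unfolding graph_on_def by (fastforce simp: doubleton_eq_iff)+

text \<open>Regroups a program so that a prefix can be executed as one unit.\<close>

lemma exec_Seq_assoc: "exec M (Seq a (Seq b c)) s = exec M (Seq (Seq a b) c) s"
proof -
  have "exec M (Seq b c) = (\<lambda>s. bind_spmf (exec M b s) (exec M c))" by (rule ext) simp
  then show ?thesis by (simp add: bind_spmf_assoc)
qed

context level_params
begin

lemma static_exec:
  assumes "s' \<in> set_spmf (exec M c s)" "written_regs c \<subseteq> {10..}" "written_arrays c \<subseteq> {0, 1, 2, 3, 4, 7, 8, 9}"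
  shows "static s' = static s"
proof -
  have "3 \<notin> written_regs c" "4 \<notin> written_regs c" "6 \<notin> written_regs c" "7 \<notin> written_regs c"
    using assms(2) by auto
  moreover have "5 \<notin> written_arrays c" "6 \<notin> written_arrays c" using assms(3) by auto
  ultimately show ?thesis using exec_frame[OF assms(1)] by (simp add: static_def)
qed

lemma written_move:
  "written_regs move_com \<subseteq> {10..}" "written_arrays move_com \<subseteq> {0, 1, 2, 3, 4, 7, 8, 9}"
  by (simp_all add: move_com_def copy_com_def relocate_body_def add_com_def remove_com_def insert_com_def Let_def)

lemma written_edge:
  "written_regs edge_com \<subseteq> {10..}" "written_arrays edge_com \<subseteq> {0, 1, 2, 3, 4, 7, 8, 9}"
  by (simp_all add: edge_com_def add_com_def remove_com_def insert_com_def Let_def)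

text \<open>The set number \<open>f r w\<close> is a parameter because in the middle of a move some
  edges are still filed under the old level.\<close>

definition book :: "nat set set \<Rightarrow> (nat \<Rightarrow> nat \<Rightarrow> nat) \<Rightarrow> nat set \<Rightarrow> nat set \<Rightarrow> nat \<Rightarrow> nat \<Rightarrow> nat option" where
  "book E f W F r w =
     (if r < n then if {r, w} \<in> E then Some (f r w) else None
      else if r = n then if w \<in> W then Some 0 else None
      else if r = n + 1 then if w \<in> F then Some 0 else None
      else None)"

text \<open>Relocating an edge removes an entry from the list it is taken from and may permute the
  rest, so the list is traversed on a copy.\<close>

lemma exec_copy:
  assumes st: "static s" and rp: "repS s bk"
    and x: "regs s 10 = x" "x < N" and l: "regs s 11 = l" "l < N"
    and c: "regs s 12 = arrays s 2 (ix N x l)"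
  shows "\<exists>s'. exec M copy_com s = return_spmf s' \<and> regs s' = (regs s)(14 := regs s 12) \<and>
    (\<forall>a. a \<noteq> 9 \<longrightarrow> arrays s' a = arrays s a) \<and>
    (\<forall>i<regs s 12. arrays s' 9 i = arrays s 3 (ix N (ix N x l) i)) \<and>
    time s' \<le> time s + 100 * regs s 12 + 100"
proof -
  have N4: "regs s 4 = N" using st by (simp add: static_def)
  note rp' = rp[unfolded repS_def]
  define c where "c = regs s 12"
  have cN: "c < N" using rep_count(2)[OF rp' x(2) l(2)] n_less_N c c_def by simp
  have cM: "Suc i < M" if "i < c" for i using cN that N3_less_M(3) by simp
  define I where "I = (\<lambda>t :: state. regs t = (regs s)(14 := regs t 14) \<and> regs t 14 \<le> c \<and>
    (\<forall>a. a \<noteq> 9 \<longrightarrow> arrays t a = arrays s a) \<and>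
    (\<forall>i<regs t 14. arrays t 9 i = arrays s 3 (ix N (ix N x l) i)) \<and>
    time t \<le> time s + 100 * regs t 14 + 20)"
  let ?b = "Less (Reg 14) (Reg 12)"
  let ?body = "Seq (Store 9 (Reg 14) (Read 3 (slot_e 10 11 (Reg 14)))) (Assign 14 (Plus (Reg 14) (Const 1)))"
  have "\<exists>s'. exec M (While ?b ?body) (tick 2 (set_reg 14 0 s)) = return_spmf (tick (bcost ?b) s') \<and> I s' \<and> \<not> bval M s' ?b"
  proof (rule exec_while_det[where I = I and m = "\<lambda>t. c - regs t 14"])
    show "I (tick 2 (set_reg 14 0 s))" by (auto simp: I_def)
    fix t assume I: "I t" and b: "bval M t ?b"
    have rr: "regs t r = ((regs s)(14 := regs t 14)) r" for r using I unfolding I_def by metis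
    have rt: "regs t 4 = N" "regs t 10 = x" "regs t 11 = l" "regs t 12 = c"
      using N4 x l rr[of 4] rr[of 10] rr[of 11] rr[of 12] by (simp_all add: c_def)
    have at: "arrays t 3 = arrays s 3" using I by (simp add: I_def)
    have i: "regs t 14 < c" using b rt by simp
    then have iN: "regs t 14 < N" using cN by simp
    have "exec M ?body (tick (bcost ?b) t) = return_spmf (tick 19 (set_reg 14 (Suc (regs t 14))
        (set_cell 9 (regs t 14) (arrays s 3 (ix N (ix N x l) (regs t 14))) t)))"
      using cM[OF i] by (simp add: aval_set rt at x l iN)
    moreover have "(regs t)(14 := Suc (regs t 14)) = (regs s)(14 := Suc (regs t 14))"
      using I unfolding I_def by (metis fun_upd_upd)
    ultimately show "\<exists>s'. exec M ?body (tick (bcost ?b) t) = return_spmf s' \<and> I s' \<and> c - regs s' 14 < c - regs t 14"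
      using I i by (simp add: I_def less_Suc_eq)
  qed
  then obtain s' where s': "exec M (While ?b ?body) (tick 2 (set_reg 14 0 s)) = return_spmf (tick (bcost ?b) s')"
    "I s'" "\<not> bval M s' ?b" by blast
  have "regs s' 12 = ((regs s)(14 := regs s' 14)) 12" using s'(2) unfolding I_def by metis
  then have "regs s' 12 = c" by (simp add: c_def)
  then have "regs s' 14 = c" using s'(2,3) by (simp add: I_def)
  have a: "exec M (Assign 14 (Const 0)) s = return_spmf (tick 2 (set_reg 14 0 s))"
    by (simp add: numeral_2_eq_2)
  have "exec M copy_com s = return_spmf (tick (bcost ?b) s')"
    by (simp only: copy_com_def exec.simps(5) a return_bind_spmf s'(1))
  moreover have "regs s' = (regs s)(14 := c)" using s'(2) \<open>regs s' 14 = c\<close> by (simp add: I_def)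
  ultimately show ?thesis
    using s'(2) \<open>regs s' 14 = c\<close> by (simp add: I_def c_def)
qed

lemma exec_relocate_body:
  assumes st: "static s" and rp: "repS s bk"
    and x: "regs s 10 = x" "x < n" and l: "regs s 11 = l" "l < N" and nl: "regs s 13 = nl" "nl < N"
    and i: "regs s 14 = Suc i" and w: "arrays s 9 i = w" "w < n" "w \<noteq> x" and lw: "arrays s 1 w < N"
    and bk: "bk x w = Some l" "bk w x = Some l" "bk n w \<in> {None, Some 0}"
  defines "b \<equiv> min nl (arrays s 1 w)"
  shows "\<exists>s'. exec M relocate_body s = return_spmf s' \<and>
    regs s' = (regs s)(14 := i, 15 := w, 16 := b) \<and>
    (\<forall>a. a \<notin> {2, 3, 4} \<longrightarrow> arrays s' a = arrays s a) \<and>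
    repS s' (bk(x := (bk x)(w := Some b), w := (bk w)(x := Some b), n := (bk n)(w := Some 0))) \<and>
    time s' \<le> time s + 1000"
proof -
  have bN: "b < N" using nl lw by (simp add: b_def)
  have xN: "x < N" "w < N" using x w n_less_N by auto
  define s1 where "s1 = set_reg 16 b (set_reg 15 w (set_reg 14 i s))"
  have "\<exists>k\<le>50. exec M (Seq (Assign 14 (Minus (Reg 14) (Const 1)))
    (Seq (Assign 15 (Read 9 (Reg 14)))
    (Seq (Assign 16 (Read 1 (Reg 15)))
    (Cond (Less (Reg 13) (Reg 16)) (Assign 16 (Reg 13)) Skip)))) s = return_spmf (tick k s1)"
    using i w nl by (intro exI[of _ "if nl < arrays s 1 w then 15 else 14"]) (simp add: s1_def b_def min_def)
  then obtain k where k: "k \<le> 50" "exec M (Seq (Assign 14 (Minus (Reg 14) (Const 1)))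
    (Seq (Assign 15 (Read 9 (Reg 14)))
    (Seq (Assign 16 (Read 1 (Reg 15)))
    (Cond (Less (Reg 13) (Reg 16)) (Assign 16 (Reg 13)) Skip)))) s = return_spmf (tick k s1)" by blast
  have split: "exec M relocate_body s = bind_spmf (return_spmf (tick k s1)) (exec M
    (Seq (remove_com 10 11 15)
    (Seq (add_com 10 16 15)
    (Seq (remove_com 15 11 10)
    (Seq (add_com 15 16 10)
         (insert_com 3 7 15))))))"
    unfolding k(2)[symmetric] by (simp add: relocate_body_def)
  have s1: "static (tick k s1)" "repS (tick k s1) bk" "regs s1 10 = x" "regs s1 11 = l" "regs s1 15 = w" "regs s1 16 = b"
    "regs s1 3 = n" "regs s1 7 = 0"
    using st rp x l by (auto simp: s1_def static_def repS_def)
  obtain s2 where s2: "exec M (remove_com 10 11 15) (tick k s1) = return_spmf s2" "upd 100 (tick k s1) s2"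
    "repS s2 (bk(x := (bk x)(w := None)))"
    using exec_remove[OF s1(1,2), of 10 15 11] s1(3-) xN bk by auto
  have r2: "regs s2 = regs s1" using updD[OF s2(2)] by simp
  have st2: "static s2" using static_upd[OF s2(2)] s1 by simp
  obtain s3 where s3: "exec M (add_com 10 16 15) s2 = return_spmf s3" "upd 100 s2 s3"
    "repS s3 (bk(x := (bk x)(w := Some b)))"
    using exec_add[OF st2 s2(3), of 10 16 15] s1(3-) xN w x bN by (auto simp: r2)
  have r3: "regs s3 = regs s1" using updD[OF s3(2)] r2 by simp
  have st3: "static s3" using static_upd[OF s3(2)] st2 by simp
  obtain s4 where s4: "exec M (remove_com 15 11 10) s3 = return_spmf s4" "upd 100 s3 s4"
    "repS s4 (bk(x := (bk x)(w := Some b), w := (bk w)(x := None)))"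
    using exec_remove[OF st3 s3(3), of 15 10 11] s1(3-) xN w x bk by (auto simp: r3)
  have r4: "regs s4 = regs s1" using updD[OF s4(2)] r3 by simp
  have st4: "static s4" using static_upd[OF s4(2)] st3 by simp
  obtain s5 where s5: "exec M (add_com 15 16 10) s4 = return_spmf s5" "upd 100 s4 s5"
    "repS s5 (bk(x := (bk x)(w := Some b), w := (bk w)(x := Some b)))"
    using exec_add[OF st4 s4(3), of 15 16 10] s1(3-) xN w x bN by (auto simp: r4)
  have r5: "regs s5 = regs s1" using updD[OF s5(2)] r4 by simp
  have st5: "static s5" using static_upd[OF s5(2)] st4 by simp
  have nx: "n \<noteq> x" "n \<noteq> w" using x w by auto
  obtain s6 where s6: "exec M (insert_com 3 7 15) s5 = return_spmf s6" "upd 200 s5 s6"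
    "repS s6 (bk(x := (bk x)(w := Some b), w := (bk w)(x := Some b), n := (bk n)(w := Some 0)))"
    using exec_insert[OF st5 s5(3), of 3 7 15] s1(3-) nx w x bk(3) n_less_N N_pos by (auto simp: r5)
  have "exec M relocate_body s = return_spmf s6"
    unfolding split by (simp add: s2(1) s3(1) s4(1) s5(1) s6(1))
  moreover have "regs s6 = (regs s)(14 := i, 15 := w, 16 := b)"
    using updD(1)[OF s6(2)] r5 by (simp add: s1_def)
  moreover have "\<forall>a. a \<notin> {2, 3, 4} \<longrightarrow> arrays s6 a = arrays s a"
    using s2(2) s3(2) s4(2) s5(2) s6(2) by (simp add: upd_def s1_def)
  moreover have "time s6 \<le> time s + 1000"
    using s2(2) s3(2) s4(2) s5(2) s6(2) k(1) by (simp add: upd_def s1_def)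
  ultimately show ?thesis using s6(3) by blast
qed

text \<open>The books while the edges from \<open>x\<close> to \<open>S\<close> still have to be moved from set \<open>l\<close>.\<close>

definition pending :: "nat \<Rightarrow> nat \<Rightarrow> (nat \<Rightarrow> nat) \<Rightarrow> nat set \<Rightarrow> nat \<Rightarrow> nat \<Rightarrow> nat" where
  "pending x l lev S r w = (if (r = x \<and> w \<in> S) \<or> (w = x \<and> r \<in> S) then l else min (lev r) (lev w))"

lemma exec_relocate:
  assumes st: "static s" and rp: "repS s (book E (pending x l lev D) W F)"
    and lev: "arrays s 1 = lev" "\<And>v. v < n \<Longrightarrow> lev v < N"
    and x: "regs s 10 = x" "x < n" and l: "regs s 11 = l" "l < N" and nl: "regs s 13 = lev x"
    and c: "regs s 14 = c" "D = arrays s 9 ` {..<c}" "inj_on (arrays s 9) {..<c}"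
    and D: "\<And>w. w \<in> D \<Longrightarrow> {x, w} \<in> E" and E: "graph_on n E"
  shows "\<exists>s'. exec M (While (Less (Const 0) (Reg 14)) relocate_body) s = return_spmf s' \<and>
    repS s' (book E (\<lambda>r w. min (lev r) (lev w)) (W \<union> D) F) \<and> arrays s' 1 = lev \<and>
    time s' \<le> time s + 1010 * c + 10"
proof -
  let ?b = "Less (Const 0) (Reg 14)"
  \<comment> \<open>The copy is consumed from its end; the edges still to be moved are therefore
    those to its prefix of length \<open>regs t 14\<close>.\<close>
  let ?S = "\<lambda>i. arrays s 9 ` {..<i}"
  define I where "I = (\<lambda>t :: state. static t \<and> (\<forall>a. a \<notin> {2, 3, 4} \<longrightarrow> arrays t a = arrays s a) \<and>
    regs t 10 = x \<and> regs t 11 = l \<and> regs t 13 = lev x \<and> regs t 14 \<le> c \<and>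
    repS t (book E (pending x l lev (?S (regs t 14))) (W \<union> (D - ?S (regs t 14))) F) \<and>
    time t \<le> time s + 1010 * (c - regs t 14))"
  have "\<exists>s'. exec M (While ?b relocate_body) s = return_spmf (tick (bcost ?b) s') \<and> I s' \<and> \<not> bval M s' ?b"
  proof (rule exec_while_det[where I = I and m = "\<lambda>t. regs t 14"])
    show "I s" using assms by (auto simp: I_def)
    fix t assume I: "I t" and b: "bval M t ?b"
    define i where "i = regs t 14 - 1"
    have i: "regs t 14 = Suc i" "Suc i \<le> c" using b I by (auto simp: i_def I_def)
    define w where "w = arrays s 9 i"
    have S: "?S (Suc i) = insert w (?S i)" by (auto simp: w_def lessThan_Suc)
    have wS: "w \<notin> ?S i"
    proof
      assume "w \<in> ?S i"
      then obtain j where "j < i" "arrays s 9 i = arrays s 9 j" by (auto simp: w_def)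
      then show False using inj_onD[OF c(3), of i j] i(2) by auto
    qed
    have wD: "w \<in> D" using i(2) c(2) by (auto simp: w_def)
    have SD: "?S i \<subseteq> D" using i(2) c(2) by auto
    have w: "w < n" "w \<noteq> x" using graph_onD[OF E D[OF wD]] by auto
    let ?bk = "book E (pending x l lev (?S (Suc i))) (W \<union> (D - ?S (Suc i))) F"
    have xw: "{x, w} \<in> E" "{w, x} \<in> E" using D[OF wD] by (auto simp: insert_commute)
    have bk: "?bk x w = Some l" "?bk w x = Some l" "?bk n w \<in> {None, Some 0}"
      using x(2) w xw by (auto simp: book_def pending_def S)
    have "\<exists>s'. exec M relocate_body (tick (bcost ?b) t) = return_spmf s' \<and>
      regs s' = (regs (tick (bcost ?b) t))(14 := i, 15 := w, 16 := min (lev x) (arrays (tick (bcost ?b) t) 1 w)) \<and>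
      (\<forall>a. a \<notin> {2, 3, 4} \<longrightarrow> arrays s' a = arrays (tick (bcost ?b) t) a) \<and>
      repS s' (?bk(x := (?bk x)(w := Some (min (lev x) (arrays (tick (bcost ?b) t) 1 w))),
        w := (?bk w)(x := Some (min (lev x) (arrays (tick (bcost ?b) t) 1 w))), n := (?bk n)(w := Some 0))) \<and>
      time s' \<le> time (tick (bcost ?b) t) + 1000"
      by (rule exec_relocate_body) (use I i x l lev w bk w_def in \<open>auto simp: I_def\<close>)
    then obtain s' where s': "exec M relocate_body (tick (bcost ?b) t) = return_spmf s'"
      "regs s' = (regs t)(14 := i, 15 := w, 16 := min (lev x) (lev w))"
      "\<forall>a. a \<notin> {2, 3, 4} \<longrightarrow> arrays s' a = arrays t a"
      "repS s' (?bk(x := (?bk x)(w := Some (min (lev x) (lev w))),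
        w := (?bk w)(x := Some (min (lev x) (lev w))), n := (?bk n)(w := Some 0)))"
      "time s' \<le> time t + 1005"
      using I lev by (auto simp: I_def)
    have "?bk(x := (?bk x)(w := Some (min (lev x) (lev w))),
        w := (?bk w)(x := Some (min (lev x) (lev w))), n := (?bk n)(w := Some 0)) =
        book E (pending x l lev (?S i)) (W \<union> (D - ?S i)) F"
      using x(2) w wD wS xw SD unfolding S
      by (intro ext) (auto simp: book_def pending_def min.commute)
    then have "I s'" using s' I i
      by (auto simp: I_def static_def)
    then show "\<exists>s'. exec M relocate_body (tick (bcost ?b) t) = return_spmf s' \<and> I s' \<and> regs s' 14 < regs t 14"
      using s'(1,2) i by auto
  qed
  then obtain s' where s': "exec M (While ?b relocate_body) s = return_spmf (tick (bcost ?b) s')" "I s'" "\<not> bval M s' ?b"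
    by blast
  have "pending x l lev {} = (\<lambda>r w. min (lev r) (lev w))" by (auto simp: pending_def fun_eq_iff)
  moreover have "regs s' 14 = 0" using s'(3) by simp
  ultimately show ?thesis using s' lev by (auto simp: I_def)
qed

text \<open>For a move by one level it suffices to refile the edges in set \<open>lev x\<close>,
  those to neighbours on level \<open>lev x\<close> or above. The same neighbours are the ones whose
  stability may be lost, so they go to the worklist.\<close>

lemma exec_move:
  assumes st: "static s" and rp: "repS s (book E (\<lambda>r w. min (lev r) (lev w)) W F)"
    and lev: "arrays s 1 = lev" "\<And>v. v < n \<Longrightarrow> lev v \<le> K" and E: "graph_on n E"
    and x: "regs s 10 = x" "x < n" and l: "regs s 11 = lev x"
    and c: "regs s 12 = arrays s 2 (ix N x (lev x))"
    and nl: "regs s 13 = nl" "nl \<le> K" "nl \<le> Suc (lev x)" "lev x \<le> Suc nl"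
  shows "\<exists>s'. exec M move_com s = return_spmf s' \<and>
    repS s' (book E (\<lambda>r w. min ((lev(x := nl)) r) ((lev(x := nl)) w))
      (W \<union> insert x {w. {x, w} \<in> E \<and> lev x \<le> lev w}) (insert x F)) \<and>
    arrays s' 1 = lev(x := nl) \<and>
    time s' \<le> time s + 1200 * regs s 12 + 1000"
proof -
  let ?bk = "book E (\<lambda>r w. min (lev r) (lev w))"
  have levN: "lev v < N" if "v < n" for v using lev(2)[OF that] K_less_N by simp
  have xN: "x < N" using x n_less_N by simp
  have lN: "lev x < N" using levN x by simp
  define D where "D = {w. {x, w} \<in> E \<and> lev x \<le> lev w}"
  have D: "{w. ?bk W F x w = Some (lev x)} = D"
    using x(2) by (auto simp: book_def D_def split: if_splits)
  obtain s1 where s1: "exec M copy_com s = return_spmf s1" "regs s1 = (regs s)(14 := regs s 12)"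
    "\<forall>a. a \<noteq> 9 \<longrightarrow> arrays s1 a = arrays s a"
    "\<forall>i<regs s 12. arrays s1 9 i = arrays s 3 (ix N (ix N x (lev x)) i)"
    "time s1 \<le> time s + 100 * regs s 12 + 100"
    using exec_copy[OF st rp x(1) xN l lN c] by blast
  have "bij_betw (\<lambda>i. arrays s 3 (ix N (ix N x (lev x)) i)) {..<regs s 12} D"
    using rep_bij[OF rp[unfolded repS_def] xN lN] unfolding D c .
  moreover have "bij_betw (arrays s1 9) {..<regs s 12} D \<longleftrightarrow>
      bij_betw (\<lambda>i. arrays s 3 (ix N (ix N x (lev x)) i)) {..<regs s 12} D"
    using s1(4) by (intro bij_betw_cong) auto
  ultimately have bij: "bij_betw (arrays s1 9) {..<regs s 12} D" by blast
  let ?lev = "lev(x := nl)"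
  let ?s2 = "tick 3 (set_cell 1 x nl s1)"
  have e2: "exec M (Store 1 (Reg 10) (Reg 13)) s1 = return_spmf ?s2"
    using s1(2) x nl by (simp add: numeral_3_eq_3)
  have s2: "static ?s2" "repS ?s2 (?bk W F)" "regs ?s2 6 = n + 1" "regs ?s2 7 = 0" "regs ?s2 3 = n"
     "regs ?s2 10 = x" "regs ?s2 11 = lev x" "regs ?s2 13 = nl" "regs ?s2 14 = regs s 12"
     "arrays ?s2 1 = ?lev" "arrays ?s2 9 = arrays s1 9"
    using st rp s1(2,3) lev x l nl by (auto simp: static_def repS_def)
  let ?bk1 = "(?bk W F)(n + 1 := (?bk W F (n + 1))(x := Some 0))"
  obtain s3 where s3: "exec M (insert_com 6 7 10) ?s2 = return_spmf s3" "upd 200 ?s2 s3" "repS s3 ?bk1"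
  proof -
    have "\<exists>s3. exec M (insert_com 6 7 10) ?s2 = return_spmf s3 \<and> upd 200 ?s2 s3 \<and> repS s3 ?bk1"
      by (rule exec_insert'[OF s2(1,2,3) _ s2(4) _ s2(6)])
        (use x n_less_N N_pos in \<open>auto simp: book_def\<close>)
    then show ?thesis using that by blast
  qed
  have bk1: "?bk1 = ?bk W (insert x F)" by (intro ext) (auto simp: book_def)
  have r3: "regs s3 = regs ?s2" using s3(2) by (simp add: upd_def)
  have st3: "static s3" using static_upd[OF s3(2)] s2(1) by simp
  let ?bk2 = "(?bk W (insert x F))(n := (?bk W (insert x F) n)(x := Some 0))"
  obtain s4 where s4: "exec M (insert_com 3 7 10) s3 = return_spmf s4" "upd 200 s3 s4" "repS s4 ?bk2"
  proof -
    have "\<exists>s4. exec M (insert_com 3 7 10) s3 = return_spmf s4 \<and> upd 200 s3 s4 \<and> repS s4 ?bk2"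
      by (rule exec_insert'[OF st3 s3(3)[unfolded bk1] s2(5)[folded r3] _ s2(4)[folded r3] _ s2(6)[folded r3]])
        (use x n_less_N N_pos in \<open>auto simp: book_def\<close>)
    then show ?thesis using that by blast
  qed
  have r4: "regs s4 = regs ?s2" using s4(2) r3 by (simp add: upd_def)
  have st4: "static s4" using static_upd[OF s4(2)] st3 by simp
  \<comment> \<open>An edge to a lower neighbour keeps its set: from \<open>lev w < lev x\<close>
    and \<open>lev x \<le> Suc nl\<close> follows \<open>lev w \<le> nl\<close>, so the minimum is
    \<open>lev w\<close> before and after.\<close>
  have bk2: "?bk2 = book E (pending x (lev x) ?lev D) (insert x W) (insert x F)"
  proof (intro ext)
    fix r w
    show "?bk2 r w = book E (pending x (lev x) ?lev D) (insert x W) (insert x F) r w"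
    proof (cases "{r, w} \<in> E")
      case True
      from graph_onD[OF E this] have "r < n" "w < n" "r \<noteq> w" .
      then show ?thesis
        using True nl(3,4) x(2) by (auto simp: book_def pending_def D_def insert_commute)
    qed (auto simp: book_def)
  qed
  have a4: "arrays s4 1 = ?lev" "arrays s4 9 = arrays s1 9"
    using s4(2) s3(2) s2(10,11) by (auto simp: upd_def)
  have "\<exists>s'. exec M (While (Less (Const 0) (Reg 14)) relocate_body) s4 = return_spmf s' \<and>
    repS s' (book E (\<lambda>r w. min (?lev r) (?lev w)) (insert x W \<union> D) (insert x F)) \<and> arrays s' 1 = ?lev \<and>
    time s' \<le> time s4 + 1010 * regs s 12 + 10"
  proof (rule exec_relocate)
    show "repS s4 (book E (pending x (lev x) ?lev D) (insert x W) (insert x F))"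
      using s4(3) unfolding bk2 .
    show "?lev v < N" if "v < n" for v using levN[OF that] nl(2) K_less_N by simp
    show "D = arrays s4 9 ` {..<regs s 12}" "inj_on (arrays s4 9) {..<regs s 12}"
      using bij unfolding a4 by (auto simp: bij_betw_def)
    show "{x, w} \<in> E" if "w \<in> D" for w using that by (simp add: D_def)
  qed (use st4 r4 s2 a4 x(2) lN E in auto)
  then obtain s5 where s5: "exec M (While (Less (Const 0) (Reg 14)) relocate_body) s4 = return_spmf s5"
    "repS s5 (book E (\<lambda>r w. min (?lev r) (?lev w)) (insert x W \<union> D) (insert x F))" "arrays s5 1 = ?lev"
    "time s5 \<le> time s4 + 1010 * regs s 12 + 10" by blast
  have "exec M move_com s = return_spmf s5"
    by (simp only: move_com_def exec.simps(5) s1(1) e2 s3(1) s4(1) s5(1) return_bind_spmf)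
  moreover have "time s5 \<le> time s + 1200 * regs s 12 + 1000"
    using s1(5) s3(2) s4(2) s5(4) by (simp add: upd_def)
  moreover have "insert x W \<union> D = W \<union> insert x D" by auto
  ultimately show ?thesis using s5(2,3) unfolding D_def by auto
qed

lemma exec_edge:
  assumes st: "static s" and rp: "repS s (book E (\<lambda>r w. min (lev r) (lev w)) {} F)"
    and lev: "arrays s 1 = lev" "\<And>v. v < n \<Longrightarrow> lev v \<le> K" and E: "graph_on n E"
    and uv: "regs s 1 = u" "regs s 2 = v" "u < n" "v < n" "u \<noteq> v"
    and op: "regs s 0 = 1 \<and> {u, v} \<notin> E \<and> E' = insert {u, v} E \<or>
             regs s 0 = 0 \<and> {u, v} \<in> E \<and> E' = E - {{u, v}}"
  shows "\<exists>s'. exec M edge_com s = return_spmf s' \<and>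
    repS s' (book E' (\<lambda>r w. min (lev r) (lev w)) {u, v} {}) \<and> arrays s' 1 = lev \<and>
    time s' \<le> time s + 1000"
proof -
  let ?f = "\<lambda>r w. min (lev r) (lev w)"
  define b where "b = min (lev u) (lev v)"
  have levN: "lev v < N" if "v < n" for v using lev(2)[OF that] K_less_N by simp
  have bN: "b < N" using levN[of u] uv by (simp add: b_def)
  have uN: "u < N" "v < N" using uv n_less_N by auto
  have s: "regs s 3 = n" "regs s 4 = N" "regs s 6 = n + 1" "regs s 7 = 0" using st by (auto simp: static_def)
  let ?s1 = "set_cell 2 (ix N (n + 1) 0) 0 s"
  have e1: "exec M (Store 2 (row_e 6 (Reg 7)) (Const 0)) s = return_spmf (tick 7 ?s1)"
    using s n_less_N N_pos by (simp add: aval_row_reg)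
  have "rep n N (arrays ?s1 2) (arrays ?s1 3) (arrays ?s1 4)
    ((book E ?f {} F)(n + 1 := (\<lambda>w. if book E ?f {} F (n + 1) w = Some 0 then None else book E ?f {} F (n + 1) w)))"
    using rep_clear[OF rp[unfolded repS_def] n_less_N(1) n_less_N(2) N_pos] by simp
  moreover have "(book E ?f {} F)(n + 1 := (\<lambda>w. if book E ?f {} F (n + 1) w = Some 0 then None else book E ?f {} F (n + 1) w))
    = book E ?f {} {}" by (intro ext) (auto simp: book_def)
  ultimately have rp1: "repS ?s1 (book E ?f {} {})" by (simp add: repS_def)
  let ?s2 = "set_reg 16 b ?s1"
  have "\<exists>k\<le>50. exec M (Seq (Assign 16 (Read 1 (Reg 1)))
     (Cond (Less (Read 1 (Reg 2)) (Reg 16)) (Assign 16 (Read 1 (Reg 2))) Skip)) (tick 7 ?s1) = return_spmf (tick k ?s2)"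
    using lev uv by (intro exI[of _ "if lev v < lev u then 17 else 15"]) (simp add: b_def min_def)
  then obtain k where k: "k \<le> 50" "exec M (Seq (Assign 16 (Read 1 (Reg 1)))
     (Cond (Less (Read 1 (Reg 2)) (Reg 16)) (Assign 16 (Read 1 (Reg 2))) Skip)) (tick 7 ?s1) = return_spmf (tick k ?s2)"
    by blast
  have s2: "static (tick k ?s2)" "repS (tick k ?s2) (book E ?f {} {})"
    "regs ?s2 1 = u" "regs ?s2 2 = v" "regs ?s2 16 = b" "regs ?s2 3 = n" "regs ?s2 7 = 0" "regs ?s2 0 = regs s 0"
    using st rp1 uv s by auto
  have "\<exists>s'. exec M (Cond (Equal (Reg 0) (Const 1))
            (Seq (add_com 1 16 2) (add_com 2 16 1))
            (Seq (remove_com 1 16 2) (remove_com 2 16 1))) (tick k ?s2) = return_spmf s' \<and>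
      upd 300 (tick k ?s2) s' \<and> repS s' (book E' ?f {} {})"
    using op
  proof (elim disjE conjE)
    assume op: "regs s 0 = 1" "{u, v} \<notin> E" "E' = insert {u, v} E"
    let ?s = "tick 3 (tick k ?s2)"
    let ?bk = "book E ?f {} {}"
    have ss: "static ?s" "repS ?s ?bk" using s2 by auto
    have nE: "{v, u} \<notin> E" using op by (simp add: insert_commute)
    obtain s3 where s3: "exec M (add_com 1 16 2) ?s = return_spmf s3" "upd 100 ?s s3"
       "repS s3 (?bk(u := (?bk u)(v := Some b)))"
      using exec_add[OF ss, of 1 16 2] s2(3-) uv uN bN op by (auto simp: book_def)
    have r3: "regs s3 = regs ?s2" using s3(2) by (simp add: upd_def)
    have st3: "static s3" using static_upd[OF s3(2)] ss by simp
    obtain s4 where s4: "exec M (add_com 2 16 1) s3 = return_spmf s4" "upd 100 s3 s4"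
       "repS s4 (?bk(u := (?bk u)(v := Some b), v := (?bk v)(u := Some b)))"
      using exec_add[OF st3 s3(3), of 2 16 1] s2(3-) uv uN bN nE
      by (auto simp: book_def r3 simp del: regs_simps)
    have "?bk(u := (?bk u)(v := Some b), v := (?bk v)(u := Some b)) = book E' ?f {} {}"
      using uv op by (intro ext) (auto simp: book_def b_def doubleton_eq_iff min.commute)
    moreover have "upd 300 (tick k ?s2) s4" using s3(2) s4(2) by (simp add: upd_def)
    moreover have "exec M (Cond (Equal (Reg 0) (Const 1))
            (Seq (add_com 1 16 2) (add_com 2 16 1))
            (Seq (remove_com 1 16 2) (remove_com 2 16 1))) (tick k ?s2) = exec M (Seq (add_com 1 16 2) (add_com 2 16 1)) ?s"
      using op(1) s2(8) by (simp add: numeral_3_eq_3)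
    ultimately show ?thesis using s3(1) s4(1,3) by simp
  next
    assume op: "regs s 0 = 0" "{u, v} \<in> E" "E' = E - {{u, v}}"
    let ?s = "tick 3 (tick k ?s2)"
    let ?bk = "book E ?f {} {}"
    have ss: "static ?s" "repS ?s ?bk" using s2 by auto
    have nE: "{v, u} \<in> E" using op by (simp add: insert_commute)
    obtain s3 where s3: "exec M (remove_com 1 16 2) ?s = return_spmf s3" "upd 100 ?s s3"
       "repS s3 (?bk(u := (?bk u)(v := None)))"
      using exec_remove[OF ss, of 1 2 16] s2(3-) uv uN bN op by (auto simp: book_def b_def)
    have r3: "regs s3 = regs ?s2" using s3(2) by (simp add: upd_def)
    have st3: "static s3" using static_upd[OF s3(2)] ss by simp
    obtain s4 where s4: "exec M (remove_com 2 16 1) s3 = return_spmf s4" "upd 100 s3 s4"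
       "repS s4 (?bk(u := (?bk u)(v := None), v := (?bk v)(u := None)))"
      using exec_remove[OF st3 s3(3), of 2 1 16] s2(3-) uv uN bN nE
      by (auto simp: book_def b_def min.commute r3 simp del: regs_simps)
    have "?bk(u := (?bk u)(v := None), v := (?bk v)(u := None)) = book E' ?f {} {}"
      using uv op by (intro ext) (auto simp: book_def doubleton_eq_iff)
    moreover have "upd 300 (tick k ?s2) s4" using s3(2) s4(2) by (simp add: upd_def)
    moreover have "exec M (Cond (Equal (Reg 0) (Const 1))
            (Seq (add_com 1 16 2) (add_com 2 16 1))
            (Seq (remove_com 1 16 2) (remove_com 2 16 1))) (tick k ?s2) = exec M (Seq (remove_com 1 16 2) (remove_com 2 16 1)) ?s"
      using op(1) s2(8) by (simp add: numeral_3_eq_3)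
    ultimately show ?thesis using s3(1) s4(1,3) by simp
  qed
  then obtain s3 where s3: "exec M (Cond (Equal (Reg 0) (Const 1))
            (Seq (add_com 1 16 2) (add_com 2 16 1))
            (Seq (remove_com 1 16 2) (remove_com 2 16 1))) (tick k ?s2) = return_spmf s3"
      "upd 300 (tick k ?s2) s3" "repS s3 (book E' ?f {} {})" by blast
  have r3: "regs s3 = regs ?s2" using s3(2) by (simp add: upd_def)
  have st3: "static s3" using static_upd[OF s3(2)] s2(1) by simp
  let ?bk = "book E' ?f {} {}"
  obtain s4 where s4: "exec M (insert_com 3 7 1) s3 = return_spmf s4" "upd 200 s3 s4" "repS s4 (?bk(n := (?bk n)(u := Some 0)))"
    using exec_insert[OF st3 s3(3), of 3 7 1] s2(3-) uv n_less_N N_pos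
    by (auto simp: book_def r3 simp del: regs_simps)
  have r4: "regs s4 = regs ?s2" using s4(2) r3 by (simp add: upd_def)
  have st4: "static s4" using static_upd[OF s4(2)] st3 by simp
  obtain s5 where s5: "exec M (insert_com 3 7 2) s4 = return_spmf s5" "upd 200 s4 s5"
    "repS s5 (?bk(n := (?bk n)(u := Some 0, v := Some 0)))"
    using exec_insert[OF st4 s4(3), of 3 7 2] s2(3-) uv n_less_N N_pos
    by (auto simp: book_def r4 simp del: regs_simps)
  have "?bk(n := (?bk n)(u := Some 0, v := Some 0)) = book E' ?f {u, v} {}"
    by (intro ext) (auto simp: book_def)
  moreover have "exec M edge_com s = return_spmf s5"
  proof -
    have "exec M edge_com s = exec M (Seq (Seq (Assign 16 (Read 1 (Reg 1)))
     (Cond (Less (Read 1 (Reg 2)) (Reg 16)) (Assign 16 (Read 1 (Reg 2))) Skip))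
     (Seq (Cond (Equal (Reg 0) (Const 1))
            (Seq (add_com 1 16 2) (add_com 2 16 1))
            (Seq (remove_com 1 16 2) (remove_com 2 16 1)))
    (Seq (insert_com 3 7 1) (insert_com 3 7 2)))) (tick 7 ?s1)"
      unfolding exec_Seq_assoc[symmetric] by (simp only: edge_com_def exec.simps(5) e1 return_bind_spmf)
    also have "\<dots> = exec M (Seq (Cond (Equal (Reg 0) (Const 1))
            (Seq (add_com 1 16 2) (add_com 2 16 1))
            (Seq (remove_com 1 16 2) (remove_com 2 16 1)))
    (Seq (insert_com 3 7 1) (insert_com 3 7 2))) (tick k ?s2)"
      by (subst exec.simps(5)) (simp only: k(2) return_bind_spmf)
    finally show ?thesis by (simp only: exec.simps(5) s3(1) s4(1) s5(1) return_bind_spmf)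
  qed
  moreover have "time s5 \<le> time s + 1000"
    using s3(2) s4(2) s5(2) k(1) by (simp add: upd_def)
  moreover have "arrays s5 1 = lev"
    using s3(2) s4(2) s5(2) lev by (simp add: upd_def)
  ultimately show ?thesis using s5(3) by auto
qed

end

section \<open>The potential\<close>

context level_params
begin

definition deg :: "nat set set \<Rightarrow> (nat \<Rightarrow> nat) \<Rightarrow> nat \<Rightarrow> nat \<Rightarrow> nat" where
  "deg E lev j v = card {w. {v, w} \<in> E \<and> j \<le> lev w}"

text \<open>The extra 1 for equal levels makes an edge pay at every step of its lower end: if
  \<open>x\<close> rises from \<open>l\<close>, an edge to level \<open>l\<close> loses the extra 1,
  one to level \<open>l + 1\<close> loses 2 and gains the extra 1, and one to a higher level loses
  2.\<close>

definition edge_term :: "nat set set \<Rightarrow> (nat \<Rightarrow> nat) \<Rightarrow> nat \<Rightarrow> nat \<Rightarrow> nat" where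
  "edge_term E lev v w =
     (if {v, w} \<in> E then 2 * (K - min (lev v) (lev w)) + (if lev v = lev w then 1 else 0) else 0)"

definition edge_pot :: "nat set set \<Rightarrow> (nat \<Rightarrow> nat) \<Rightarrow> nat" where
  "edge_pot E lev = (\<Sum>v<n. \<Sum>w<n. edge_term E lev v w)"

text \<open>Savings for a later descent: for every level \<open>j\<close> below \<open>v\<close>,
  what \<open>v\<close> lacks to the bound \<open>3 * T j\<close> for rising from \<open>j\<close>,
  where the subtraction is truncated at 0. Directly after the rise nothing is lacking at
  \<open>j\<close>; when \<open>v\<close> falls from \<open>j + 1\<close> for want of
  \<open>T j\<close> neighbours, more than \<open>2 * T j\<close> has been saved.\<close>

definition debt :: "nat set set \<Rightarrow> (nat \<Rightarrow> nat) \<Rightarrow> nat \<Rightarrow> nat" where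
  "debt E lev v = (\<Sum>j<lev v. 3 * T j - deg E lev j v)"

definition debt_pot :: "nat set set \<Rightarrow> (nat \<Rightarrow> nat) \<Rightarrow> nat" where
  "debt_pot E lev = (\<Sum>v<n. debt E lev v)"

definition stable :: "nat set set \<Rightarrow> (nat \<Rightarrow> nat) \<Rightarrow> nat \<Rightarrow> bool" where
  "stable E lev v \<longleftrightarrow> deg E lev (lev v) v \<le> 3 * T (lev v) \<and>
     (0 < lev v \<longrightarrow> T (lev v - 1) \<le> deg E lev (lev v - 1) v)"

lemma nbs_subset: "graph_on n E \<Longrightarrow> {w. {v, w} \<in> E \<and> P w} \<subseteq> {..<n} - {v}"
  using graph_onD[of n E v] by blast

lemma finite_nbs [simp]: "graph_on n E \<Longrightarrow> finite {w. {v, w} \<in> E \<and> P w}"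
  using nbs_subset[of E v P] by (meson finite_Diff finite_lessThan finite_subset)

lemma deg_le:
  assumes "graph_on n E"
  shows "deg E lev j v \<le> n"
proof -
  have "{w. {v, w} \<in> E \<and> j \<le> lev w} \<subseteq> {..<n}"
    using nbs_subset[OF assms, of v "\<lambda>w. j \<le> lev w"] by blast
  from card_mono[OF finite_lessThan this] show ?thesis by (simp add: deg_def)
qed

lemma deg_mono:
  assumes "graph_on n E" "\<And>w. {v, w} \<in> E \<Longrightarrow> j \<le> lev w \<Longrightarrow> {v, w} \<in> E' \<and> j' \<le> lev' w" "graph_on n E'"
  shows "deg E lev j v \<le> deg E' lev' j' v"
  unfolding deg_def using assms by (intro card_mono) auto

lemma not_top:
  assumes "graph_on n E" "3 * T (lev v) < deg E lev (lev v) v" "lev v \<le> K"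
  shows "lev v < K"
proof (rule ccontr)
  assume "\<not> lev v < K"
  then have "lev v = K" using assms by simp
  then show False using assms(2) T_K deg_le[OF assms(1), of lev "lev v" v] by simp
qed

lemma sum_row:
  assumes "x < n"
  shows "(\<Sum>v<n. \<Sum>w<n. if v = x \<and> w \<in> D then c else 0) = c * card (D \<inter> {..<n})" (is "?l = _")
proof -
  have "?l = (\<Sum>v<n. if v = x then \<Sum>w<n. if w \<in> D then c else 0 else 0)"
    by (intro sum.cong) auto
  also have "\<dots> = (\<Sum>w<n. if w \<in> D then c else 0)" using assms by simp
  also have "\<dots> = (\<Sum>w\<in>{..<n} \<inter> D. c)" by (simp only: sum.inter_restrict finite_lessThan)
  finally show ?thesis by (simp add: Int_commute mult.commute)
qed

context
  fixes E :: "nat set set" and lev :: "nat \<Rightarrow> nat" and x :: nat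
  assumes E: "graph_on n E" and lev: "\<forall>v<n. lev v \<le> K" and x: "x < n"
begin

text \<open>By the choice of \<open>edge_term\<close>, every edge to level \<open>lev x\<close> or
  above loses at least 1 in each direction; only the direction starting in \<open>x\<close> is
  counted.\<close>

lemma edge_pot_up:
  assumes "lev x < K"
  shows "edge_pot E (lev(x := Suc (lev x))) + deg E lev (lev x) x \<le> edge_pot E lev"
proof -
  let ?D = "{w. {x, w} \<in> E \<and> lev x \<le> lev w}" and ?lev = "lev(x := Suc (lev x))"
  have D: "?D \<inter> {..<n} = ?D" using nbs_subset[OF E, of x] by blast
  have "edge_term E ?lev v w + (if v = x \<and> w \<in> ?D then 1 else 0) \<le> edge_term E lev v w"
    if "v < n" "w < n" for v w
  proof (cases "{v, w} \<in> E")
    case True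
    have "v \<noteq> w" using graph_onD(3)[OF E True] .
    then consider "v = x" "w \<noteq> x" | "v \<noteq> x" "w = x" | "v \<noteq> x" "w \<noteq> x" by blast
    then show ?thesis
    proof cases
      case 1
      then show ?thesis using True assms by (auto simp: edge_term_def min_def)
    next
      case 2
      then show ?thesis using True assms by (auto simp: edge_term_def min_def)
    qed (simp add: edge_term_def)
  qed (auto simp: edge_term_def)
  then have "(\<Sum>v<n. \<Sum>w<n. edge_term E ?lev v w + (if v = x \<and> w \<in> ?D then 1 else 0)) \<le> edge_pot E lev"
    unfolding edge_pot_def by (intro sum_mono) auto
  then show ?thesis
    by (simp only: sum.distrib sum_row[OF x] D edge_pot_def deg_def mult_1)
qed

text \<open>The only new summand belongs to \<open>lev x\<close> itself and is 0, as
  \<open>x\<close> has more than \<open>3 * T (lev x)\<close> neighbours on that level or above; all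
  other degrees can only grow.\<close>

lemma debt_pot_up:
  assumes "3 * T (lev x) < deg E lev (lev x) x"
  shows "debt_pot E (lev(x := Suc (lev x))) \<le> debt_pot E lev"
  unfolding debt_pot_def
proof (rule sum_mono)
  fix v assume "v \<in> {..<n}"
  let ?lev = "lev(x := Suc (lev x))"
  have mono: "deg E lev j v \<le> deg E ?lev j v" for j
    by (rule deg_mono[OF E _ E]) auto
  show "debt E ?lev v \<le> debt E lev v"
  proof (cases "v = x")
    case False
    then show ?thesis unfolding debt_def using mono by (auto intro!: sum_mono diff_le_mono2)
  next
    case True
    have "debt E ?lev v = (\<Sum>j<lev x. 3 * T j - deg E ?lev j v) + (3 * T (lev x) - deg E ?lev (lev x) v)"
      using True by (simp add: debt_def)
    moreover have "3 * T (lev x) - deg E ?lev (lev x) v = 0"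
      using mono[of "lev x"] assms True by simp
    ultimately show ?thesis
      unfolding debt_def using mono True by (auto intro!: sum_mono diff_le_mono2)
  qed
qed

text \<open>Only edges to level \<open>l\<close> or above are affected, each by at most 2 in either
  direction.\<close>

lemma edge_pot_down:
  assumes "lev x = Suc l"
  shows "edge_pot E (lev(x := l)) \<le> edge_pot E lev + 4 * deg E lev l x"
proof -
  let ?D = "{w. {x, w} \<in> E \<and> l \<le> lev w}" and ?lev = "lev(x := l)"
  have D: "?D \<inter> {..<n} = ?D" using nbs_subset[OF E, of x] by blast
  have "edge_term E ?lev v w \<le> edge_term E lev v w + ((if v = x \<and> w \<in> ?D then 2 else 0) + (if w = x \<and> v \<in> ?D then 2 else 0))"
    if "v < n" "w < n" for v w
  proof (cases "{v, w} \<in> E")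
    case True
    have "v \<noteq> w" using graph_onD(3)[OF E True] .
    then consider "v = x" "w \<noteq> x" | "v \<noteq> x" "w = x" | "v \<noteq> x" "w \<noteq> x" by blast
    then show ?thesis
    proof cases
      case 1
      have "lev w \<le> K" using lev that by simp
      then show ?thesis using 1 True assms by (simp add: edge_term_def min_def) arith
    next
      case 2
      have "{x, v} \<in> E" using True 2(2) by (simp only: insert_commute[of x v "{}"])
      then have "v \<in> ?D \<longleftrightarrow> l \<le> lev v" by simp
      moreover have "lev v \<le> K" using lev that by simp
      ultimately show ?thesis using 2 True assms by (simp add: edge_term_def min_def) arith
    qed (simp add: edge_term_def)
  qed (simp add: edge_term_def)
  then have "edge_pot E ?lev \<le> (\<Sum>v<n. \<Sum>w<n. edge_term E lev v w + ((if v = x \<and> w \<in> ?D then 2 else 0) + (if w = x \<and> v \<in> ?D then 2 else 0)))"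
    unfolding edge_pot_def by (intro sum_mono) auto
  moreover have "(\<Sum>v<n. \<Sum>w<n. if w = x \<and> v \<in> ?D then 2 else 0) = (\<Sum>v<n. \<Sum>w<n. if v = x \<and> w \<in> ?D then 2::nat else 0)"
    by (rule sum.swap)
  ultimately show ?thesis
    by (simp only: sum.distrib sum_row[OF x] D edge_pot_def deg_def)
qed

text \<open>The summand for \<open>l\<close> disappears from the debt of \<open>x\<close>; it
  exceeds \<open>2 * T l\<close>. In return the degree towards level \<open>l + 1\<close> drops by
  one for neighbours above that level, which adds at most \<open>deg E lev l x < T l\<close> to
  their debts. A surplus of \<open>T l\<close> remains.\<close>

lemma debt_pot_down:
  assumes "lev x = Suc l" "deg E lev l x < T l"
  shows "debt_pot E (lev(x := l)) + T l \<le> debt_pot E lev"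
proof -
  let ?lev = "lev(x := l)" and ?D = "{w. {x, w} \<in> E \<and> l \<le> lev w}"
  have D: "?D \<inter> {..<n} = ?D" using nbs_subset[OF E, of x] by blast
  have same: "deg E ?lev j v = deg E lev j v" if "j \<noteq> Suc l \<or> {v, x} \<notin> E" for j v
    unfolding deg_def using that assms by (intro arg_cong[of _ _ card]) (auto simp: le_Suc_eq)
  have less: "deg E lev j v \<le> Suc (deg E ?lev j v)" for j v
  proof -
    have "{w. {v, w} \<in> E \<and> j \<le> lev w} \<subseteq> insert x {w. {v, w} \<in> E \<and> j \<le> ?lev w}" by auto
    then have "deg E lev j v \<le> card (insert x {w. {v, w} \<in> E \<and> j \<le> ?lev w})"
      unfolding deg_def by (intro card_mono) (simp_all add: E)
    also have "\<dots> \<le> Suc (deg E ?lev j v)" unfolding deg_def by (rule card_insert_le_m1) simp_all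
    finally show ?thesis .
  qed
  have other: "debt E ?lev v \<le> debt E lev v + (if v \<in> ?D then 1 else 0)" if "v \<noteq> x" for v
  proof (cases "{v, x} \<in> E \<and> Suc l < lev v")
    case True
    then have "{x, v} \<in> E" by (simp only: insert_commute[of x v "{}"])
    then have D_mem: "v \<in> ?D" using True by simp
    have "debt E ?lev v \<le> (\<Sum>j<lev v. (3 * T j - deg E lev j v) + (if j = Suc l then 1 else 0))"
      unfolding debt_def using that
    proof (simp, intro sum_mono)
      fix j
      show "3 * T j - deg E ?lev j v \<le> 3 * T j - deg E lev j v + (if j = Suc l then 1 else 0)"
        using same[of j v] less[of j v] by (cases "j = Suc l") simp_all
    qed
    also have "\<dots> = debt E lev v + 1" using True by (simp add: sum.distrib debt_def)
    finally show ?thesis using D_mem True by simp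
  next
    case False
    then have "deg E ?lev j v = deg E lev j v" if "j < lev v" for j
    proof -
      have "j \<noteq> Suc l \<or> {v, x} \<notin> E" using False \<open>j < lev v\<close> by blast
      then show ?thesis by (rule same)
    qed
    then have "debt E ?lev v = debt E lev v" unfolding debt_def using that by simp
    then show ?thesis by simp
  qed
  have self: "debt E ?lev x + 2 * T l \<le> debt E lev x"
  proof -
    have nE: "{x, x} \<notin> E" using graph_onD(3)[OF E, of x x] by blast
    have "debt E ?lev x = (\<Sum>j<l. 3 * T j - deg E lev j x)"
      unfolding debt_def using same nE by simp
    moreover have "debt E lev x = (\<Sum>j<l. 3 * T j - deg E lev j x) + (3 * T l - deg E lev l x)"
      unfolding debt_def using assms(1) by simp
    ultimately show ?thesis using assms(2) by simp
  qed
  have "(\<Sum>v<n. debt E ?lev v + (if v = x then 2 * T l else 0)) \<le> (\<Sum>v<n. debt E lev v + (if v \<in> ?D then 1 else 0))"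
  proof (rule sum_mono)
    fix v
    show "debt E ?lev v + (if v = x then 2 * T l else 0) \<le> debt E lev v + (if v \<in> ?D then 1 else 0)"
      by (cases "v = x") (use self other[of v] in simp_all)
  qed
  moreover have "(\<Sum>v<n. if v \<in> ?D then 1 else 0 :: nat) = deg E lev l x"
  proof -
    have "(\<Sum>v<n. if v \<in> ?D then 1 else 0 :: nat) = (\<Sum>v\<in>{..<n} \<inter> ?D. 1)" by (simp only: sum.inter_restrict finite_lessThan)
    then show ?thesis using D by (simp add: deg_def Int_commute)
  qed
  ultimately show ?thesis using assms(2) x by (simp add: sum.distrib debt_pot_def)
qed

end

lemma edge_pot_insert:
  assumes "graph_on n E" "u < n" "v < n"
  shows "edge_pot (insert {u, v} E) lev \<le> edge_pot E lev + (4 * K + 2)"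
proof -
  have "edge_term (insert {u, v} E) lev a b \<le> edge_term E lev a b +
      ((if a = u \<and> b \<in> {v} then 2 * K + 1 else 0) + (if a = v \<and> b \<in> {u} then 2 * K + 1 else 0))" for a b
  proof (cases "(a = u \<and> b = v) \<or> (a = v \<and> b = u)")
    case True
    have "edge_term (insert {u, v} E) lev a b \<le> 2 * K + 1"
      unfolding edge_term_def using diff_le_self[of K "min (lev a) (lev b)"] by (simp split del: if_split) auto
    moreover have "2 * K + 1 \<le> (if a = u \<and> b \<in> {v} then 2 * K + 1 else 0) + (if a = v \<and> b \<in> {u} then 2 * K + 1 else 0)"
      using True by (elim disjE) simp_all
    ultimately show ?thesis by linarith
  next
    case False
    then have "{a, b} \<noteq> {u, v}" by (auto simp: doubleton_eq_iff)
    then show ?thesis by (simp add: edge_term_def)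
  qed
  then have "edge_pot (insert {u, v} E) lev \<le> (\<Sum>a<n. \<Sum>b<n. edge_term E lev a b +
      ((if a = u \<and> b \<in> {v} then 2 * K + 1 else 0) + (if a = v \<and> b \<in> {u} then 2 * K + 1 else 0)))"
    unfolding edge_pot_def by (intro sum_mono) auto
  then show ?thesis
    using assms by (simp only: sum.distrib sum_row edge_pot_def) simp
qed

lemma edge_pot_mono: "E' \<subseteq> E \<Longrightarrow> edge_pot E' lev \<le> edge_pot E lev"
  unfolding edge_pot_def edge_term_def by (intro sum_mono) auto

lemma debt_pot_mono:
  assumes "graph_on n E" "graph_on n E'" "E \<subseteq> E'"
  shows "debt_pot E' lev \<le> debt_pot E lev"
  unfolding debt_pot_def debt_def using assms
  by (intro sum_mono diff_le_mono2 deg_mono) auto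

text \<open>Each end loses one neighbour in the degrees towards its at most \<open>K\<close> lower
  levels; nobody else is affected.\<close>

lemma debt_pot_delete:
  assumes E: "graph_on n E" and lev: "\<forall>v<n. lev v \<le> K" and u: "u < n" "v < n"
  shows "debt_pot (E - {{u, v}}) lev \<le> debt_pot E lev + 2 * K"
proof -
  have *: "deg E lev j a \<le> deg (E - {{u, v}}) lev j a + (if a = u \<or> a = v then 1 else 0)" for j a
  proof (cases "a = u \<or> a = v")
    case True
    define b where "b = (if a = u then v else u)"
    have "{w. {a, w} \<in> E \<and> j \<le> lev w} \<subseteq> insert b {w. {a, w} \<in> E - {{u, v}} \<and> j \<le> lev w}"
      using True by (auto simp: b_def doubleton_eq_iff)
    then have "deg E lev j a \<le> card (insert b {w. {a, w} \<in> E - {{u, v}} \<and> j \<le> lev w})"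
      unfolding deg_def using E by (intro card_mono finite.insertI finite_nbs) (auto simp: graph_on_def)
    also have "\<dots> \<le> Suc (deg (E - {{u, v}}) lev j a)" unfolding deg_def by (rule card_insert_le_m1) simp_all
    finally show ?thesis using True by simp
  next
    case False
    then show ?thesis unfolding deg_def by (auto simp: doubleton_eq_iff intro!: eq_imp_le arg_cong[of _ _ card])
  qed
  have "debt (E - {{u, v}}) lev a \<le> debt E lev a + ((if a = u then K else 0) + (if a = v then K else 0))" if "a < n" for a
  proof -
    have "debt (E - {{u, v}}) lev a \<le> (\<Sum>j<lev a. (3 * T j - deg E lev j a) + (if a = u \<or> a = v then 1 else 0))"
      unfolding debt_def
    proof (rule sum_mono)
      fix j
      show "3 * T j - deg (E - {{u, v}}) lev j a \<le> 3 * T j - deg E lev j a + (if a = u \<or> a = v then 1 else 0)"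
        using *[of j a] by auto
    qed
    also have "\<dots> = debt E lev a + lev a * (if a = u \<or> a = v then 1 else 0)"
      by (simp add: sum.distrib debt_def)
    finally show ?thesis using lev[rule_format, OF that] by (auto split: if_splits)
  qed
  then have "debt_pot (E - {{u, v}}) lev \<le> (\<Sum>a<n. debt E lev a + ((if a = u then K else 0) + (if a = v then K else 0)))"
    unfolding debt_pot_def by (intro sum_mono) auto
  then show ?thesis using u by (simp add: sum.distrib debt_pot_def)
qed

text \<open>Stability of \<open>v\<close> depends on degrees towards levels up to
  \<open>lev v\<close>. A neighbour \<open>x\<close> above \<open>v\<close> that descends by at most
  one level stays on level \<open>lev v\<close> or above and is counted as before.\<close>

lemma stable_other:
  assumes E: "graph_on n E" and v: "v \<noteq> x" "{x, v} \<in> E \<Longrightarrow> lev v < lev x"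
    and nl: "lev x \<le> Suc nl" and st: "stable E lev v"
  shows "stable E (lev(x := nl)) v"
proof -
  have "deg E (lev(x := nl)) j v = deg E lev j v" if "j \<le> lev v" for j
  proof -
    have "{v, x} \<in> E \<Longrightarrow> lev v < lev x" using v(2) by (simp add: insert_commute)
    then show ?thesis
      unfolding deg_def using that v(1) nl by (intro arg_cong[of _ _ card]) auto
  qed
  then show ?thesis using st v by (simp add: stable_def)
qed

text \<open>Worklist entries are prepaid rounds of \<open>settle_com\<close>, flags are prepaid
  recolorings of cost \<open>O(T)\<close>. An edge unit pays for what a rise entails; a debt unit is
  worth five edge units because a descent gives back up to four edge units per neighbour.\<close>

definition pot :: "nat set set \<Rightarrow> (nat \<Rightarrow> nat) \<Rightarrow> nat set \<Rightarrow> nat set \<Rightarrow> nat" where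
  "pot E lev W F = 8000 * edge_pot E lev + 40000 * debt_pot E lev + 2000 * card W
     + 2000 * (\<Sum>v\<in>F. T (lev v))"

lemma flag_sum:
  assumes "finite F"
  shows "(\<Sum>v\<in>insert x F. T ((lev(x := nl)) v)) \<le> (\<Sum>v\<in>F. T (lev v)) + T nl"
proof -
  have "(\<Sum>v\<in>insert x F. T ((lev(x := nl)) v)) = T nl + (\<Sum>v\<in>F - {x}. T ((lev(x := nl)) v))"
    using assms by (subst sum.insert_remove) auto
  also have "(\<Sum>v\<in>F - {x}. T ((lev(x := nl)) v)) = (\<Sum>v\<in>F - {x}. T (lev v))"
    by (intro sum.cong) auto
  also have "\<dots> \<le> (\<Sum>v\<in>F. T (lev v))" using assms by (intro sum_mono2) auto
  finally show ?thesis by simp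
qed

text \<open>Each of the \<open>d\<close> units released by the edges pays 2000 for a new worklist
  entry, 2000 for the flag and 1200 + 2000 for the running time, 7200 in all and below 8000.\<close>

lemma pot_up_arith:
  fixes a b w d s t :: nat
  assumes "s' \<le> s + d" "a' + d \<le> a" "b' \<le> b" "w' \<le> w + d" "1 \<le> d"
  shows "8000 * a' + 40000 * b' + 2000 * w' + 2000 * s' + (1200 * d + 2000)
    \<le> 8000 * a + 40000 * b + 2000 * w + 2000 * s"
  using assms by linarith

text \<open>Per unit of \<open>t\<close> the debts release 40000; the edges take back at most
  \<open>4 * 8000\<close>, worklist and flag 2000 each, the running time 1200 + 2000, together
  39200.\<close>

lemma pot_down_arith:
  fixes a b w d e s t :: nat
  assumes "d \<le> e" "a' \<le> a + 4 * e" "b' + t \<le> b" "w' \<le> w + d" "s' \<le> s + t" "e < t" "1 \<le> t"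
  shows "8000 * a' + 40000 * b' + 2000 * w' + 2000 * s' + (1200 * d + 2000)
    \<le> 8000 * a + 40000 * b + 2000 * w + 2000 * s"
  using assms by linarith

context
  fixes E :: "nat set set" and lev :: "nat \<Rightarrow> nat" and x :: nat and W F :: "nat set"
  assumes E: "graph_on n E" and lev: "\<forall>v<n. lev v \<le> K" and x: "x < n"
    and W: "finite W" "x \<in> W" and F: "finite F"
begin

text \<open>\<open>x\<close> leaves the worklist and enters it again, so only its neighbours can be
  new.\<close>

lemma work_card:
  "card ((W - {x}) \<union> insert x {w. {x, w} \<in> E \<and> lev x \<le> lev w}) \<le> card W + deg E lev (lev x) x"
proof -
  have "(W - {x}) \<union> insert x {w. {x, w} \<in> E \<and> lev x \<le> lev w} = W \<union> {w. {x, w} \<in> E \<and> lev x \<le> lev w}"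
    using W by auto
  then show ?thesis by (simp add: card_Un_le deg_def)
qed

lemma pot_up:
  assumes up: "3 * T (lev x) < deg E lev (lev x) x"
  shows "pot E (lev(x := Suc (lev x))) ((W - {x}) \<union> insert x {w. {x, w} \<in> E \<and> lev x \<le> lev w}) (insert x F)
    + (1200 * deg E lev (lev x) x + 2000) \<le> pot E lev W F"
proof -
  let ?d = "deg E lev (lev x) x" and ?lev = "lev(x := Suc (lev x))"
  have "1 \<le> ?d" using up by simp
  have lK: "lev x < K" using not_top[OF E up] lev[rule_format, OF x] by simp
  \<comment> \<open>The new flag costs \<open>T (Suc (lev x)) \<le> 2 * T (lev x)\<close>, which is
    less than the degree that caused the rise.\<close>
  have flags: "(\<Sum>v\<in>insert x F. T (?lev v)) \<le> (\<Sum>v\<in>F. T (lev v)) + ?d"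
    using flag_sum[OF F, of lev x "Suc (lev x)"] T_Suc[of "lev x"] up by linarith
  from flags edge_pot_up[where E = E and lev = lev and x = x, OF E lev x lK]
    debt_pot_up[where E = E and lev = lev and x = x, OF E lev x up] work_card \<open>1 \<le> ?d\<close>
  show ?thesis
    unfolding pot_def by (rule pot_up_arith)
qed

lemma pot_down:
  assumes down: "lev x = Suc l" "deg E lev l x < T l"
  shows "pot E (lev(x := l)) ((W - {x}) \<union> insert x {w. {x, w} \<in> E \<and> lev x \<le> lev w}) (insert x F)
    + (1200 * deg E lev (lev x) x + 2000) \<le> pot E lev W F"
proof -
  have "1 \<le> T l" using T_pos[of l] by linarith
  have le: "deg E lev (lev x) x \<le> deg E lev l x"
    by (rule deg_mono[OF E _ E]) (use down in auto)
  from le edge_pot_down[where E = E and lev = lev and x = x, OF E lev x down(1)]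
    debt_pot_down[where E = E and lev = lev and x = x, OF E lev x down] work_card
    flag_sum[OF F, of lev x l] down(2) \<open>1 \<le> T l\<close>
  show ?thesis
    unfolding pot_def by (rule pot_down_arith)
qed

end

end

section \<open>Restoring the level invariants\<close>

text \<open>Used to see that every round of the settling loop advances the clock.\<close>

lemma exec_time_mono:
  assumes "s' \<in> set_spmf (exec M c s)"
  shows "time s \<le> time s'"
  using assms
proof (induction c arbitrary: s s')
  case (Seq c1 c2)
  from Seq.prems obtain t where t: "t \<in> set_spmf (exec M c1 s)" "s' \<in> set_spmf (exec M c2 t)"
    by (auto simp: set_bind_spmf)
  from Seq.IH(1)[OF t(1)] Seq.IH(2)[OF t(2)] show ?case by simp
next
  case (Cond b c1 c2)
  show ?case
  proof (cases "bval M s b")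
    case True
    then show ?thesis using Cond.IH(1)[of s' "tick (bcost b) s"] Cond.prems by simp
  next
    case False
    then show ?thesis using Cond.IH(2)[of s' "tick (bcost b) s"] Cond.prems by simp
  qed
next
  case (While b c)
  have "\<forall>s' \<in> set_spmf (loop (\<lambda>s. bval M s b)
      (\<lambda>s. map_spmf (tick (bcost b)) (exec M c s)) (tick (bcost b) s)). time s \<le> time s'"
  proof (rule loop_invariant)
    show "time s \<le> time (tick (bcost b) s)" by simp
    fix t t' assume t: "time s \<le> time t" "t' \<in> set_spmf (map_spmf (tick (bcost b)) (exec M c t))"
    then obtain t'' where "t'' \<in> set_spmf (exec M c t)" "t' = tick (bcost b) t''" by auto
    with While.IH[OF this(1)] t(1) show "time s \<le> time t'" by simp
  qed
  with While.prems show ?case by (simp add: exec.simps(7))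
qed (auto split: if_splits)

context level_params
begin

abbreviation lbook :: "nat set set \<Rightarrow> (nat \<Rightarrow> nat) \<Rightarrow> nat set \<Rightarrow> nat set \<Rightarrow> nat \<Rightarrow> nat \<Rightarrow> nat option" where
  "lbook E lev \<equiv> book E (\<lambda>r w. min (lev r) (lev w))"

text \<open>Filing an edge under the smaller level puts all neighbours on level \<open>lev x\<close>
  or above into one set of \<open>x\<close>, and those on a lower level \<open>j\<close> into set
  \<open>j\<close>. Hence both tests for a move need only read counters.\<close>

lemma count_top:
  assumes rp: "repS s (lbook E lev W F)" and E: "graph_on n E" and x: "x < n" and l: "lev x < N"
  shows "arrays s 2 (ix N x (lev x)) = deg E lev (lev x) x"
proof -
  have xN: "x < N" using x n_less_N by simp
  have "{w. lbook E lev W F x w = Some (lev x)} = {w. {x, w} \<in> E \<and> lev x \<le> lev w}"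
    using x by (auto simp: book_def min_def split: if_splits)
  then show ?thesis using rep_count(1)[OF rp[unfolded repS_def] xN l] by (simp add: deg_def)
qed

lemma count_below:
  assumes rp: "repS s (lbook E lev W F)" and E: "graph_on n E" and x: "x < n" and l: "lev x < N" "lev x = Suc l"
  shows "arrays s 2 (ix N x (lev x)) + arrays s 2 (ix N x l) = deg E lev l x"
proof -
  have xN: "x < N" using x n_less_N by simp
  have lN: "l < N" using l by simp
  have "{w. lbook E lev W F x w = Some l} = {w. {x, w} \<in> E \<and> l = lev w}"
    using x l(2) by (auto simp: book_def min_def split: if_splits)
  then have "arrays s 2 (ix N x l) = card {w. {x, w} \<in> E \<and> l = lev w}"
    using rep_count(1)[OF rp[unfolded repS_def] xN lN] by simp
  moreover have "arrays s 2 (ix N x (lev x)) = card {w. {x, w} \<in> E \<and> lev x \<le> lev w}"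
    using count_top[OF rp E x l(1)] by (simp add: deg_def)
  moreover have "{w. {x, w} \<in> E \<and> l \<le> lev w} = {w. {x, w} \<in> E \<and> lev x \<le> lev w} \<union> {w. {x, w} \<in> E \<and> l = lev w}"
    using l(2) by auto
  moreover have "card ({w. {x, w} \<in> E \<and> lev x \<le> lev w} \<union> {w. {x, w} \<in> E \<and> l = lev w}) =
      card {w. {x, w} \<in> E \<and> lev x \<le> lev w} + card {w. {x, w} \<in> E \<and> l = lev w}"
    using l(2) by (intro card_Un_disjoint finite_nbs[OF E]) auto
  ultimately show ?thesis by (simp add: deg_def)
qed

definition target :: "nat set set \<Rightarrow> (nat \<Rightarrow> nat) \<Rightarrow> nat \<Rightarrow> nat" where
  "target E lev x =
     (if 3 * T (lev x) < deg E lev (lev x) x then Suc (lev x)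
      else if 0 < lev x \<and> deg E lev (lev x - 1) x < T (lev x - 1) then lev x - 1
      else lev x)"

abbreviation decide_com :: com where
  "decide_com \<equiv> Cond (Less (Times (Const 3) (Read 5 (Reg 11))) (Reg 12))
           (Assign 13 (Plus (Reg 11) (Const 1)))
           (Cond (Less (Const 0) (Reg 11))
             (Seq (Assign 16 (Minus (Reg 11) (Const 1)))
               (Cond (Less (Plus (Reg 12) (cnt_e 10 16)) (Read 5 (Reg 16)))
                  (Assign 13 (Reg 16)) Skip))
             Skip)"

lemma exec_decide:
  assumes st: "static s" and rp: "repS s (lbook E lev W F)" and E: "graph_on n E"
    and lev: "\<forall>v<n. lev v \<le> K"
    and x: "regs s 10 = x" "x < n" and l: "regs s 11 = lev x" and c: "regs s 12 = arrays s 2 (ix N x (lev x))"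
    and nl: "regs s 13 = lev x"
  shows "\<exists>s'. exec M decide_com s = return_spmf s' \<and> arrays s' = arrays s \<and>
    (\<forall>r. r \<notin> {13, 16} \<longrightarrow> regs s' r = regs s r) \<and> regs s' 13 = target E lev x \<and> time s' \<le> time s + 100"
proof -
  have lK: "lev x \<le> K" using lev x by simp
  then have lN: "lev x < N" using K_less_N by simp
  have xN: "x < N" using x n_less_N by simp
  have N4: "regs s 4 = N" using st by (simp add: static_def)
  have T: "arrays s 5 l = T l" if "l \<le> K" for l using st that by (simp add: static_def)
  have nM: "8 * n < M"
  proof -
    have "8 * n \<le> 8 * n * N" using N_pos by (cases N) auto
    then show ?thesis using N3_less_M(6) by linarith
  qed
  have T3: "3 * T (lev x) mod M = 3 * T (lev x)"
    using T_le[OF lK] nM by simp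
  have lM: "Suc (lev x) mod M = Suc (lev x)"
    using lK K_less_N N3_less_M(3) by simp
  have d: "regs s 12 = deg E lev (lev x) x" using c count_top[OF rp E x(2) lN] by simp
  show ?thesis
  proof (cases "3 * T (lev x) < deg E lev (lev x) x")
    case True
    then have "exec M decide_com s = return_spmf (tick 10 (set_reg 13 (Suc (lev x)) s))"
      using d l T[OF lK] T3 lM by simp
    then show ?thesis using True by (simp add: target_def)
  next
    case False
    show ?thesis
    proof (cases "lev x")
      case 0
      then have "exec M decide_com s = return_spmf (tick 10 s)"
        using d l T[of 0] T3 False by simp
      then show ?thesis using 0 False nl by (simp add: target_def)
    next
      case (Suc l')
      have l'N: "l' < N" "l' \<le> K" using Suc lN lK by auto
      have cb: "deg E lev (lev x) x + arrays s 2 (ix N x l') = deg E lev l' x"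
        using count_below[OF rp E x(2) lN Suc] count_top[OF rp E x(2) lN] by simp
      let ?s = "set_reg 16 l' s"
      have cnt: "aval M ?s (cnt_e 10 16) = arrays s 2 (ix N x l')"
        using aval_set(1)[of ?s 10 16] N4 x xN l'N by simp
      have dM: "deg E lev l' x mod M = deg E lev l' x"
        using deg_le[OF E, of lev l' x] nM by simp
      have "exec M decide_com s = return_spmf (if deg E lev l' x < T l' then tick 26 (set_reg 13 l' ?s) else tick 25 ?s)"
        using d l T[OF lK] T[OF l'N(2)] T3 False Suc cb dM cnt by simp
      moreover have "target E lev x = (if deg E lev l' x < T l' then l' else lev x)"
        using False Suc by (simp add: target_def)
      ultimately show ?thesis using nl by simp
    qed
  qed
qed

lemma stable_if_target:
  "target E lev x = lev x \<Longrightarrow> stable E lev x"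
  by (auto simp: target_def stable_def split: if_splits)

text \<open>One round lowers time plus potential by at least 100, which leaves room for the guard of
  the loop. A round without a move is covered by \<open>nl = lev x\<close>.\<close>

lemma exec_settle_body:
  assumes st: "static s" and rp: "repS s (lbook E lev W F)" and E: "graph_on n E"
    and lev: "arrays s 1 = lev" "\<forall>v<n. lev v \<le> K"
    and W: "W \<subseteq> {..<n}" "W \<noteq> {}" and F: "F \<subseteq> {..<n}"
    and stab: "\<forall>v<n. v \<notin> W \<longrightarrow> stable E lev v"
  shows "\<exists>s' W' F' x nl. exec M settle_body s = return_spmf s' \<and> static s' \<and>
    arrays s' 1 = lev(x := nl) \<and> (\<forall>v<n. (lev(x := nl)) v \<le> K) \<and> repS s' (lbook E (lev(x := nl)) W' F') \<and>
    W' \<subseteq> {..<n} \<and> F' \<subseteq> {..<n} \<and> F \<subseteq> F' \<and> (x \<in> F' \<or> nl = lev x) \<and>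
    (\<forall>v<n. v \<notin> W' \<longrightarrow> stable E (lev(x := nl)) v) \<and>
    time s' + pot E (lev(x := nl)) W' F' + 100 \<le> time s + pot E lev W F"
proof -
  have N4: "regs s 3 = n" "regs s 4 = N" "regs s 7 = 0" using st by (auto simp: static_def)
  have finW: "finite W" and finF: "finite F" using W(1) F finite_subset by blast+
  have nN: "n < N" by (rule n_less_N)
  note rp' = rp[unfolded repS_def]
  have bkn: "{w. lbook E lev W F n w = Some 0} = W" by (auto simp: book_def)
  have c: "arrays s 2 (ix N n 0) = card W" using rep_count(1)[OF rp' nN N_pos] bkn by simp
  have cpos: "card W - 1 < card W" using W finW by (simp add: card_gt_0_iff)
  have cN: "card W < N" using card_mono[OF finite_lessThan W(1)] nN by simp
  define x where "x = arrays s 3 (ix N (ix N n 0) (card W - 1))"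
  have "lbook E lev W F n x = Some 0"
    using rep_index(1)[OF rp' nN N_pos, of "card W - 1"] c cpos by (simp add: x_def)
  then have xW: "x \<in> W" using bkn by blast
  then have x: "x < n" using W by auto
  have lK: "lev x \<le> K" using lev x by simp
  then have lN: "lev x < N" using K_less_N by simp
  have xN: "x < N" using x n_less_N by simp
  have e1: "exec M (Assign 10 (Read 3 (slot_e 3 7 (Minus (cnt_e 3 7) (Const 1))))) s = return_spmf (tick 18 (set_reg 10 x s))"
    using aval_set(1)[of s 3 7] aval_set(3)[of s 3 7 "Minus (cnt_e 3 7) (Const 1)"] N4 nN N_pos c cN
    by (simp add: x_def)
  let ?s1 = "tick 18 (set_reg 10 x s)"
  have s1: "static ?s1" "repS ?s1 (lbook E lev W F)" using st rp by auto
  obtain s2 where s2: "exec M (remove_com 3 7 10) ?s1 = return_spmf s2" "upd 100 ?s1 s2"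
     "repS s2 ((lbook E lev W F)(n := (lbook E lev W F n)(x := None)))"
    using exec_remove[OF s1, of 3 10 7] N4 nN \<open>lbook E lev W F n x = Some 0\<close> by auto
  have bk2: "(lbook E lev W F)(n := (lbook E lev W F n)(x := None)) = lbook E lev (W - {x}) F"
    by (intro ext) (auto simp: book_def)
  have st2: "static s2" using static_upd[OF s2(2)] s1(1) by simp
  have r2: "regs s2 = (regs s)(10 := x)" using updD(1)[OF s2(2)] by simp
  have a2: "arrays s2 1 = lev" using updD(3)[OF s2(2)] lev by simp
  let ?s3 = "tick 3 (set_reg 11 (lev x) s2)"
  have e3: "exec M (Assign 11 (Read 1 (Reg 10))) s2 = return_spmf ?s3"
    using a2 r2 by (simp add: numeral_3_eq_3)
  let ?c = "arrays s2 2 (ix N x (lev x))"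
  let ?s4 = "tick 7 (set_reg 12 ?c ?s3)"
  have e4: "exec M (Assign 12 (cnt_e 10 11)) ?s3 = return_spmf ?s4"
    using aval_set(1)[of ?s3 10 11] r2 N4 xN lN by simp
  let ?s5 = "tick 2 (set_reg 13 (lev x) ?s4)"
  have e5: "exec M (Assign 13 (Reg 11)) ?s4 = return_spmf ?s5" by (simp add: numeral_2_eq_2)
  have s5: "static ?s5" "repS ?s5 (lbook E lev (W - {x}) F)" "regs ?s5 10 = x" "regs ?s5 11 = lev x"
    "regs ?s5 12 = arrays ?s5 2 (ix N x (lev x))" "regs ?s5 13 = lev x"
    using st2 s2(3) r2 unfolding bk2 by simp_all
  obtain s6 where s6: "exec M decide_com ?s5 = return_spmf s6" "arrays s6 = arrays ?s5"
    "\<forall>r. r \<notin> {13, 16} \<longrightarrow> regs s6 r = regs ?s5 r" "regs s6 13 = target E lev x" "time s6 \<le> time ?s5 + 100"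
    using exec_decide[OF s5(1,2) E lev(2) s5(3) x s5(4,5,6)] by blast
  have st6: "static s6" "repS s6 (lbook E lev (W - {x}) F)" "arrays s6 1 = lev"
    "regs s6 10 = x" "regs s6 11 = lev x" "regs s6 12 = arrays s6 2 (ix N x (lev x))"
    using s5(1-5) a2 s6(2,3) by (simp_all add: static_def repS_def)
  have dc: "regs s6 12 = deg E lev (lev x) x" using count_top[OF st6(2) E x lN] st6(6) by simp
  have t6: "time s6 \<le> time s + 300" using s6(5) updD(8)[OF s2(2)] by simp
  have body: "exec M settle_body s = exec M (Cond (Equal (Reg 13) (Reg 11)) Skip move_com) s6"
    by (simp only: settle_body_def exec.simps(5) e1 s2(1) e3 e4 e5 s6(1) return_bind_spmf)
  show ?thesis
  proof (cases "target E lev x = lev x")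
    case True
    let ?s7 = "tick 4 s6"
    have e7: "exec M settle_body s = return_spmf ?s7" unfolding body using True s6(4) st6(5) by simp
    have id: "lev(x := lev x) = lev" by simp
    have st7: "\<forall>v<n. v \<notin> W - {x} \<longrightarrow> stable E lev v"
      using stab stable_if_target[OF True] by blast
    \<comment> \<open>Without a move the removed worklist entry is the only change; its 2000 pays
      for the round.\<close>
    have pot: "pot E lev (W - {x}) F + 2000 = pot E lev W F"
      using cpos card_Diff_singleton[OF xW] unfolding pot_def by simp
    have "time ?s7 + pot E lev (W - {x}) F + 100 \<le> time s + pot E lev W F"
      using pot t6 by simp
    moreover have "static ?s7" "repS ?s7 (lbook E lev (W - {x}) F)" "arrays ?s7 1 = lev"
      using st6(1-3) by simp_all
    moreover have "W - {x} \<subseteq> {..<n}" using W(1) by blast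
    ultimately have "exec M settle_body s = return_spmf ?s7 \<and> static ?s7 \<and>
      arrays ?s7 1 = lev(x := lev x) \<and> (\<forall>v<n. (lev(x := lev x)) v \<le> K) \<and>
      repS ?s7 (lbook E (lev(x := lev x)) (W - {x}) F) \<and>
      W - {x} \<subseteq> {..<n} \<and> F \<subseteq> {..<n} \<and> F \<subseteq> F \<and> (x \<in> F \<or> lev x = lev x) \<and>
      (\<forall>v<n. v \<notin> W - {x} \<longrightarrow> stable E (lev(x := lev x)) v) \<and>
      time ?s7 + pot E (lev(x := lev x)) (W - {x}) F + 100 \<le> time s + pot E lev W F"
      unfolding id using e7 lev(2) F st7 by blast
    then show ?thesis by blast
  next
    case False
    let ?nl = "target E lev x"
    let ?W = "(W - {x}) \<union> insert x {w. {x, w} \<in> E \<and> lev x \<le> lev w}"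
    have nl: "?nl \<le> K" "?nl \<le> Suc (lev x)" "lev x \<le> Suc ?nl"
      using not_top[OF E, of lev x] lK by (auto simp: target_def)
    let ?s7 = "tick 3 s6"
    have s7: "static ?s7" "repS ?s7 (lbook E lev (W - {x}) F)" "arrays ?s7 1 = lev"
      "regs ?s7 10 = x" "regs ?s7 11 = lev x" "regs ?s7 12 = arrays ?s7 2 (ix N x (lev x))" "regs ?s7 13 = ?nl"
      using st6 s6(4) by simp_all
    have levK: "\<And>v. v < n \<Longrightarrow> lev v \<le> K" using lev(2) by blast
    have "\<exists>s'. exec M move_com ?s7 = return_spmf s' \<and>
      repS s' (lbook E (lev(x := ?nl)) ?W (insert x F)) \<and> arrays s' 1 = lev(x := ?nl) \<and>
      time s' \<le> time ?s7 + 1200 * regs ?s7 12 + 1000"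
      by (rule exec_move[OF s7(1-3) levK E s7(4) x s7(5,6,7) nl]) assumption
    then obtain s8 where s8: "exec M move_com ?s7 = return_spmf s8"
      "repS s8 (lbook E (lev(x := ?nl)) ?W (insert x F))" "arrays s8 1 = lev(x := ?nl)"
      "time s8 \<le> time ?s7 + 1200 * regs ?s7 12 + 1000" by blast
    have e8: "exec M settle_body s = return_spmf s8"
      unfolding body using False s6(4) st6(5) s8(1) by (simp add: numeral_3_eq_3)
    have st8: "static s8"
    proof -
      have "s8 \<in> set_spmf (exec M move_com ?s7)" using s8(1) by simp
      then have "static s8 = static ?s7"
        by (rule static_exec[OF _ written_move])
      then show ?thesis using s7(1) by simp
    qed
    have pot: "pot E (lev(x := ?nl)) ?W (insert x F) + (1200 * deg E lev (lev x) x + 2000) \<le> pot E lev W F"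
    proof (cases "3 * T (lev x) < deg E lev (lev x) x")
      case True
      then show ?thesis using pot_up[OF E lev(2) x finW xW finF True] by (simp add: target_def)
    next
      case up: False
      then have *: "0 < lev x" "deg E lev (lev x - 1) x < T (lev x - 1)" "?nl = lev x - 1"
        using False by (auto simp: target_def split: if_splits)
      then have "lev x = Suc (lev x - 1)" by simp
      from pot_down[OF E lev(2) x finW xW finF this *(2)] show ?thesis unfolding *(3) .
    qed
    have WW: "?W \<subseteq> {..<n}"
      using W(1) x nbs_subset[OF E, of x "\<lambda>w. lev x \<le> lev w"] by blast
    have st': "stable E (lev(x := ?nl)) v" if v: "v < n" "v \<notin> ?W" for v
    proof (rule stable_other[OF E])
      show "lev x \<le> Suc ?nl" by (rule nl(3))
      show "v \<noteq> x" using v by blast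
      show "{x, v} \<in> E \<Longrightarrow> lev v < lev x" using v by (cases "lev v < lev x") simp_all
      show "stable E lev v" using v stab by blast
    qed
    have c1: "time s8 + pot E (lev(x := ?nl)) ?W (insert x F) + 100 \<le> time s + pot E lev W F"
      using s8(4) dc t6 pot by simp
    have c2: "\<forall>v<n. (lev(x := ?nl)) v \<le> K" using lev(2) nl(1) by simp
    have c3: "insert x F \<subseteq> {..<n}" "F \<subseteq> insert x F" "x \<in> insert x F \<or> ?nl = lev x" using F x by auto
    have c4: "\<forall>v<n. v \<notin> ?W \<longrightarrow> stable E (lev(x := ?nl)) v" using st' by blast
    have "exec M settle_body s = return_spmf s8 \<and> static s8 \<and>
      arrays s8 1 = lev(x := ?nl) \<and> (\<forall>v<n. (lev(x := ?nl)) v \<le> K) \<and>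
      repS s8 (lbook E (lev(x := ?nl)) ?W (insert x F)) \<and>
      ?W \<subseteq> {..<n} \<and> insert x F \<subseteq> {..<n} \<and> F \<subseteq> insert x F \<and> (x \<in> insert x F \<or> ?nl = lev x) \<and>
      (\<forall>v<n. v \<notin> ?W \<longrightarrow> stable E (lev(x := ?nl)) v) \<and>
      time s8 + pot E (lev(x := ?nl)) ?W (insert x F) + 100 \<le> time s + pot E lev W F"
      by (intro conjI e8 st8 s8(2,3) WW c1 c2 c3 c4)
    note concl = this
    show ?thesis
      by (rule exI[of _ s8], rule exI[of _ ?W], rule exI[of _ "insert x F"], rule exI[of _ x],
          rule exI[of _ ?nl]) (rule concl)
  qed
qed

lemma exec_settle:
  assumes st: "static s" and rp: "repS s (lbook E lev W {})" and E: "graph_on n E"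
    and lev: "arrays s 1 = lev" "\<forall>v<n. lev v \<le> K"
    and W: "W \<subseteq> {..<n}" and stab: "\<forall>v<n. v \<notin> W \<longrightarrow> stable E lev v"
  shows "\<exists>s' F. exec M settle_com s = return_spmf s' \<and> static s' \<and> F \<subseteq> {..<n} \<and>
    repS s' (lbook E (arrays s' 1) {} F) \<and> (\<forall>v<n. arrays s' 1 v \<le> K \<and> stable E (arrays s' 1) v) \<and>
    (\<forall>v<n. v \<notin> F \<longrightarrow> arrays s' 1 v = lev v) \<and>
    time s' + pot E (arrays s' 1) {} F \<le> time s + pot E lev W {} + 20"
proof -
  let ?b = "Less (Const 0) (cnt_e 3 7)"
  define I where "I = (\<lambda>t :: state. static t \<and> (\<forall>v<n. arrays t 1 v \<le> K) \<and>
    (\<exists>W' F. W' \<subseteq> {..<n} \<and> F \<subseteq> {..<n} \<and> repS t (lbook E (arrays t 1) W' F) \<and>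
      (\<forall>v<n. v \<notin> W' \<longrightarrow> stable E (arrays t 1) v) \<and> (\<forall>v<n. v \<notin> F \<longrightarrow> arrays t 1 v = lev v) \<and>
      time t + pot E (arrays t 1) W' F \<le> time s + pot E lev W {}))"
  have cnt: "aval M t (cnt_e 3 7) = card W'" if "static t" "repS t (lbook E l W' F)" for t l W' F
  proof -
    have "{w. lbook E l W' F n w = Some 0} = W'" by (auto simp: book_def)
    then have "arrays t 2 (ix N n 0) = card W'"
      using rep_count(1)[OF that(2)[unfolded repS_def] n_less_N(1) N_pos] by simp
    then show ?thesis using aval_set(1)[of t 3 7] that(1) n_less_N N_pos by (simp add: static_def)
  qed
  have "\<exists>s'. exec M (While ?b settle_body) s = return_spmf (tick (bcost ?b) s') \<and> I s' \<and> \<not> bval M s' ?b"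
  \<comment> \<open>The unspent budget serves as termination measure: the potential is nonnegative,
    so the clock cannot pass the initial sum, and every round advances it.\<close>
  proof (rule exec_while_det[where I = I and m = "\<lambda>t. time s + pot E lev W {} - time t"])
    show "I s" unfolding I_def using assms by blast
    fix t assume I: "I t" and b: "bval M t ?b"
    from I obtain W' F where t: "static t" "\<forall>v<n. arrays t 1 v \<le> K" "W' \<subseteq> {..<n}" "F \<subseteq> {..<n}"
      "repS t (lbook E (arrays t 1) W' F)" "\<forall>v<n. v \<notin> W' \<longrightarrow> stable E (arrays t 1) v"
      "\<forall>v<n. v \<notin> F \<longrightarrow> arrays t 1 v = lev v" "time t + pot E (arrays t 1) W' F \<le> time s + pot E lev W {}"
      unfolding I_def by blast
    have "card W' > 0" using b cnt[OF t(1,5)] by simp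
    then have ne: "W' \<noteq> {}" by auto
    let ?t = "tick (bcost ?b) t"
    have "static ?t" "repS ?t (lbook E (arrays t 1) W' F)" "arrays ?t 1 = arrays t 1" using t by simp_all
    from exec_settle_body[OF this(1,2) E this(3) t(2,3) ne t(4,6)]
    obtain s' W2 F2 x nl where s': "exec M settle_body ?t = return_spmf s'" "static s'"
      "arrays s' 1 = (arrays t 1)(x := nl)" "\<forall>v<n. ((arrays t 1)(x := nl)) v \<le> K"
      "repS s' (lbook E ((arrays t 1)(x := nl)) W2 F2)" "W2 \<subseteq> {..<n}" "F2 \<subseteq> {..<n}" "F \<subseteq> F2"
      "x \<in> F2 \<or> nl = arrays t 1 x" "\<forall>v<n. v \<notin> W2 \<longrightarrow> stable E ((arrays t 1)(x := nl)) v"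
      "time s' + pot E ((arrays t 1)(x := nl)) W2 F2 + 100 \<le> time ?t + pot E (arrays t 1) W' F"
      by blast
    have tm: "time s' + pot E ((arrays t 1)(x := nl)) W2 F2 \<le> time s + pot E lev W {}"
      using s'(11) t(8) by simp
    have keep: "((arrays t 1)(x := nl)) v = lev v" if "v < n" "v \<notin> F2" for v
      using that t(7) s'(8,9) by auto
    have "I s'" unfolding I_def s'(3) using s'(2,4-7,10) tm keep by blast
    moreover have "time ?t \<le> time s'" using s'(1) exec_time_mono[of s' M settle_body ?t] by simp
    then have "time t < time s'" by simp
    then have "time s + pot E lev W {} - time s' < time s + pot E lev W {} - time t"
      using tm by simp
    ultimately show "\<exists>s'. exec M settle_body (tick (bcost ?b) t) = return_spmf s' \<and> I s' \<and>
      time s + pot E lev W {} - time s' < time s + pot E lev W {} - time t"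
      using s'(1) by blast
  qed
  then obtain s' where s': "exec M (While ?b settle_body) s = return_spmf (tick (bcost ?b) s')" "I s'" "\<not> bval M s' ?b"
    by blast
  then obtain W' F where t: "static s'" "\<forall>v<n. arrays s' 1 v \<le> K" "W' \<subseteq> {..<n}" "F \<subseteq> {..<n}"
      "repS s' (lbook E (arrays s' 1) W' F)" "\<forall>v<n. v \<notin> W' \<longrightarrow> stable E (arrays s' 1) v"
      "\<forall>v<n. v \<notin> F \<longrightarrow> arrays s' 1 v = lev v" "time s' + pot E (arrays s' 1) W' F \<le> time s + pot E lev W {}"
      unfolding I_def by blast
  have "card W' = 0" using s'(3) cnt[OF t(1,5)] by simp
  then have "W' = {}" using t(3) finite_subset[OF t(3)] by simp
  then show ?thesis
    apply (intro exI[of _ "tick (bcost ?b) s'"] exI[of _ F])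
    using t s'(1) by (simp add: settle_com_def)
qed

lemma exec_level_update:
  assumes st: "static s" and rp: "repS s (lbook E lev {} F)"
    and lev: "arrays s 1 = lev" "\<forall>v<n. lev v \<le> K" and E: "graph_on n E"
    and uv: "regs s 1 = u" "regs s 2 = v" "u < n" "v < n" "u \<noteq> v"
    and op: "regs s 0 = 1 \<and> {u, v} \<notin> E \<and> E' = insert {u, v} E \<or>
             regs s 0 = 0 \<and> {u, v} \<in> E \<and> E' = E - {{u, v}}"
    and stab: "\<forall>v<n. stable E lev v"
  shows "\<exists>s' F. exec M (Seq edge_com settle_com) s = return_spmf s' \<and> static s' \<and> F \<subseteq> {..<n} \<and>
    repS s' (lbook E' (arrays s' 1) {} F) \<and> (\<forall>v<n. arrays s' 1 v \<le> K \<and> stable E' (arrays s' 1) v) \<and>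
    (\<forall>v<n. v \<notin> F \<longrightarrow> arrays s' 1 v = lev v) \<and>
    time s' + pot E' (arrays s' 1) {} F \<le> time s + pot E lev {} {} + 200000 * K"
proof -
  have E': "graph_on n E'"
    using E uv op unfolding graph_on_def by blast
  have levK: "\<And>v. v < n \<Longrightarrow> lev v \<le> K" using lev(2) by blast
  have "\<exists>s'. exec M edge_com s = return_spmf s' \<and> repS s' (lbook E' lev {u, v} {}) \<and> arrays s' 1 = lev \<and>
    time s' \<le> time s + 1000"
    by (rule exec_edge[OF st rp lev(1) levK E uv op]) assumption
  then obtain s1 where s1: "exec M edge_com s = return_spmf s1" "repS s1 (lbook E' lev {u, v} {})"
    "arrays s1 1 = lev" "time s1 \<le> time s + 1000" by blast
  have st1: "static s1"
  proof -
    have "s1 \<in> set_spmf (exec M edge_com s)" using s1(1) by simp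
    then have "static s1 = static s"
      by (rule static_exec[OF _ written_edge])
    then show ?thesis using st by simp
  qed
  have stab': "stable E' lev w" if w: "w < n" "w \<notin> {u, v}" for w
  proof -
    have "{w, a} \<in> E' \<longleftrightarrow> {w, a} \<in> E" for a
    proof -
      have "{w, a} \<noteq> {u, v}" using w by (auto simp: doubleton_eq_iff)
      then show ?thesis using op by blast
    qed
    then have "deg E' lev j w = deg E lev j w" for j by (simp add: deg_def)
    then show ?thesis using stab w by (simp add: stable_def)
  qed
  have uvn: "{u, v} \<subseteq> {..<n}" using uv by simp
  have "\<forall>w<n. w \<notin> {u, v} \<longrightarrow> stable E' lev w" using stab' by blast
  from exec_settle[OF st1 s1(2) E' s1(3) lev(2) uvn this]
  obtain s' F where s': "exec M settle_com s1 = return_spmf s'" "static s'" "F \<subseteq> {..<n}"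
    "repS s' (lbook E' (arrays s' 1) {} F)" "\<forall>v<n. arrays s' 1 v \<le> K \<and> stable E' (arrays s' 1) v"
    "\<forall>v<n. v \<notin> F \<longrightarrow> arrays s' 1 v = lev v"
    "time s' + pot E' (arrays s' 1) {} F \<le> time s1 + pot E' lev {u, v} {} + 20"
    by blast
  have K: "1 \<le> K" using L_pos by (simp add: K_def)
  have ep: "edge_pot E' lev \<le> edge_pot E lev + (4 * K + 2)"
  proof -
    consider "E' = insert {u, v} E" | "E' = E - {{u, v}}" using op by blast
    then show ?thesis
    proof cases
      case 1
      then show ?thesis using edge_pot_insert[OF E uv(3,4), of lev] by simp
    next
      case 2
      then have "edge_pot E' lev \<le> edge_pot E lev" by (intro edge_pot_mono) blast
      then show ?thesis by simp
    qed
  qed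
  have dp: "debt_pot E' lev \<le> debt_pot E lev + 2 * K"
  proof -
    consider "E' = insert {u, v} E" | "E' = E - {{u, v}}" using op by blast
    then show ?thesis
    proof cases
      case 1
      then have "debt_pot E' lev \<le> debt_pot E lev" by (intro debt_pot_mono E E') blast
      then show ?thesis by simp
    next
      case 2
      then show ?thesis using debt_pot_delete[OF E lev(2) uv(3,4)] by simp
    qed
  qed
  have "card {u, v} = 2" using uv by simp
  \<comment> \<open>The increase collects \<open>8000 * (4 * K + 2)\<close> for the edge,
    \<open>40000 * 2 * K\<close> for the debts and \<open>2000 * 2\<close> for the worklist; the sum
    covers insertions and deletions alike.\<close>
  then have "pot E' lev {u, v} {} \<le> pot E lev {} {} + (112000 * K + 20000)"
    using ep dp unfolding pot_def by simp
  then have "time s' + pot E' (arrays s' 1) {} F \<le> time s + pot E lev {} {} + 200000 * K"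
    using s'(7) s1(4) K by linarith
  moreover have "exec M (Seq edge_com settle_com) s = return_spmf s'" using s1(1) s'(1) by simp
  ultimately show ?thesis using s'(2-6) by blast
qed

end

section \<open>Recoloring a vertex\<close>

text \<open>The vertex is in register 21. Array 7 marks the colors of its neighbours and array 8 lists
  the free colors of the palette of its level.\<close>

definition unmark_loop :: com where
  "unmark_loop = While (Less (Reg 25) (Reg 23))
     (Seq (Store 7 (Plus (Reg 24) (Reg 25)) (Const 0))
          (Assign 25 (Plus (Reg 25) (Const 1))))"

definition mark_loop :: com where
  "mark_loop = While (Less (Reg 25) (Reg 26))
     (Seq (Store 7 (Read 0 (Read 3 (slot_e 21 22 (Reg 25)))) (Const 1))
          (Assign 25 (Plus (Reg 25) (Const 1))))"

definition list_loop :: com where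
  "list_loop = While (Less (Reg 25) (Reg 23))
     (Seq (Cond (Equal (Read 7 (Plus (Reg 24) (Reg 25))) (Const 0))
            (Seq (Store 8 (Reg 28) (Plus (Reg 24) (Reg 25)))
                 (Assign 28 (Plus (Reg 28) (Const 1))))
            Skip)
          (Assign 25 (Plus (Reg 25) (Const 1))))"

definition gather_com :: com where
  "gather_com =
     Seq (Assign 22 (Read 1 (Reg 21)))
    (Seq (Assign 23 (Times (Const 4) (Read 5 (Reg 22))))
    (Seq (Assign 24 (Plus (Read 6 (Reg 22)) (Const 1)))
    (Seq (Assign 25 (Const 0))
    (Seq unmark_loop
    (Seq (Assign 26 (cnt_e 21 22))
    (Seq (Assign 25 (Const 0))
    (Seq mark_loop
    (Seq (Assign 28 (Const 0))
    (Seq (Assign 25 (Const 0))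
         list_loop)))))))))"

definition recolor_com :: com where
  "recolor_com =
     Seq gather_com
    (Seq (Random 29 (Reg 28))
         (Store 0 (Reg 21) (Read 8 (Reg 29))))"

lemma exec_unmark:
  assumes "\<And>i. i < regs s 23 \<Longrightarrow> regs s 24 + i + 1 < M" "regs s 25 = 0" "1 < M"
  shows "\<exists>s'. exec M unmark_loop s = return_spmf s' \<and> (\<forall>r. r \<noteq> 25 \<longrightarrow> regs s' r = regs s r) \<and>
    (\<forall>a. a \<noteq> 7 \<longrightarrow> arrays s' a = arrays s a) \<and>
    (\<forall>c. regs s 24 \<le> c \<and> c < regs s 24 + regs s 23 \<longrightarrow> arrays s' 7 c = 0) \<and>
    time s' \<le> time s + 20 * regs s 23 + 20"
proof -
  define m o' where "m = regs s 23" and "o' = regs s 24"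
  define I where "I = (\<lambda>t :: state. (\<forall>r. r \<noteq> 25 \<longrightarrow> regs t r = regs s r) \<and> regs t 25 \<le> m \<and>
    (\<forall>a. a \<noteq> 7 \<longrightarrow> arrays t a = arrays s a) \<and>
    (\<forall>c. o' \<le> c \<and> c < o' + regs t 25 \<longrightarrow> arrays t 7 c = 0) \<and> time t \<le> time s + 20 * regs t 25)"
  let ?b = "Less (Reg 25) (Reg 23)"
  let ?body = "Seq (Store 7 (Plus (Reg 24) (Reg 25)) (Const 0)) (Assign 25 (Plus (Reg 25) (Const 1)))"
  have "\<exists>s'. exec M (While ?b ?body) s = return_spmf (tick (bcost ?b) s') \<and> I s' \<and> \<not> bval M s' ?b"
  proof (rule exec_while_det[where I = I and m = "\<lambda>t. m - regs t 25"])
    show "I s" using assms(2) by (simp add: I_def)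
    fix t assume I: "I t" and b: "bval M t ?b"
    define i where "i = regs t 25"
    have rt: "regs t 23 = m" "regs t 24 = o'" using I by (simp_all add: I_def m_def o'_def)
    have i: "i < m" using b rt by (simp add: i_def)
    have iM: "(o' + i) mod M = o' + i" "Suc i mod M = Suc i"
      using assms(1)[of i] i by (simp_all add: m_def o'_def)
    let ?t = "tick 12 (set_reg 25 (Suc i) (set_cell 7 (o' + i) 0 t))"
    have "exec M ?body (tick (bcost ?b) t) = return_spmf ?t"
      using iM assms(3) rt by (simp add: i_def[symmetric] mod_less state_eqI)
    moreover have "I ?t" using I i unfolding I_def by (simp add: i_def[symmetric])
    moreover have "m - regs ?t 25 < m - regs t 25" using i by (simp add: i_def[symmetric])
    ultimately show "\<exists>s'. exec M ?body (tick (bcost ?b) t) = return_spmf s' \<and> I s' \<and> m - regs s' 25 < m - regs t 25"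
      by blast
  qed
  then obtain s' where s': "exec M (While ?b ?body) s = return_spmf (tick (bcost ?b) s')" "I s'" "\<not> bval M s' ?b"
    by blast
  have "regs s' 25 = m" using s'(2,3) by (simp add: I_def m_def)
  then show ?thesis
    using s' by (intro exI[of _ "tick (bcost ?b) s'"]) (simp add: unmark_loop_def I_def m_def o'_def)
qed

lemma exec_list:
  assumes "\<And>i. i < regs s 23 \<Longrightarrow> regs s 24 + i + 1 < M" "regs s 25 = 0" "regs s 28 = 0" "1 < M"
  shows "\<exists>s'. exec M list_loop s = return_spmf s' \<and> (\<forall>r. r \<noteq> 25 \<and> r \<noteq> 28 \<longrightarrow> regs s' r = regs s r) \<and>
    (\<forall>a. a \<noteq> 8 \<longrightarrow> arrays s' a = arrays s a) \<and> inj_on (arrays s' 8) {..<regs s' 28} \<and>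
    arrays s' 8 ` {..<regs s' 28} = {c. regs s 24 \<le> c \<and> c < regs s 24 + regs s 23 \<and> arrays s 7 c = 0} \<and>
    time s' \<le> time s + 40 * regs s 23 + 20"
proof -
  define m o' where "m = regs s 23" and "o' = regs s 24"
  define I where "I = (\<lambda>t :: state. (\<forall>r. r \<noteq> 25 \<and> r \<noteq> 28 \<longrightarrow> regs t r = regs s r) \<and> regs t 25 \<le> m \<and>
    (\<forall>a. a \<noteq> 8 \<longrightarrow> arrays t a = arrays s a) \<and> regs t 28 \<le> regs t 25 \<and>
    inj_on (arrays t 8) {..<regs t 28} \<and>
    arrays t 8 ` {..<regs t 28} = {c. o' \<le> c \<and> c < o' + regs t 25 \<and> arrays s 7 c = 0} \<and>
    time t \<le> time s + 40 * regs t 25)"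
  let ?b = "Less (Reg 25) (Reg 23)"
  let ?body = "Seq (Cond (Equal (Read 7 (Plus (Reg 24) (Reg 25))) (Const 0))
            (Seq (Store 8 (Reg 28) (Plus (Reg 24) (Reg 25)))
                 (Assign 28 (Plus (Reg 28) (Const 1))))
            Skip)
          (Assign 25 (Plus (Reg 25) (Const 1)))"
  have "\<exists>s'. exec M (While ?b ?body) s = return_spmf (tick (bcost ?b) s') \<and> I s' \<and> \<not> bval M s' ?b"
  proof (rule exec_while_det[where I = I and m = "\<lambda>t. m - regs t 25"])
    show "I s" using assms(2,3) by (simp add: I_def)
    fix t assume I: "I t" and b: "bval M t ?b"
    define i f where "i = regs t 25" and "f = regs t 28"
    have rt: "regs t 23 = m" "regs t 24 = o'" "arrays t 7 = arrays s 7" using I by (simp_all add: I_def m_def o'_def)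
    have i: "i < m" using b rt by (simp add: i_def)
    have fi: "f \<le> i" using I by (simp add: I_def i_def f_def)
    have iM: "(o' + i) mod M = o' + i" "Suc i mod M = Suc i" "Suc f mod M = Suc f"
      using assms(1)[of i] i fi by (simp_all add: m_def o'_def)
    have img: "arrays t 8 ` {..<f} = {c. o' \<le> c \<and> c < o' + i \<and> arrays s 7 c = 0}"
      and inj: "inj_on (arrays t 8) {..<f}" using I by (simp_all add: I_def i_def f_def)
    show "\<exists>s'. exec M ?body (tick (bcost ?b) t) = return_spmf s' \<and> I s' \<and> m - regs s' 25 < m - regs t 25"
    proof (cases "arrays s 7 (o' + i) = 0")
      case True
      let ?t = "tick 22 (set_reg 25 (Suc i) (set_reg 28 (Suc f) (set_cell 8 f (o' + i) t)))"
      have "exec M ?body (tick (bcost ?b) t) = return_spmf ?t"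
        using iM assms(4) rt True by (simp add: i_def[symmetric] f_def[symmetric])
      moreover have "I ?t"
      proof -
        let ?a = "(arrays t 8)(f := o' + i)"
        have "o' + i \<notin> arrays t 8 ` {..<f}" unfolding img by simp
        then have "inj_on ?a {..<Suc f}"
          unfolding lessThan_Suc by (simp add: inj_on_fun_updI[OF inj] )
        moreover have "?a ` {..<Suc f} = insert (o' + i) (arrays t 8 ` {..<f})"
          unfolding lessThan_Suc by (auto simp: image_iff)
        then have "?a ` {..<Suc f} = {c. o' \<le> c \<and> c < o' + Suc i \<and> arrays s 7 c = 0}"
          unfolding img using True by (auto simp: less_Suc_eq)
        ultimately show ?thesis using I i fi unfolding I_def by (simp add: i_def[symmetric] f_def[symmetric])
      qed
      moreover have "m - regs ?t 25 < m - regs t 25" using i by (simp add: i_def[symmetric])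
      ultimately show ?thesis by blast
    next
      case False
      let ?t = "tick 14 (set_reg 25 (Suc i) t)"
      have "exec M ?body (tick (bcost ?b) t) = return_spmf ?t"
        using iM assms(4) rt False by (simp add: i_def[symmetric] f_def[symmetric])
      moreover have "I ?t"
      proof -
        have "arrays t 8 ` {..<f} = {c. o' \<le> c \<and> c < o' + Suc i \<and> arrays s 7 c = 0}"
          unfolding img using False by (auto simp: less_Suc_eq)
        then show ?thesis using I i fi unfolding I_def by (simp add: i_def[symmetric] f_def[symmetric])
      qed
      moreover have "m - regs ?t 25 < m - regs t 25" using i by (simp add: i_def[symmetric])
      ultimately show ?thesis by blast
    qed
  qed
  then obtain s' where s': "exec M (While ?b ?body) s = return_spmf (tick (bcost ?b) s')" "I s'" "\<not> bval M s' ?b"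
    by blast
  have "regs s' 25 = m" using s'(2,3) by (simp add: I_def m_def)
  then show ?thesis
    using s' by (intro exI[of _ "tick (bcost ?b) s'"]) (simp add: list_loop_def I_def m_def o'_def)
qed

context level_params
begin

text \<open>Neighbours with colors from other palettes set marks outside of the segment in question.
  Such marks may stay, because \<open>gather_com\<close> clears the segment of its own palette in
  array 7 before it sets marks and reads them.\<close>

lemma exec_mark:
  assumes st: "static s" and rp: "repS s bk"
    and x: "regs s 21 = x" "x < N" and l: "regs s 22 = l" "l < N"
    and c: "regs s 26 = arrays s 2 (ix N x l)" and i0: "regs s 25 = 0"
  shows "\<exists>s'. exec M mark_loop s = return_spmf s' \<and> (\<forall>r. r \<noteq> 25 \<longrightarrow> regs s' r = regs s r) \<and>
    (\<forall>a. a \<noteq> 7 \<longrightarrow> arrays s' a = arrays s a) \<and>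
    (\<forall>k. arrays s' 7 k = (if k \<in> arrays s 0 ` {w. bk x w = Some l} then 1 else arrays s 7 k)) \<and>
    time s' \<le> time s + 40 * regs s 26 + 20"
proof -
  have N4: "regs s 4 = N" using st by (simp add: static_def)
  note rp' = rp[unfolded repS_def]
  define c xs where "c = regs s 26" and "xs = (\<lambda>i. arrays s 3 (ix N (ix N x l) i))"
  have cN: "c < N" using rep_count(2)[OF rp' x(2) l(2)] n_less_N c c_def by simp
  have cM: "Suc i mod M = Suc i" if "i < c" for i using cN that N3_less_M(3) by simp
  have D: "{w. bk x w = Some l} = xs ` {..<c}"
    using rep_bij[OF rp' x(2) l(2)] unfolding c_def c xs_def by (simp add: bij_betw_def)
  define I where "I = (\<lambda>t :: state. (\<forall>r. r \<noteq> 25 \<longrightarrow> regs t r = regs s r) \<and> regs t 25 \<le> c \<and>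
    (\<forall>a. a \<noteq> 7 \<longrightarrow> arrays t a = arrays s a) \<and>
    (\<forall>k. arrays t 7 k = (if k \<in> arrays s 0 ` xs ` {..<regs t 25} then 1 else arrays s 7 k)) \<and>
    time t \<le> time s + 40 * regs t 25)"
  let ?b = "Less (Reg 25) (Reg 26)"
  let ?body = "Seq (Store 7 (Read 0 (Read 3 (slot_e 21 22 (Reg 25)))) (Const 1))
          (Assign 25 (Plus (Reg 25) (Const 1)))"
  have "\<exists>s'. exec M (While ?b ?body) s = return_spmf (tick (bcost ?b) s') \<and> I s' \<and> \<not> bval M s' ?b"
  proof (rule exec_while_det[where I = I and m = "\<lambda>t. c - regs t 25"])
    show "I s" using i0 by (simp add: I_def)
    fix t assume I: "I t" and b: "bval M t ?b"
    define i where "i = regs t 25"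
    have rt: "regs t 4 = N" "regs t 21 = x" "regs t 22 = l" "regs t 26 = c" "arrays t 3 = arrays s 3" "arrays t 0 = arrays s 0"
      using I N4 x l by (simp_all add: I_def c_def)
    have i: "i < c" using b rt by (simp add: i_def)
    have iN: "i < N" using i cN by simp
    have sl: "aval M t (slot_e 21 22 (Reg 25)) = ix N (ix N x l) i"
      using aval_set(3)[of t 21 22 "Reg 25"] rt x l iN by (simp add: i_def)
    let ?t = "tick 20 (set_reg 25 (Suc i) (set_cell 7 (arrays s 0 (xs i)) 1 t))"
    have "exec M ?body (tick (bcost ?b) t) = return_spmf ?t"
      using cM[OF i] rt sl by (simp add: i_def[symmetric] xs_def)
    moreover have "I ?t"
    proof -
      have "arrays s 0 ` xs ` {..<Suc i} = insert (arrays s 0 (xs i)) (arrays s 0 ` xs ` {..<i})"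
        unfolding lessThan_Suc by simp
      then show ?thesis using I i unfolding I_def by (simp add: i_def[symmetric])
    qed
    moreover have "c - regs ?t 25 < c - regs t 25" using i by (simp add: i_def[symmetric])
    ultimately show "\<exists>s'. exec M ?body (tick (bcost ?b) t) = return_spmf s' \<and> I s' \<and> c - regs s' 25 < c - regs t 25"
      by blast
  qed
  then obtain s' where s': "exec M (While ?b ?body) s = return_spmf (tick (bcost ?b) s')" "I s'" "\<not> bval M s' ?b"
    by blast
  have "regs s' 25 = c" using s'(2,3) by (simp add: I_def c_def)
  then show ?thesis
    using s' unfolding D by (intro exI[of _ "tick (bcost ?b) s'"]) (simp add: mark_loop_def I_def c_def)
qed

text \<open>The shift by 1 keeps out color 0, which no proper coloring may use. Consecutive palettes
  are adjacent intervals, so \<open>off (Suc l)\<close> is also the largest color of level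
  \<open>l\<close>.\<close>

definition palette :: "nat \<Rightarrow> nat set" where
  "palette l = {off l + 1..<off l + 1 + 4 * T l}"

lemma off_mono: "l \<le> l' \<Longrightarrow> off l \<le> off l'"
  unfolding off_def by (intro sum_mono2) auto

lemma off_Suc: "off (Suc l) = off l + 4 * T l"
  by (simp add: off_def)

lemma palette_disjoint: "l \<noteq> l' \<Longrightarrow> palette l \<inter> palette l' = {}"
proof (induction l l' rule: linorder_wlog)
  case (le l l')
  then have "off l + 4 * T l \<le> off l'" using off_mono[of "Suc l" l'] off_Suc[of l] by simp
  then show ?case by (auto simp: palette_def)
next
  case (sym l l')
  then show ?case by blast
qed

text \<open>A crude count: at most \<open>K + 1\<close> palettes of at most \<open>8 * n\<close>
  colors each, where \<open>K + 2 \<le> N\<close>.\<close>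

lemma off_less_M: "l \<le> K \<Longrightarrow> off l + 4 * T l + 1 < M"
proof -
  assume l: "l \<le> K"
  have "off (Suc l) \<le> (\<Sum>j<Suc l. 8 * n)"
    unfolding off_def using T_le l by (intro sum_mono) (force simp: le_trans)
  also have "\<dots> = Suc l * (8 * n)" by simp
  finally have "off l + 4 * T l + 1 \<le> Suc l * (8 * n) + 1" by (simp add: off_Suc)
  also have "\<dots> \<le> Suc (Suc l) * (8 * n)" using n2 by simp
  also have "\<dots> \<le> N * (8 * n)" using l K_less_N by (intro mult_le_mono1) simp
  also have "\<dots> < M" using N3_less_M(6) by (simp add: mult.commute mult.left_commute)
  finally show ?thesis .
qed

lemma written_gather:
  "written_regs gather_com \<subseteq> {22..28}" "written_arrays gather_com \<subseteq> {7, 8}"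
  by (simp_all add: gather_com_def unmark_loop_def mark_loop_def list_loop_def)

text \<open>When colors fit the levels, only neighbours on the same level matter. Strictly higher
  ones are included because they share a stored set with these; \<open>stable\<close> bounds both
  together by \<open>3 * T\<close>, so a quarter of the palette is free in any case.\<close>

definition nbs :: "nat set set \<Rightarrow> (nat \<Rightarrow> nat) \<Rightarrow> nat \<Rightarrow> nat set" where
  "nbs E lev v = {w. {v, w} \<in> E \<and> lev v \<le> lev w}"

text \<open>The loops are linear in \<open>T\<close>: two scan the palette of \<open>4 * T\<close>
  colors, one scans a stored set of at most \<open>3 * T\<close> neighbours. Neighbours on lower
  levels are never looked at.\<close>

lemma exec_gather:
  assumes st: "static s" and rp: "repS s (lbook E lev W F)" and E: "graph_on n E"
    and lev: "arrays s 1 = lev" and v: "regs s 21 = v" "v < n" and lK: "lev v \<le> K"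
    and deg: "deg E lev (lev v) v \<le> 3 * T (lev v)"
  shows "\<exists>s'. exec M gather_com s = return_spmf s' \<and> inj_on (arrays s' 8) {..<regs s' 28} \<and>
    arrays s' 8 ` {..<regs s' 28} = palette (lev v) - arrays s 0 ` nbs E lev v \<and>
    T (lev v) \<le> regs s' 28 \<and> time s' \<le> time s + 800 * T (lev v)"
proof -
  let ?l = "lev v"
  have lN: "?l < N" using lK K_less_N by simp
  have vN: "v < N" using v n_less_N by simp
  have T: "arrays s 5 ?l = T ?l" "arrays s 6 ?l = off ?l" using st lK by (simp_all add: static_def)
  have N4: "regs s 4 = N" using st by (simp add: static_def)
  have M1: "1 < M" by (rule M_neq(4))
  have oM: "off ?l + 4 * T ?l + 1 < M" by (rule off_less_M[OF lK])
  define s1 where "s1 = set_reg 25 0 (set_reg 24 (Suc (off ?l)) (set_reg 23 (4 * T ?l) (set_reg 22 ?l s)))"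
  have mods: "4 * T ?l mod M = 4 * T ?l" "Suc (off ?l) mod M = Suc (off ?l)" using oM by simp_all
  have e1: "exec M (Assign 22 (Read 1 (Reg 21))) s = return_spmf (tick 3 (set_reg 22 ?l s))"
    "exec M (Assign 23 (Times (Const 4) (Read 5 (Reg 22)))) (tick 3 (set_reg 22 ?l s)) =
      return_spmf (tick 8 (set_reg 23 (4 * T ?l) (set_reg 22 ?l s)))"
    "exec M (Assign 24 (Plus (Read 6 (Reg 22)) (Const 1))) (tick 8 (set_reg 23 (4 * T ?l) (set_reg 22 ?l s))) =
      return_spmf (tick 13 (set_reg 24 (Suc (off ?l)) (set_reg 23 (4 * T ?l) (set_reg 22 ?l s))))"
    "exec M (Assign 25 (Const 0)) (tick 13 (set_reg 24 (Suc (off ?l)) (set_reg 23 (4 * T ?l) (set_reg 22 ?l s)))) =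
      return_spmf (tick 15 s1)"
    using lev v T mods by (simp_all add: s1_def)
  have r1: "regs (tick 15 s1) 23 = 4 * T ?l" "regs (tick 15 s1) 24 = Suc (off ?l)" "regs (tick 15 s1) 25 = 0"
    by (simp_all add: s1_def)
  have b1: "regs (tick 15 s1) 24 + i + 1 < M" if "i < regs (tick 15 s1) 23" for i
    using that oM unfolding r1 by simp
  from exec_unmark[OF b1 r1(3) M1] obtain s2 where s2: "exec M unmark_loop (tick 15 s1) = return_spmf s2"
    "\<forall>r. r \<noteq> 25 \<longrightarrow> regs s2 r = regs (tick 15 s1) r" "\<forall>a. a \<noteq> 7 \<longrightarrow> arrays s2 a = arrays (tick 15 s1) a"
    "\<forall>c. Suc (off ?l) \<le> c \<and> c < Suc (off ?l) + 4 * T ?l \<longrightarrow> arrays s2 7 c = 0"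
    "time s2 \<le> time (tick 15 s1) + 20 * (4 * T ?l) + 20"
    unfolding r1 by blast
  have a2: "\<forall>a. a \<noteq> 7 \<longrightarrow> arrays s2 a = arrays s a" using s2(3) by (simp add: s1_def)
  have r2: "regs s2 4 = N" "regs s2 21 = v" "regs s2 22 = ?l" "regs s2 23 = 4 * T ?l" "regs s2 24 = Suc (off ?l)"
    "regs s2 3 = n" "regs s2 6 = n + 1" "regs s2 7 = 0"
    using s2(2) N4 v st by (simp_all add: s1_def static_def)
  define c where "c = arrays s 2 (ix N v ?l)"
  have c2: "aval M s2 (cnt_e 21 22) = c" using aval_set(1)[of s2 21 22] r2 vN lN a2 by (simp add: c_def)
  define s3 where "s3 = set_reg 25 0 (set_reg 26 c s2)"
  have e3: "exec M (Assign 26 (cnt_e 21 22)) s2 = return_spmf (tick 7 (set_reg 26 c s2))"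
    "exec M (Assign 25 (Const 0)) (tick 7 (set_reg 26 c s2)) = return_spmf (tick 9 s3)"
    using c2 by (simp_all add: s3_def)
  have st3: "static (tick 9 s3)" using st a2 r2 by (simp add: static_def s3_def)
  have rp3: "repS (tick 9 s3) (lbook E lev W F)" using rp a2 by (simp add: repS_def s3_def)
  have r3: "regs (tick 9 s3) 21 = v" "regs (tick 9 s3) 22 = ?l" "regs (tick 9 s3) 25 = 0"
    "regs (tick 9 s3) 26 = arrays (tick 9 s3) 2 (ix N v ?l)"
    using r2 a2 by (simp_all add: s3_def c_def)
  have D: "{w. lbook E lev W F v w = Some ?l} = nbs E lev v"
    using v by (auto simp: book_def nbs_def min_def split: if_splits)
  from exec_mark[OF st3 rp3 r3(1) vN r3(2) lN r3(4,3)] obtain s4 where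
    s4: "exec M mark_loop (tick 9 s3) = return_spmf s4" "\<forall>r. r \<noteq> 25 \<longrightarrow> regs s4 r = regs (tick 9 s3) r"
    "\<forall>a. a \<noteq> 7 \<longrightarrow> arrays s4 a = arrays (tick 9 s3) a"
    "\<forall>k. arrays s4 7 k = (if k \<in> arrays (tick 9 s3) 0 ` nbs E lev v then 1 else arrays (tick 9 s3) 7 k)"
    "time s4 \<le> time (tick 9 s3) + 40 * regs (tick 9 s3) 26 + 20"
    unfolding D by blast
  define s5 where "s5 = set_reg 25 0 (set_reg 28 0 s4)"
  have e5: "exec M (Assign 28 (Const 0)) s4 = return_spmf (tick 2 (set_reg 28 0 s4))"
    "exec M (Assign 25 (Const 0)) (tick 2 (set_reg 28 0 s4)) = return_spmf (tick 4 s5)"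
    by (simp_all add: s5_def)
  have r5: "regs (tick 4 s5) 23 = 4 * T ?l" "regs (tick 4 s5) 24 = Suc (off ?l)" "regs (tick 4 s5) 25 = 0" "regs (tick 4 s5) 28 = 0"
    using s4(2) r2 by (simp_all add: s5_def s3_def)
  have b5: "regs (tick 4 s5) 24 + i + 1 < M" if "i < regs (tick 4 s5) 23" for i
    using that oM unfolding r5 by simp
  from exec_list[OF b5 r5(3,4) M1] obtain s6 where s6: "exec M list_loop (tick 4 s5) = return_spmf s6"
    "inj_on (arrays s6 8) {..<regs s6 28}"
    "arrays s6 8 ` {..<regs s6 28} = {c. Suc (off ?l) \<le> c \<and> c < Suc (off ?l) + 4 * T ?l \<and> arrays (tick 4 s5) 7 c = 0}"
    "time s6 \<le> time (tick 4 s5) + 40 * (4 * T ?l) + 20"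
    unfolding r5 by blast
  have img: "arrays s6 8 ` {..<regs s6 28} = palette ?l - arrays s 0 ` nbs E lev v"
  proof -
    have "arrays (tick 4 s5) 7 k = (if k \<in> arrays s 0 ` nbs E lev v then 1 else arrays s2 7 k)" for k
      using s4(4) a2 by (simp add: s5_def s3_def)
    then show ?thesis unfolding s6(3) using s2(4) by (auto simp: palette_def)
  qed
  have cdeg: "c = deg E lev ?l v" using count_top[OF rp E v(2) lN] by (simp add: c_def)
  have free: "T ?l \<le> regs s6 28"
  proof -
    have fin: "finite (nbs E lev v)" unfolding nbs_def using E by simp
    have "card (arrays s 0 ` nbs E lev v) \<le> card (nbs E lev v)" using fin by (rule card_image_le)
    also have "\<dots> \<le> 3 * T ?l" using deg by (simp add: deg_def nbs_def)
    finally have "card (palette ?l) - 3 * T ?l \<le> card (palette ?l) - card (arrays s 0 ` nbs E lev v)" by simp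
    also have "\<dots> \<le> card (palette ?l - arrays s 0 ` nbs E lev v)"
      using fin by (intro diff_card_le_card_Diff) simp
    also have "\<dots> = regs s6 28" unfolding img[symmetric] using s6(2) by (simp add: card_image)
    finally show ?thesis by (simp add: palette_def)
  qed
  have "exec M gather_com s = return_spmf s6"
    by (simp only: gather_com_def exec.simps(5) e1 e3 e5 s2(1) s4(1) s6(1) return_bind_spmf)
  moreover have "time s6 \<le> time s + 800 * T ?l"
  proof -
    have "time s2 \<le> time s + 80 * T ?l + 35" using s2(5) by (simp add: s1_def)
    moreover have "time s4 \<le> time s2 + 120 * T ?l + 29"
      using s4(5) deg by (simp add: s3_def cdeg)
    moreover have "time s6 \<le> time s4 + 160 * T ?l + 24" using s6(4) by (simp add: s5_def)
    moreover have "1 \<le> T ?l" using T_pos[of ?l] by linarith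
    ultimately show ?thesis by linarith
  qed
  ultimately show ?thesis using s6(2) img free by blast
qed

definition recolored :: "nat \<Rightarrow> nat \<Rightarrow> nat \<Rightarrow> state \<Rightarrow> state \<Rightarrow> bool" where
  "recolored v c k s s' \<longleftrightarrow> arrays s' 0 = (arrays s 0)(v := c) \<and>
     (\<forall>a. a \<notin> {0, 7, 8} \<longrightarrow> arrays s' a = arrays s a) \<and> (\<forall>r. r \<notin> {22..29} \<longrightarrow> regs s' r = regs s r) \<and>
     time s' \<le> time s + k"

text \<open>The outcome is presented as the image of a uniform index \<open>x\<close>:
  \<open>g\<close> lists the free colors without repetition and \<open>S x\<close> is the final
  state. Probabilities then become counts of indices.\<close>

lemma exec_recolor:
  assumes st: "static s" and rp: "repS s (lbook E lev W F)" and E: "graph_on n E"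
    and lev: "arrays s 1 = lev" and v: "regs s 21 = v" "v < n" and lK: "lev v \<le> K"
    and deg: "deg E lev (lev v) v \<le> 3 * T (lev v)"
  shows "\<exists>f g S. T (lev v) \<le> f \<and> inj_on g {0..<f} \<and>
    g ` {0..<f} = palette (lev v) - arrays s 0 ` nbs E lev v \<and>
    exec M recolor_com s = map_spmf S (spmf_of_set {0..<f}) \<and>
    (\<forall>x. recolored v (g x) (900 * T (lev v)) s (S x))"
proof -
  obtain s1 where s1: "exec M gather_com s = return_spmf s1" "inj_on (arrays s1 8) {..<regs s1 28}"
    "arrays s1 8 ` {..<regs s1 28} = palette (lev v) - arrays s 0 ` nbs E lev v"
    "T (lev v) \<le> regs s1 28" "time s1 \<le> time s + 800 * T (lev v)"
    using exec_gather[OF assms] by blast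
  have fr: "(\<forall>r. r \<notin> written_regs gather_com \<longrightarrow> regs s1 r = regs s r) \<and>
         (\<forall>a. a \<notin> written_arrays gather_com \<longrightarrow> arrays s1 a = arrays s a)"
    using s1(1) exec_frame[of s1 M gather_com s] by simp
  have r1: "regs s1 r = regs s r" if "r \<notin> {22..28}" for r
    using fr written_gather(1) that by blast
  have a1: "arrays s1 a = arrays s a" if "a \<notin> {7, 8}" for a
    using fr written_gather(2) that by blast
  have v1: "regs s1 21 = v" using r1[of 21] v by simp
  define S where "S = (\<lambda>x. tick (Suc (Suc (Suc (Suc (Suc (Suc 0)))))) (set_cell 0 v (arrays s1 8 x) (set_reg 29 x s1)))"
  have "0 < regs s1 28" using s1(4) T_pos[of "lev v"] by linarith
  then have "exec M recolor_com s = map_spmf S (spmf_of_set {0..<regs s1 28})"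
    using s1(1) v1 by (simp add: recolor_com_def S_def bind_spmf_map_spmf map_spmf_conv_bind_spmf)
  moreover have "recolored v (arrays s1 8 x) (900 * T (lev v)) s (S x)" for x
  proof -
    have "1 \<le> T (lev v)" using T_pos[of "lev v"] by linarith
    then have "time (S x) \<le> time s + 900 * T (lev v)" using s1(5) by (simp add: S_def)
    moreover have "arrays (S x) 0 = (arrays s 0)(v := arrays s1 8 x)" using a1[of 0] by (simp add: S_def)
    moreover have "arrays (S x) a = arrays s a" if "a \<notin> {0, 7, 8}" for a
      using a1[of a] that by (simp add: S_def)
    moreover have "regs (S x) r = regs s r" if "r \<notin> {22..29}" for r
    proof -
      have "r \<noteq> 29" "r \<notin> {22..28}" using that by auto
      then show ?thesis using r1[of r] by (simp add: S_def)
    qed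
    ultimately show ?thesis unfolding recolored_def by blast
  qed
  ultimately show ?thesis
    using s1(2-4) by (intro exI[of _ "regs s1 28"] exI[of _ "arrays s1 8"] exI[of _ S])
      (simp add: atLeast0LessThan)
qed

end

section \<open>Distribution of the colors\<close>

lemma nn_integral_measure_spmf_bind:
  "(\<integral>\<^sup>+ x. g x \<partial>measure_spmf (bind_spmf p f)) =
   (\<integral>\<^sup>+ y. (\<integral>\<^sup>+ x. g x \<partial>measure_spmf (f y)) \<partial>measure_spmf p)"
  unfolding measure_spmf_bind
  by (subst nn_integral_bind[where B = "count_space UNIV"])
    (auto simp: measurable_def space_subprob_algebra)

lemma nn_integral_spmf_mono:
  assumes "\<And>x. x \<in> set_spmf p \<Longrightarrow> f x \<le> g x"
  shows "(\<integral>\<^sup>+ x. f x \<partial>measure_spmf p) \<le> (\<integral>\<^sup>+ x. g x \<partial>measure_spmf p)"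
  using assms by (intro nn_integral_mono_AE) simp

lemma nn_integral_spmf_const: "(\<integral>\<^sup>+ x. c \<partial>measure_spmf p) \<le> (c :: ennreal)"
proof -
  have "emeasure (measure_spmf p) UNIV \<le> 1"
    using subprob_space.subprob_emeasure_le_1[OF subprob_space_measure_spmf, of p UNIV] .
  then have "c * emeasure (measure_spmf p) UNIV \<le> c * 1" by (intro mult_left_mono) auto
  then show ?thesis by (simp add: space_measure_spmf)
qed

lemma nn_integral_lossless_const:
  assumes "lossless_spmf p"
  shows "(\<integral>\<^sup>+ x. c \<partial>measure_spmf p) = c"
proof -
  have "emeasure (measure_spmf p) UNIV = 1"
    using assms by (simp add: measure_spmf.emeasure_eq_measure weight_spmf_def[symmetric] lossless_weight_spmfD)
  then show ?thesis by (simp add: space_measure_spmf)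
qed

lemma nn_integral_spmf_le:
  assumes "\<And>x. x \<in> set_spmf p \<Longrightarrow> f x \<le> (c :: ennreal)"
  shows "(\<integral>\<^sup>+ x. f x \<partial>measure_spmf p) \<le> c"
proof -
  have "(\<integral>\<^sup>+ x. f x \<partial>measure_spmf p) \<le> (\<integral>\<^sup>+ x. c \<partial>measure_spmf p)"
    by (rule nn_integral_spmf_mono) (rule assms)
  also have "\<dots> \<le> c" by (rule nn_integral_spmf_const)
  finally show ?thesis .
qed

definition ind :: "bool \<Rightarrow> ennreal" where
  "ind b = (if b then 1 else 0)"

lemma ind_le_1: "ind b \<le> 1" by (simp add: ind_def)

lemma ind_ennreal: "ind b = ennreal (of_bool b)" by (simp add: ind_def)

definition eqc :: "nat \<Rightarrow> nat \<Rightarrow> state \<Rightarrow> ennreal" where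
  "eqc x y s = ind (arrays s 0 x = arrays s 0 y)"

section \<open>Recoloring the flagged vertices, and the refresh\<close>

definition recolor_all_body :: com where
  "recolor_all_body =
     Seq (Assign 20 (Minus (Reg 20) (Const 1)))
    (Seq (Assign 21 (Read 3 (slot_e 6 7 (Reg 20)))) recolor_com)"

definition recolor_all_com :: com where
  "recolor_all_com = Seq (Assign 20 (cnt_e 6 7)) (While (Less (Const 0) (Reg 20)) recolor_all_body)"

text \<open>Besides resolving a conflict, the first end point is recolored with probability
  \<open>2 / T\<close>. This forgets enough of the past to keep the collision probabilities bounded.\<close>

definition refresh_com :: com where
  "refresh_com =
     Seq (Assign 21 (Reg 1))
    (Seq (Assign 30 (Read 5 (Read 1 (Reg 1))))
    (Seq (Random 29 (Reg 30))
         (Cond (Neg (Conj (Neg (Less (Reg 29) (Const 2))) (Neg (Equal (Read 0 (Reg 1)) (Read 0 (Reg 2))))))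
            recolor_com Skip)))"

context level_params
begin

text \<open>Gathers what concerns the levels and says nothing about colors; this part is common to
  all random outcomes.\<close>

definition skel :: "nat set set \<Rightarrow> (nat \<Rightarrow> nat) \<Rightarrow> nat set \<Rightarrow> state \<Rightarrow> bool" where
  "skel E lev F s \<longleftrightarrow> static s \<and> arrays s 1 = lev \<and> repS s (lbook E lev {} F) \<and> graph_on n E \<and>
     (\<forall>v<n. lev v \<le> K \<and> stable E lev v) \<and> F \<subseteq> {..<n}"

lemma skel_cong:
  assumes "skel E lev F s" "\<And>a. a \<in> {1, 2, 3, 4, 5, 6} \<Longrightarrow> arrays s' a = arrays s a"
    "\<And>r. r \<in> {3, 4, 6, 7} \<Longrightarrow> regs s' r = regs s r"
  shows "skel E lev F s'"
  using assms(1) unfolding skel_def static_def repS_def by (simp add: assms(2,3))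

lemma skel_simps [simp]:
  "skel E lev F (tick k s) = skel E lev F s"
  "r \<notin> {3, 4, 6, 7} \<Longrightarrow> skel E lev F (set_reg r x s) = skel E lev F s"
  unfolding skel_def by simp_all

lemma skel_recolored:
  assumes "skel E lev F s" "recolored v c k s s'"
  shows "skel E lev F s'"
  by (rule skel_cong[OF assms(1)]) (use assms(2) in \<open>auto simp: recolored_def\<close>)

text \<open>For the collision bound: \<open>w\<close> keeps its color and the
  \<open>f \<ge> T (lev v)\<close> free colors are distinct, so at most one of \<open>f\<close>
  equally likely indices yields the color of \<open>w\<close>.\<close>

lemma recolor_facts:
  assumes sk: "skel E lev F s" and v: "regs s 21 = v" "v < n"
  shows "lossless_spmf (exec M recolor_com s)" (is ?A)
    "\<And>s'. s' \<in> set_spmf (exec M recolor_com s) \<Longrightarrow>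
      \<exists>c. recolored v c (900 * T (lev v)) s s' \<and> c \<in> palette (lev v) \<and> c \<notin> arrays s 0 ` nbs E lev v" (is "\<And>s'. _ \<Longrightarrow> ?B s'")
    "\<And>w. w \<noteq> v \<Longrightarrow> (\<integral>\<^sup>+ s'. eqc v w s' \<partial>measure_spmf (exec M recolor_com s)) \<le> ennreal (1 / real (T (lev v)))" (is "\<And>w. _ \<Longrightarrow> ?C w")
proof -
  have st: "static s" "repS s (lbook E lev {} F)" "graph_on n E" "arrays s 1 = lev" "lev v \<le> K"
    "deg E lev (lev v) v \<le> 3 * T (lev v)"
    using sk v unfolding skel_def stable_def by blast+
  obtain f g S where f: "T (lev v) \<le> f" "inj_on g {0..<f}"
    "g ` {0..<f} = palette (lev v) - arrays s 0 ` nbs E lev v"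
    "exec M recolor_com s = map_spmf S (spmf_of_set {0..<f})"
    "\<forall>x. recolored v (g x) (900 * T (lev v)) s (S x)"
    using exec_recolor[OF st(1-4) v st(5,6)] by blast
  have fpos: "0 < f" using f(1) T_pos[of "lev v"] by linarith
  show ?A unfolding f(4) using fpos by simp
  show "?B s'" if "s' \<in> set_spmf (exec M recolor_com s)" for s'
  proof -
    from that obtain x where x: "x \<in> {0..<f}" "s' = S x" unfolding f(4) by auto
    then have "g x \<in> palette (lev v) - arrays s 0 ` nbs E lev v" unfolding f(3)[symmetric] by blast
    then show ?thesis using f(5) x(2) by blast
  qed
  show "?C w" if "w \<noteq> v" for w
  proof -
    have eq: "eqc v w (S x) = ind (g x = arrays s 0 w)" for x
      using f(5)[rule_format, of x] that by (simp add: eqc_def recolored_def)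
    have "card {x \<in> {0..<f}. g x = arrays s 0 w} \<le> 1"
      using f(2) by (auto simp: card_le_Suc0_iff_eq inj_on_def)
    moreover have "(\<Sum>x = 0..<f. ind (g x = arrays s 0 w)) = of_nat (card {x \<in> {0..<f}. g x = arrays s 0 w})"
      unfolding ind_def by (simp add: sum.If_cases Int_def)
    ultimately have "(\<Sum>x = 0..<f. ind (g x = arrays s 0 w)) \<le> 1"
      by (metis of_nat_1 of_nat_le_iff)
    then have "(\<integral>\<^sup>+ s'. eqc v w s' \<partial>measure_spmf (exec M recolor_com s)) \<le> 1 / of_nat f"
      unfolding f(4) by (simp add: nn_integral_spmf_of_set o_def eq divide_right_mono_ennreal)
    also have "\<dots> = ennreal (1 / real f)"
      using fpos by (simp add: divide_ennreal[symmetric] ennreal_of_nat_eq_real_of_nat)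
    also have "\<dots> \<le> ennreal (1 / real (T (lev v)))"
      using f(1) T_pos[of "lev v"] by (intro ennreal_leI frac_le) simp_all
    finally show ?thesis .
  qed
qed

text \<open>\<open>R\<close> contains the vertices that still wait for a new color and
  \<open>e\<close> is the updated edge, whose conflict is resolved last. As \<open>{x, y}\<close> is
  never empty, \<open>e = {}\<close> exempts no edge.\<close>

definition cinv :: "nat set set \<Rightarrow> (nat \<Rightarrow> nat) \<Rightarrow> nat set \<Rightarrow> nat set \<Rightarrow> state \<Rightarrow> bool" where
  "cinv E lev e R s \<longleftrightarrow> (\<forall>v<n. v \<notin> R \<longrightarrow> arrays s 0 v \<in> palette (lev v)) \<and>
     (\<forall>x y. {x, y} \<in> E \<longrightarrow> {x, y} \<noteq> e \<longrightarrow> x \<notin> R \<longrightarrow> y \<notin> R \<longrightarrow> arrays s 0 x \<noteq> arrays s 0 y)"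

text \<open>Neighbours on level \<open>lev v\<close> or above are avoided explicitly, lower ones by
  disjointness of the palettes. All edges from \<open>v\<close> to vertices outside of
  \<open>R\<close> become proper, so the exemption of \<open>e\<close> can be lifted if
  \<open>v\<close> is one of its ends.\<close>

lemma cinv_recolored:
  assumes sk: "graph_on n E" and v: "v < n"
    and ci: "cinv E lev e (insert v R) s"
    and rc: "recolored v c k s s'" "c \<in> palette (lev v)" "c \<notin> arrays s 0 ` nbs E lev v"
    and e: "e' = e \<or> (v \<in> e \<and> (\<forall>x\<in>e. x \<notin> R)) \<and> e' = {}"
  shows "cinv E lev e' R s'"
proof -
  have col: "arrays s' 0 w = (if w = v then c else arrays s 0 w)" for w
    using rc(1) by (simp add: recolored_def)
  have pal: "arrays s' 0 w \<in> palette (lev w)" if "w < n" "w \<notin> R" for w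
    using ci that rc(2) col[of w] unfolding cinv_def by auto
  have new: "c \<noteq> arrays s 0 y" if y: "{v, y} \<in> E" "y \<notin> R" for y
  proof (cases "lev v \<le> lev y")
    case True
    then have "y \<in> nbs E lev v" using y by (simp add: nbs_def)
    then show ?thesis using rc(3) by blast
  next
    case False
    have "y \<noteq> v" "y < n" using graph_onD[OF sk y(1)] by blast+
    then have "arrays s 0 y \<in> palette (lev y)" using pal[of y] col[of y] y by simp
    moreover have "lev y \<noteq> lev v" using False by simp
    ultimately show ?thesis using palette_disjoint[of "lev y" "lev v"] rc(2) by blast
  qed
  have "arrays s' 0 x \<noteq> arrays s' 0 y" if xy: "{x, y} \<in> E" "{x, y} \<noteq> e'" "x \<notin> R" "y \<notin> R" for x y
  proof -
    have ne: "x \<noteq> y" using graph_onD[OF sk xy(1)] by blast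
    consider "x = v" | "y = v" | "x \<noteq> v" "y \<noteq> v" by blast
    then show ?thesis
    proof cases
      case 1
      then show ?thesis using new[of y] xy ne col[of x] col[of y] by auto
    next
      case 2
      have "{v, x} \<in> E" using xy(1) 2 by (simp add: insert_commute)
      then show ?thesis using new[of x] xy(3) ne 2 col[of x] col[of y] by auto
    next
      case 3
      have "{x, y} \<noteq> e" using e xy(2) 3 by auto
      then show ?thesis using ci xy 3 col[of x] col[of y] unfolding cinv_def by simp
    qed
  qed
  with pal show ?thesis unfolding cinv_def by blast
qed

abbreviation recolor_loop :: com where
  "recolor_loop \<equiv> While (Less (Const 0) (Reg 20)) recolor_all_body"

text \<open>For two vertices of equal level, the last recoloring that hits one of them decides: it
  makes a collision at most \<open>1 / T\<close> likely whatever happened before, and later rounds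
  leave the pair alone. A pair without waiting vertices keeps its colors.\<close>

lemma recolor_loop_facts:
  assumes "skel E lev F s" "arrays s 3 = A" "regs s 20 = h" "h \<le> card F"
    and "cinv E lev e ((\<lambda>i. A (ix N (ix N (n + 1) 0) i)) ` {..<h}) s"
  shows "lossless_spmf (exec M recolor_loop s) \<and>
    (\<forall>s'\<in>set_spmf (exec M recolor_loop s). skel E lev F s' \<and> cinv E lev e {} s' \<and>
       (\<forall>r<20. regs s' r = regs s r) \<and>
       time s' \<le> time s + (\<Sum>i<h. 1000 * T (lev (A (ix N (ix N (n + 1) 0) i)))) + 3) \<and>
    (\<forall>x y. x < n \<longrightarrow> y < n \<longrightarrow> x \<noteq> y \<longrightarrow> lev x = lev y \<longrightarrow>
       (\<integral>\<^sup>+ s'. eqc x y s' \<partial>measure_spmf (exec M recolor_loop s)) \<le>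
         (if x \<in> (\<lambda>i. A (ix N (ix N (n + 1) 0) i)) ` {..<h} \<or> y \<in> (\<lambda>i. A (ix N (ix N (n + 1) 0) i)) ` {..<h}
          then ennreal (1 / real (T (lev x))) else eqc x y s))"
  using assms
proof (induction h arbitrary: s)
  case 0
  then have "exec M recolor_loop s = return_spmf (tick 3 s)"
    by (simp add: exec_While[of _ _ _ s])
  then show ?case using 0 by (simp add: eqc_def cinv_def measure_spmf_return_spmf nn_integral_return)
next
  case (Suc h)
  define xs where "xs = (\<lambda>i. A (ix N (ix N (n + 1) 0) i))"
  let ?R = "\<lambda>h. xs ` {..<h}"
  define v where "v = xs h"
  note sk = Suc.prems(1)
  have st: "static s" "graph_on n E" "repS s (lbook E lev {} F)" "F \<subseteq> {..<n}" using sk unfolding skel_def by blast+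
  have N4: "regs s 4 = N" "regs s 6 = n + 1" "regs s 7 = 0" using st(1) by (simp_all add: static_def)
  have bkF: "{w. lbook E lev {} F (n + 1) w = Some 0} = F" by (auto simp: book_def)
  have cF: "arrays s 2 (ix N (n + 1) 0) = card F"
    using rep_count(1)[OF st(3)[unfolded repS_def] n_less_N(2) N_pos] bkF by simp
  have hF: "h < card F" using Suc.prems(4) by simp
  have hN: "h < N" using hF card_mono[OF finite_lessThan st(4)] n_less_N(1) by simp
  have v: "v < n"
    using rep_index(3)[OF st(3)[unfolded repS_def] n_less_N(2) N_pos, of h] hF cF Suc.prems(2)
    by (simp add: v_def xs_def)
  have sl: "aval M (set_reg 20 h s) (slot_e 6 7 (Reg 20)) = ix N (ix N (n + 1) 0) h"
    using aval_set(3)[of "set_reg 20 h s" 6 7 "Reg 20"] N4 n_less_N(2) N_pos hN by simp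
  have ex: "exec M recolor_all_body (tick 3 s) = exec M recolor_com (tick 18 (set_reg 21 v (set_reg 20 h s)))"
    using Suc.prems(2,3) sl by (simp add: recolor_all_body_def v_def xs_def)
  define t where "t = tick 18 (set_reg 21 v (set_reg 20 h s))"
  have loop: "exec M recolor_loop s = bind_spmf (exec M recolor_com t) (exec M recolor_loop)"
    unfolding t_def ex[symmetric] using Suc.prems(3) by (simp add: exec_While[of _ _ _ s] numeral_3_eq_3)
  have skt: "skel E lev F t" "regs t 21 = v" using sk by (simp_all add: t_def)
  note rf = recolor_facts[OF skt v]
  have RS: "?R (Suc h) = insert v (?R h)" unfolding v_def lessThan_Suc by simp
  have cit: "cinv E lev e (insert v (?R h)) t"
  proof -
    have "cinv E lev e R t = cinv E lev e R s" for R by (simp add: cinv_def t_def)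
    then show ?thesis unfolding RS[symmetric] unfolding xs_def using Suc.prems(5) by (simp only:)
  qed
  have step: "skel E lev F t' \<and> arrays t' 3 = A \<and> regs t' 20 = h \<and> cinv E lev e (?R h) t' \<and>
      (\<forall>r<20. regs t' r = regs s r) \<and> time t' \<le> time s + 900 * T (lev v) + 18 \<and>
      (\<forall>w. w \<noteq> v \<longrightarrow> arrays t' 0 w = arrays s 0 w)"
    if t': "t' \<in> set_spmf (exec M recolor_com t)" for t'
  proof -
    obtain c where c: "recolored v c (900 * T (lev v)) t t'" "c \<in> palette (lev v)" "c \<notin> arrays t 0 ` nbs E lev v"
      using rf(2)[OF t'] by blast
    have "skel E lev F t'" by (rule skel_recolored[OF skt(1) c(1)])
    moreover have "cinv E lev e (?R h) t'" by (rule cinv_recolored[OF st(2) v cit c]) simp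
    moreover have "arrays t' 3 = arrays t 3" using c(1) unfolding recolored_def by simp
    then have "arrays t' 3 = A" using Suc.prems(2) by (simp add: t_def)
    moreover have rr: "regs t' r = regs t r" if "r \<notin> {22..29}" for r using c(1) that unfolding recolored_def by blast
    have "regs t' 20 = h" using rr[of 20] by (simp add: t_def)
    moreover have "\<forall>r<20. regs t' r = regs s r"
    proof (intro allI impI)
      fix r :: nat assume "r < 20"
      then have "r \<notin> {22..29}" "r \<noteq> 20" "r \<noteq> 21" by auto
      then show "regs t' r = regs s r" using rr[of r] by (simp add: t_def)
    qed
    moreover have "time t' \<le> time t + 900 * T (lev v)" using c(1) unfolding recolored_def by blast
    then have "time t' \<le> time s + 900 * T (lev v) + 18" by (simp add: t_def)
    moreover have "arrays t' 0 = (arrays t 0)(v := c)" using c(1) unfolding recolored_def by blast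
    then have "\<forall>w. w \<noteq> v \<longrightarrow> arrays t' 0 w = arrays s 0 w" by (simp add: t_def)
    ultimately show ?thesis by blast
  qed
  have IH: "lossless_spmf (exec M recolor_loop t') \<and>
    (\<forall>s'\<in>set_spmf (exec M recolor_loop t'). skel E lev F s' \<and> cinv E lev e {} s' \<and>
       (\<forall>r<20. regs s' r = regs t' r) \<and>
       time s' \<le> time t' + (\<Sum>i<h. 1000 * T (lev (xs i))) + 3) \<and>
    (\<forall>x y. x < n \<longrightarrow> y < n \<longrightarrow> x \<noteq> y \<longrightarrow> lev x = lev y \<longrightarrow>
       (\<integral>\<^sup>+ s'. eqc x y s' \<partial>measure_spmf (exec M recolor_loop t')) \<le>
         (if x \<in> ?R h \<or> y \<in> ?R h then ennreal (1 / real (T (lev x))) else eqc x y t'))"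
    if "t' \<in> set_spmf (exec M recolor_com t)" for t'
  proof -
    have "skel E lev F t'" "arrays t' 3 = A" "regs t' 20 = h" "h \<le> card F" "cinv E lev e (?R h) t'"
      using step[OF that] hF by simp_all
    then show ?thesis unfolding xs_def by (rule Suc.IH)
  qed
  have "lossless_spmf (exec M recolor_loop s)"
    unfolding loop using rf(1) IH by (simp only: lossless_bind_spmf) blast
  moreover have "skel E lev F s' \<and> cinv E lev e {} s' \<and> (\<forall>r<20. regs s' r = regs s r) \<and>
       time s' \<le> time s + (\<Sum>i<Suc h. 1000 * T (lev (xs i))) + 3"
    if s': "s' \<in> set_spmf (exec M recolor_loop s)" for s'
  proof -
    obtain t' where t': "t' \<in> set_spmf (exec M recolor_com t)" "s' \<in> set_spmf (exec M recolor_loop t')"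
      using s' unfolding loop by (auto simp: set_bind_spmf)
    have i: "skel E lev F s'" "cinv E lev e {} s'" "\<forall>r<20. regs s' r = regs t' r"
      "time s' \<le> time t' + (\<Sum>i<h. 1000 * T (lev (xs i))) + 3"
      using IH[OF t'(1)] t'(2) by blast+
    have j: "\<forall>r<20. regs t' r = regs s r" "time t' \<le> time s + 900 * T (lev v) + 18" using step[OF t'(1)] by blast+
    have "1 \<le> T (lev v)" using T_pos[of "lev v"] by linarith
    then have "time s' \<le> time s + (\<Sum>i<Suc h. 1000 * T (lev (xs i))) + 3"
      using i(4) j(2) by (simp add: v_def)
    then show ?thesis using i j by simp
  qed
  moreover have "(\<integral>\<^sup>+ s'. eqc x y s' \<partial>measure_spmf (exec M recolor_loop s)) \<le>
         (if x \<in> ?R (Suc h) \<or> y \<in> ?R (Suc h) then ennreal (1 / real (T (lev x))) else eqc x y s)"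
    if xy: "x < n" "y < n" "x \<noteq> y" "lev x = lev y" for x y
  proof -
    have I: "(\<integral>\<^sup>+ s'. eqc x y s' \<partial>measure_spmf (exec M recolor_loop t')) \<le>
         (if x \<in> ?R h \<or> y \<in> ?R h then ennreal (1 / real (T (lev x))) else eqc x y t')"
      if "t' \<in> set_spmf (exec M recolor_com t)" for t' using IH[OF that] xy by blast
    have int: "(\<integral>\<^sup>+ s'. eqc x y s' \<partial>measure_spmf (exec M recolor_loop s)) =
       (\<integral>\<^sup>+ t'. (\<integral>\<^sup>+ s'. eqc x y s' \<partial>measure_spmf (exec M recolor_loop t')) \<partial>measure_spmf (exec M recolor_com t))"
      unfolding loop by (rule nn_integral_measure_spmf_bind)
    consider "x \<in> ?R h \<or> y \<in> ?R h" | "x \<notin> ?R h" "y \<notin> ?R h" "x = v" | "x \<notin> ?R h" "y \<notin> ?R h" "y = v"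
      | "x \<notin> ?R h" "y \<notin> ?R h" "x \<noteq> v" "y \<noteq> v" by blast
    then show ?thesis
    proof cases
      case 1
      have "(\<integral>\<^sup>+ s'. eqc x y s' \<partial>measure_spmf (exec M recolor_loop s)) \<le> ennreal (1 / real (T (lev x)))"
        unfolding int by (rule nn_integral_spmf_le) (use I 1 in simp)
      then show ?thesis using 1 unfolding RS by auto
    next
      case 2
      have "(\<integral>\<^sup>+ s'. eqc x y s' \<partial>measure_spmf (exec M recolor_loop s)) \<le>
          (\<integral>\<^sup>+ t'. eqc v y t' \<partial>measure_spmf (exec M recolor_com t))"
        unfolding int by (rule nn_integral_spmf_mono) (use I 2 in simp)
      also have "\<dots> \<le> ennreal (1 / real (T (lev x)))" using rf(3)[of y] 2(3) xy by simp
      finally show ?thesis using 2 unfolding RS by simp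
    next
      case 3
      have "(\<integral>\<^sup>+ s'. eqc x y s' \<partial>measure_spmf (exec M recolor_loop s)) \<le>
          (\<integral>\<^sup>+ t'. eqc v x t' \<partial>measure_spmf (exec M recolor_com t))"
        unfolding int
      proof (rule nn_integral_spmf_mono)
        fix t' assume "t' \<in> set_spmf (exec M recolor_com t)"
        from I[OF this] 3 have "(\<integral>\<^sup>+ s'. eqc x y s' \<partial>measure_spmf (exec M recolor_loop t')) \<le> eqc x y t'" by simp
        also have "eqc x y t' = eqc v x t'" using 3(3) by (simp add: eqc_def eq_commute)
        finally show "(\<integral>\<^sup>+ s'. eqc x y s' \<partial>measure_spmf (exec M recolor_loop t')) \<le> eqc v x t'" .
      qed
      also have "\<dots> \<le> ennreal (1 / real (T (lev x)))" using rf(3)[of x] 3(3) xy by simp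
      finally show ?thesis using 3 unfolding RS by simp
    next
      case 4
      have "(\<integral>\<^sup>+ s'. eqc x y s' \<partial>measure_spmf (exec M recolor_loop s)) \<le> eqc x y s"
        unfolding int
      proof (rule nn_integral_spmf_le)
        fix t' assume t': "t' \<in> set_spmf (exec M recolor_com t)"
        have "eqc x y t' = eqc x y s" using step[OF t'] 4 by (simp add: eqc_def)
        then show "(\<integral>\<^sup>+ s'. eqc x y s' \<partial>measure_spmf (exec M recolor_loop t')) \<le> eqc x y s"
          using I[OF t'] 4 by simp
      qed
      then show ?thesis using 4 unfolding RS by simp
    qed
  qed
  ultimately show ?case unfolding xs_def by blast
qed

end

text \<open>Transfers the average over a uniform draw to real arithmetic, where terms such as
  \<open>t - 2\<close> can be handled.\<close>

lemma uniform_bound: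
  fixes b :: "nat \<Rightarrow> real"
  assumes t: "0 < t" and f: "\<And>r. r < t \<Longrightarrow> f r \<le> ennreal (b r)" and b: "\<And>r. r < t \<Longrightarrow> 0 \<le> b r"
    and sum: "(\<Sum>r<t. b r) \<le> real t * c"
  shows "(\<integral>\<^sup>+ r. f r \<partial>measure_spmf (spmf_of_set {0..<t})) \<le> ennreal c"
proof -
  have "(\<Sum>r\<in>{0..<t}. f r) \<le> (\<Sum>r\<in>{0..<t}. ennreal (b r))" by (intro sum_mono f) simp
  also have "\<dots> = ennreal (\<Sum>r<t. b r)" using b by (subst sum_ennreal) (auto simp: atLeast0LessThan)
  also have "\<dots> \<le> ennreal (real t * c)" using sum by (rule ennreal_leI)
  finally have "(\<Sum>r\<in>{0..<t}. f r) / of_nat t \<le> ennreal (real t * c) / of_nat t"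
    by (rule divide_right_mono_ennreal)
  also have "\<dots> = ennreal (real t * c / real t)"
  proof -
    have "0 \<le> real t * c" using order.trans[OF sum_nonneg sum] b by simp
    then show ?thesis using t by (simp add: divide_ennreal ennreal_of_nat_eq_real_of_nat del: times_divide_eq_left)
  qed
  finally show ?thesis using t by (simp add: nn_integral_spmf_of_set)
qed

context level_params
begin

lemma recolor_all_facts:
  assumes sk: "skel E lev F s" and ci: "cinv E lev e F s"
  shows "lossless_spmf (exec M recolor_all_com s)" (is ?A)
    "\<And>s'. s' \<in> set_spmf (exec M recolor_all_com s) \<Longrightarrow> skel E lev F s' \<and> cinv E lev e {} s' \<and>
       (\<forall>r<20. regs s' r = regs s r) \<and> time s' \<le> time s + 1000 * (\<Sum>v\<in>F. T (lev v)) + 10" (is "\<And>s'. _ \<Longrightarrow> ?B s'")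
    "\<And>x y. x < n \<Longrightarrow> y < n \<Longrightarrow> x \<noteq> y \<Longrightarrow> lev x = lev y \<Longrightarrow>
       (\<integral>\<^sup>+ s'. eqc x y s' \<partial>measure_spmf (exec M recolor_all_com s)) \<le>
         (if x \<in> F \<or> y \<in> F then ennreal (1 / real (T (lev x))) else eqc x y s)" (is "\<And>x y. _ \<Longrightarrow> _ \<Longrightarrow> _ \<Longrightarrow> _ \<Longrightarrow> ?C x y")
proof -
  have st: "static s" "graph_on n E" "repS s (lbook E lev {} F)" "F \<subseteq> {..<n}" using sk unfolding skel_def by blast+
  have N4: "regs s 4 = N" "regs s 6 = n + 1" "regs s 7 = 0" using st(1) by (simp_all add: static_def)
  have bkF: "{w. lbook E lev {} F (n + 1) w = Some 0} = F" by (auto simp: book_def)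
  note rp = st(3)[unfolded repS_def]
  have cF: "arrays s 2 (ix N (n + 1) 0) = card F"
    using rep_count(1)[OF rp n_less_N(2) N_pos] bkF by simp
  define A where "A = arrays s 3"
  define xs where "xs = (\<lambda>i. A (ix N (ix N (n + 1) 0) i))"
  have bij: "bij_betw xs {..<card F} F"
    using rep_bij[OF rp n_less_N(2) N_pos] unfolding bkF cF A_def[symmetric] xs_def[symmetric] .
  have img: "xs ` {..<card F} = F" using bij by (simp add: bij_betw_def)
  have sum: "(\<Sum>i<card F. 1000 * T (lev (xs i))) = 1000 * (\<Sum>v\<in>F. T (lev v))"
    using sum.reindex_bij_betw[OF bij, of "\<lambda>v. T (lev v)"] by (simp add: sum_distrib_left[symmetric])
  have sum': "(\<Sum>i<card F. 1000 * T (lev (A (ix N (ix N (n + 1) 0) i)))) = 1000 * (\<Sum>v\<in>F. T (lev v))"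
    using sum by (simp only: xs_def)
  define t where "t = tick 7 (set_reg 20 (card F) s)"
  have "aval M s (cnt_e 6 7) = card F" using aval_set(1)[of s 6 7] N4 n_less_N(2) N_pos cF by simp
  then have ex: "exec M recolor_all_com s = exec M recolor_loop t"
    by (simp add: recolor_all_com_def t_def)
  have ct: "cinv E lev e (xs ` {..<card F}) t"
    unfolding img using ci by (simp add: cinv_def t_def)
  have skt: "skel E lev F t" "arrays t 3 = A" "regs t 20 = card F" "card F \<le> card F"
    using sk by (simp_all add: t_def A_def)
  note facts = recolor_loop_facts[OF skt ct[unfolded xs_def], unfolded sum', folded xs_def, unfolded img]
  show ?A unfolding ex using facts by blast
  show "?B s'" if s': "s' \<in> set_spmf (exec M recolor_all_com s)" for s'
  proof -
    have f: "skel E lev F s'" "cinv E lev e {} s'" "\<forall>r<20. regs s' r = regs t r"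
      "time s' \<le> time t + 1000 * (\<Sum>v\<in>F. T (lev v)) + 3"
      using facts s' unfolding ex by blast+
    have "\<forall>r<20. regs s' r = regs s r" using f(3) by (simp add: t_def)
    moreover have "time s' \<le> time s + 1000 * (\<Sum>v\<in>F. T (lev v)) + 10" using f(4) by (simp add: t_def)
    ultimately show ?thesis using f(1,2) by blast
  qed
  show "?C x y" if "x < n" "y < n" "x \<noteq> y" "lev x = lev y" for x y
  proof -
    have "eqc x y t = eqc x y s" by (simp add: eqc_def t_def)
    then show ?thesis unfolding ex using facts that by metis
  qed
qed

text \<open>A recoloring of \<open>u\<close> has two causes, a small draw or a conflict with
  \<open>v\<close>. Their contributions are added and not separated by conditioning. The conflict
  thus enters linearly through \<open>eqc u v s\<close>, and later only its expectation has to be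
  known, not a joint distribution of several pairs.\<close>

lemma refresh_facts:
  assumes sk: "skel E lev F s" and ci: "cinv E lev {u, v} {} s"
    and uv: "regs s 1 = u" "regs s 2 = v" "u < n" "v < n" "u \<noteq> v"
  shows "lossless_spmf (exec M refresh_com s)" (is ?A)
    "\<And>s'. s' \<in> set_spmf (exec M refresh_com s) \<Longrightarrow> skel E lev F s' \<and> cinv E lev {} {} s'" (is "\<And>s'. _ \<Longrightarrow> ?B s'")
    "(\<integral>\<^sup>+ s'. ennreal (real (time s')) \<partial>measure_spmf (exec M refresh_com s)) \<le>
      ennreal (real (time s) + 2000) + ennreal (900 * real (T (lev u))) * eqc u v s" (is ?D)
    "\<And>x y. x < n \<Longrightarrow> y < n \<Longrightarrow> x \<noteq> y \<Longrightarrow> lev x = lev y \<Longrightarrow> u \<notin> {x, y} \<Longrightarrow>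
       (\<integral>\<^sup>+ s'. eqc x y s' \<partial>measure_spmf (exec M refresh_com s)) \<le> eqc x y s" (is "\<And>x y. _ \<Longrightarrow> _ \<Longrightarrow> _ \<Longrightarrow> _ \<Longrightarrow> _ \<Longrightarrow> ?C x y")
    "\<And>y. y < n \<Longrightarrow> u \<noteq> y \<Longrightarrow> lev u = lev y \<Longrightarrow> 2 \<le> T (lev u) \<Longrightarrow>
       (\<integral>\<^sup>+ s'. eqc u y s' \<partial>measure_spmf (exec M refresh_com s)) \<le>
         ennreal (1 - 2 / real (T (lev u))) * eqc u y s + ennreal (2 / (real (T (lev u)))\<^sup>2)
         + ennreal (1 / real (T (lev u))) * eqc u v s" (is "\<And>y. _ \<Longrightarrow> _ \<Longrightarrow> _ \<Longrightarrow> _ \<Longrightarrow> ?G y")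
proof -
  have st: "static s" "graph_on n E" "arrays s 1 = lev" "lev u \<le> K" using sk uv unfolding skel_def by blast+
  define t where "t = T (lev u)"
  have tpos: "0 < t" by (simp add: t_def)
  define conf where "conf = (arrays s 0 u = arrays s 0 v)"
  define w where "w = (\<lambda>r. tick 20 (set_reg 29 r (set_reg 30 t (set_reg 21 u s))))"
  define k where "k = (\<lambda>r. if r < 2 \<or> conf then exec M recolor_com (w r) else return_spmf (tick 1 (w r)))"
  have T5: "arrays s 5 (lev u) = t" using st by (simp add: static_def t_def)
  have ex: "exec M refresh_com s = bind_spmf (spmf_of_set {0..<t}) k"
  proof -
    have e1: "exec M (Assign 21 (Reg 1)) s = return_spmf (tick 2 (set_reg 21 u s))"
      using uv by (simp add: numeral_2_eq_2)
    have e2: "exec M (Assign 30 (Read 5 (Read 1 (Reg 1)))) (tick 2 (set_reg 21 u s)) =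
        return_spmf (tick 6 (set_reg 30 t (set_reg 21 u s)))"
      using uv st(3) T5 by simp
    have e3: "exec M (Random 29 (Reg 30)) (tick 6 (set_reg 30 t (set_reg 21 u s))) =
        map_spmf (\<lambda>r. tick 8 (set_reg 29 r (set_reg 30 t (set_reg 21 u s)))) (spmf_of_set {0..<t})"
      using tpos by simp
    have e4: "exec M (Cond (Neg (Conj (Neg (Less (Reg 29) (Const 2))) (Neg (Equal (Read 0 (Reg 1)) (Read 0 (Reg 2))))))
            recolor_com Skip) (tick 8 (set_reg 29 r (set_reg 30 t (set_reg 21 u s)))) = k r" for r
      using uv by (simp add: k_def w_def conf_def)
    show ?thesis
      by (simp only: refresh_com_def exec.simps(5) e1 e2 e3 e4 return_bind_spmf bind_spmf_map_spmf)
  qed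
  have wr: "skel E lev F (w r)" "regs (w r) 21 = u" for r using sk by (simp_all add: w_def)
  note rf = recolor_facts[OF wr uv(3)]
  have w0: "arrays (w r) 0 = arrays s 0" "time (w r) = time s + 20" for r by (simp_all add: w_def)
  have ciw: "cinv E lev {u, v} (insert u {}) (w r)" for r
    using ci unfolding cinv_def w0 by blast
  show ?A
    unfolding ex using rf(1) tpos by (auto simp: k_def)
  show "?B s'" if s': "s' \<in> set_spmf (exec M refresh_com s)" for s'
  proof -
    obtain r where r: "s' \<in> set_spmf (k r)" using s' unfolding ex by (auto simp: set_bind_spmf)
    show ?thesis
    proof (cases "r < 2 \<or> conf")
      case True
      then have "s' \<in> set_spmf (exec M recolor_com (w r))" using r by (simp add: k_def)
      then obtain c where c: "recolored u c (900 * T (lev u)) (w r) s'" "c \<in> palette (lev u)"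
        "c \<notin> arrays (w r) 0 ` nbs E lev u" using rf(2) by blast
      have "cinv E lev {} {} s'"
        by (rule cinv_recolored[OF st(2) uv(3) ciw c]) simp
      then show ?thesis using skel_recolored[OF wr(1) c(1)] by blast
    next
      case False
      then have s'': "s' = tick 1 (w r)" using r by (simp add: k_def)
      have nc: "arrays s 0 u \<noteq> arrays s 0 v" using False by (simp add: conf_def)
      have "arrays s 0 x \<noteq> arrays s 0 y" if xy: "{x, y} \<in> E" for x y
      proof (cases "{x, y} = {u, v}")
        case True
        then have "x = u \<and> y = v \<or> x = v \<and> y = u" by (simp add: doubleton_eq_iff)
        then show ?thesis using nc by metis
      next
        case False
        then show ?thesis using ci xy unfolding cinv_def by blast
      qed
      then have "cinv E lev {} {} s'" using ci unfolding cinv_def s'' by (simp add: w0)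
      then show ?thesis using wr(1) unfolding s'' by simp
    qed
  qed
  have int: "(\<integral>\<^sup>+ s'. g s' \<partial>measure_spmf (exec M refresh_com s)) =
      (\<integral>\<^sup>+ r. (\<integral>\<^sup>+ s'. g s' \<partial>measure_spmf (k r)) \<partial>measure_spmf (spmf_of_set {0..<t}))" for g
    unfolding ex by (rule nn_integral_measure_spmf_bind)
  have ret: "(\<integral>\<^sup>+ s'. g s' \<partial>measure_spmf (return_spmf x)) = g x" for g :: "state \<Rightarrow> ennreal" and x
    by (simp add: measure_spmf_return_spmf nn_integral_return)
  \<comment> \<open>Only an inequality, since for \<open>t = 1\<close> the draw has a single
    value.\<close>
  have two: "(\<Sum>r<t. of_bool (r < 2) :: real) \<le> 2"
  proof -
    have "(\<Sum>r<t. of_bool (r < 2) :: real) = real (card {r. r < t \<and> r < 2})"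
      by (simp add: of_bool_def sum.If_cases Int_def lessThan_def)
    also have "\<dots> \<le> real (card {..<2::nat})" by (intro of_nat_mono card_mono) auto
    finally show ?thesis by simp
  qed
  show ?D
  proof -
    \<comment> \<open>A small draw costs \<open>900 * t\<close> but accounts for at most two of the
      \<open>t\<close> values, which averages to at most 1800; the conflict term stays as it
      is.\<close>
    define b where "b = (\<lambda>r. real (time s) + 21 + 900 * real t * of_bool (r < (2::nat)) + 900 * real t * of_bool conf)"
    have "(\<integral>\<^sup>+ s'. ennreal (real (time s')) \<partial>measure_spmf (k r)) \<le> ennreal (b r)" for r
    proof (cases "r < 2 \<or> conf")
      case True
      have "ennreal (real (time s')) \<le> ennreal (b r)" if s': "s' \<in> set_spmf (exec M recolor_com (w r))" for s'
      proof -
        obtain c where "recolored u c (900 * T (lev u)) (w r) s'" using rf(2)[OF s'] by blast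
        then have "time s' \<le> time s + 20 + 900 * t" unfolding recolored_def w0 t_def by blast
        then have "real (time s') \<le> real (time s) + 20 + 900 * real t" by (simp flip: of_nat_add of_nat_mult)
        also have "\<dots> \<le> b r" using True by (auto simp: b_def)
        finally show ?thesis by (rule ennreal_leI)
      qed
      then show ?thesis unfolding k_def using True by (simp add: nn_integral_spmf_le)
    next
      case False
      then show ?thesis unfolding k_def by (simp add: ret w0 b_def)
    qed
    moreover have "(\<Sum>r<t. b r) \<le> real t * (real (time s) + 2000 + 900 * real t * of_bool conf)"
    proof -
      have "(\<Sum>r<t. b r) = real t * (real (time s) + 21 + 900 * real t * of_bool conf) + 900 * real t * (\<Sum>r<t. of_bool (r < 2))"
        by (simp only: b_def sum.distrib sum_distrib_left[symmetric] sum_constant card_lessThan)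
          (simp add: algebra_simps del: sum_of_bool_eq)
      also have "\<dots> \<le> real t * (real (time s) + 21 + 900 * real t * of_bool conf) + 900 * real t * 2"
        using two by (intro add_left_mono mult_left_mono) auto
      also have "\<dots> \<le> real t * (real (time s) + 2000 + 900 * real t * of_bool conf)"
        by (simp add: algebra_simps)
      finally show ?thesis .
    qed
    ultimately have "(\<integral>\<^sup>+ s'. ennreal (real (time s')) \<partial>measure_spmf (exec M refresh_com s)) \<le>
        ennreal (real (time s) + 2000 + 900 * real t * of_bool conf)"
      unfolding int by (intro uniform_bound[OF tpos]) (auto simp: b_def)
    also have "\<dots> = ennreal (real (time s) + 2000) + ennreal (900 * real t) * ennreal (of_bool conf)"
      by (subst ennreal_mult[symmetric]; simp add: ennreal_plus[symmetric] del: ennreal_plus)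
    finally show ?thesis by (simp add: t_def eqc_def conf_def ind_ennreal)
  qed
  show "?C x y" if xy: "x < n" "y < n" "x \<noteq> y" "lev x = lev y" "u \<notin> {x, y}" for x y
  proof -
    have "(\<integral>\<^sup>+ s'. eqc x y s' \<partial>measure_spmf (k r)) \<le> eqc x y s" for r
    proof (rule nn_integral_spmf_le)
      fix s' assume s': "s' \<in> set_spmf (k r)"
      show "eqc x y s' \<le> eqc x y s"
      proof (cases "r < 2 \<or> conf")
        case True
        then obtain c where "recolored u c (900 * T (lev u)) (w r) s'" using rf(2) s' unfolding k_def by fastforce
        then have "arrays s' 0 = (arrays s 0)(u := c)" unfolding recolored_def w0 by blast
        then show ?thesis using xy(5) by (simp add: eqc_def)
      next
        case False
        then have "s' = tick 1 (w r)" using s' by (simp add: k_def)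
        then show ?thesis by (simp add: eqc_def w0)
      qed
    qed
    then show ?thesis unfolding int by (rule nn_integral_spmf_le)
  qed
  show "?G y" if y: "y < n" "u \<noteq> y" "lev u = lev y" "2 \<le> T (lev u)" for y
  proof -
    define q where "q = (of_bool (arrays s 0 u = arrays s 0 y) :: real)"
    have t2: "2 \<le> t" using y(4) by (simp add: t_def)
    have q01: "0 \<le> q" "q \<le> 1" by (simp_all add: q_def)
    \<comment> \<open>One bound for all cases: a recoloring, whether by a small draw or by the
      conflict, collides with probability at most \<open>1 / t\<close>; otherwise the old value
      \<open>q\<close> persists.\<close>
    define b where "b = (\<lambda>r. (if r < (2::nat) then 1 / real t else q) + of_bool conf / real t)"
    have "(\<integral>\<^sup>+ s'. eqc u y s' \<partial>measure_spmf (k r)) \<le> ennreal (b r)" for r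
    proof (cases "r < 2 \<or> conf")
      case True
      then have "(\<integral>\<^sup>+ s'. eqc u y s' \<partial>measure_spmf (k r)) \<le> ennreal (1 / real t)"
        unfolding k_def t_def using rf(3)[of y r] y(2) by simp
      also have "\<dots> \<le> ennreal (b r)" using True q01 by (intro ennreal_leI) (auto simp: b_def)
      finally show ?thesis .
    next
      case False
      then show ?thesis unfolding k_def by (simp add: ret b_def q_def eqc_def w0 ind_ennreal)
    qed
    moreover have "(\<Sum>r<t. b r) \<le> real t * ((1 - 2 / real t) * q + 2 / (real t)\<^sup>2 + 1 / real t * of_bool conf)"
    proof -
      have "(\<Sum>r<t. if r < (2::nat) then 1 / real t else q) = (\<Sum>r\<in>{..<2::nat}. 1 / real t) + (\<Sum>r\<in>{2::nat..<t}. q)"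
      proof -
        let ?f = "\<lambda>r :: nat. if r < 2 then 1 / real t else q"
        have "{..<t} = {..<2::nat} \<union> {2::nat..<t}" using t2 by auto
        then have "sum ?f {..<t} = sum ?f ({..<2} \<union> {2..<t})" by (rule arg_cong)
        also have "\<dots> = sum ?f {..<2} + sum ?f {2..<t}" by (rule sum.union_disjoint) auto
        finally have "sum ?f {..<t} = sum ?f {..<2} + sum ?f {2..<t}" .
        moreover have "(\<Sum>r\<in>{2::nat..<t}. if r < 2 then 1 / real t else q) = (\<Sum>r\<in>{2::nat..<t}. q)" by (intro sum.cong) auto
        moreover have "(\<Sum>r\<in>{..<2::nat}. if r < 2 then 1 / real t else q) = (\<Sum>r\<in>{..<2::nat}. 1 / real t)" by (intro sum.cong) auto
        ultimately show ?thesis by simp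
      qed
      also have "\<dots> = 2 / real t + (real t - 2) * q" using t2 by simp
      finally have "(\<Sum>r<t. b r) = 2 / real t + (real t - 2) * q + of_bool conf"
        using tpos by (simp add: b_def sum.distrib)
      also have "\<dots> = real t * ((1 - 2 / real t) * q + 2 / (real t)\<^sup>2 + 1 / real t * of_bool conf)"
        using tpos by (simp add: field_simps power2_eq_square)
      finally show ?thesis by simp
    qed
    moreover have "0 \<le> b r" for r using q01 by (simp add: b_def)
    ultimately have "(\<integral>\<^sup>+ s'. eqc u y s' \<partial>measure_spmf (exec M refresh_com s)) \<le>
        ennreal ((1 - 2 / real t) * q + 2 / (real t)\<^sup>2 + 1 / real t * of_bool conf)"
      unfolding int by (intro uniform_bound[OF tpos, where b = b])
    also have "\<dots> = ennreal (1 - 2 / real t) * ennreal q + ennreal (2 / (real t)\<^sup>2) + ennreal (1 / real t) * ennreal (of_bool conf)"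
    proof -
      have "0 \<le> 1 - 2 / real t" using t2 by simp
      then show ?thesis using q01 by (simp add: ennreal_mult ennreal_plus)
    qed
    finally show ?thesis by (simp add: t_def q_def conf_def eqc_def ind_ennreal)
  qed
qed

end

section \<open>Initialization\<close>

definition size_loop :: com where
  "size_loop = While (Neg (Less (Reg 3) (Reg 10)))
     (Seq (Assign 10 (Plus (Reg 10) (Reg 10))) (Assign 5 (Plus (Reg 5) (Const 1))))"

definition table_body :: com where
  "table_body =
     Seq (Store 5 (Reg 12) (Reg 14))
    (Seq (Store 6 (Reg 12) (Reg 13))
    (Seq (Assign 13 (Plus (Reg 13) (Times (Const 4) (Reg 14))))
    (Seq (Assign 12 (Plus (Reg 12) (Const 1)))
    (Seq (Assign 15 (Plus (Reg 15) (Const 1)))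
         (Cond (Equal (Reg 15) (Reg 5))
            (Seq (Assign 15 (Const 0)) (Assign 14 (Plus (Reg 14) (Reg 14)))) Skip)))))"

definition table_loop :: com where
  "table_loop = While (Less (Reg 12) (Plus (Reg 11) (Const 1))) table_body"

definition color_loop :: com where
  "color_loop = While (Less (Reg 12) (Reg 3))
     (Seq (Store 0 (Reg 12) (Const 1)) (Assign 12 (Plus (Reg 12) (Const 1))))"

definition init_com :: com where
  "init_com =
     Seq (Assign 3 (Reg 0))
    (Seq (Assign 6 (Plus (Reg 0) (Const 1)))
    (Seq (Assign 4 (Times (Reg 6) (Reg 6)))
    (Seq (Assign 10 (Const 1))
    (Seq size_loop
    (Seq (Assign 11 (Times (Reg 5) (Reg 5)))
    (Seq (Assign 12 (Const 0))
    (Seq (Assign 14 (Const 1))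
    (Seq table_loop
    (Seq (Assign 12 (Const 0))
         color_loop)))))))))"

context level_params
begin

text \<open>The loop finds the least exponent whose power of two exceeds \<open>n\<close>; by
  \<open>pow_le\<close> this exponent is \<open>L\<close>.\<close>

lemma exec_size:
  assumes "regs s 3 = n" "regs s 10 = 1" "regs s 5 = 0"
  shows "\<exists>s'. exec M size_loop s = return_spmf s' \<and> regs s' 5 = L \<and>
    (\<forall>r. r \<noteq> 5 \<and> r \<noteq> 10 \<longrightarrow> regs s' r = regs s r) \<and> arrays s' = arrays s \<and>
    time s' \<le> time s + 20 * L + 20"
proof -
  define I where "I = (\<lambda>t :: state. regs t 10 = 2 ^ regs t 5 \<and> regs t 5 \<le> L \<and>
    (\<forall>r. r \<noteq> 5 \<and> r \<noteq> 10 \<longrightarrow> regs t r = regs s r) \<and> arrays t = arrays s \<and> time t \<le> time s + 20 * regs t 5)"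
  let ?b = "Neg (Less (Reg 3) (Reg 10))"
  let ?body = "Seq (Assign 10 (Plus (Reg 10) (Reg 10))) (Assign 5 (Plus (Reg 5) (Const 1)))"
  have nM: "4 * n < M" "Suc L < M"
  proof -
    have "8 * n \<le> 8 * n * N" using N_pos by (cases N) auto
    then show "4 * n < M" using N3_less_M(6) by linarith
    then show "Suc L < M" using L_le n2 by linarith
  qed
  have "\<exists>s'. exec M (While ?b ?body) s = return_spmf (tick (bcost ?b) s') \<and> I s' \<and> \<not> bval M s' ?b"
  proof (rule exec_while_det[where I = I and m = "\<lambda>t. L - regs t 5"])
    show "I s" using assms by (simp add: I_def)
    fix t assume I: "I t" and b: "bval M t ?b"
    define k where "k = regs t 5"
    have k: "regs t 10 = 2 ^ k" "k \<le> L" "regs t 3 = n" using I assms by (simp_all add: I_def k_def)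
    have le: "2 ^ k \<le> n" using b k by simp
    have kL: "k < L"
    proof (rule ccontr)
      assume "\<not> k < L"
      then have "k = L" using k(2) by simp
      then show False using le n_less by simp
    qed
    have mods: "(2 ^ k + 2 ^ k) mod M = 2 ^ Suc k" "Suc k mod M = Suc k"
      using le nM kL by (simp_all add: mult_2[symmetric])
    let ?t = "tick 12 (set_reg 5 (Suc k) (set_reg 10 (2 ^ Suc k) t))"
    have "exec M ?body (tick (bcost ?b) t) = return_spmf ?t"
      using k mods by (simp add: k_def[symmetric] del: power_Suc)
    moreover have "I ?t" using I kL unfolding I_def by (simp add: k_def[symmetric] del: power_Suc)
    moreover have "L - regs ?t 5 < L - regs t 5" using kL by (simp add: k_def[symmetric])
    ultimately show "\<exists>s'. exec M ?body (tick (bcost ?b) t) = return_spmf s' \<and> I s' \<and> L - regs s' 5 < L - regs t 5"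
      by blast
  qed
  then obtain s' where s': "exec M (While ?b ?body) s = return_spmf (tick (bcost ?b) s')" "I s'" "\<not> bval M s' ?b"
    by blast
  have "n < 2 ^ regs s' 5" using s'(2,3) assms by (simp add: I_def)
  have "regs s' 5 = L"
  proof (rule ccontr)
    assume "regs s' 5 \<noteq> L"
    then have "Suc (regs s' 5) \<le> L" using s'(2) by (simp add: I_def)
    then have "2 ^ Suc (regs s' 5) \<le> (2 ^ L :: nat)" by (intro power_increasing) auto
    then show False using pow_le \<open>n < 2 ^ regs s' 5\<close> by simp
  qed
  then show ?thesis
    using s'(1,2) by (intro exI[of _ "tick (bcost ?b) s'"]) (simp add: size_loop_def I_def)
qed

text \<open>Register 15 counts \<open>l mod L\<close>, so that the threshold in register 14 doubles
  exactly when a group of \<open>L\<close> levels is complete.\<close>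

lemma exec_table:
  assumes "regs s 5 = L" "regs s 11 = K" "regs s 12 = 0" "regs s 13 = 0" "regs s 14 = 1" "regs s 15 = 0"
  shows "\<exists>s'. exec M table_loop s = return_spmf s' \<and>
    (\<forall>r. r \<notin> {12, 13, 14, 15} \<longrightarrow> regs s' r = regs s r) \<and> (\<forall>a. a \<notin> {5, 6} \<longrightarrow> arrays s' a = arrays s a) \<and>
    (\<forall>l\<le>K. arrays s' 5 l = T l \<and> arrays s' 6 l = off l) \<and>
    time s' \<le> time s + 100 * Suc K + 20"
proof -
  define I where "I = (\<lambda>t :: state. regs t 12 \<le> Suc K \<and> regs t 13 = off (regs t 12) \<and> regs t 14 = T (regs t 12) \<and>
    regs t 15 = regs t 12 mod L \<and>
    (\<forall>r. r \<notin> {12, 13, 14, 15} \<longrightarrow> regs t r = regs s r) \<and> (\<forall>a. a \<notin> {5, 6} \<longrightarrow> arrays t a = arrays s a) \<and>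
    (\<forall>l<regs t 12. arrays t 5 l = T l \<and> arrays t 6 l = off l) \<and> time t \<le> time s + 100 * regs t 12)"
  let ?b = "Less (Reg 12) (Plus (Reg 11) (Const 1))"
  have KM: "Suc K mod M = Suc K" "Suc K < M" using K_less_N N3_less_M(3) by simp_all
  have "\<exists>s'. exec M (While ?b table_body) s = return_spmf (tick (bcost ?b) s') \<and> I s' \<and> \<not> bval M s' ?b"
  proof (rule exec_while_det[where I = I and m = "\<lambda>t. Suc K - regs t 12"])
    show "I s" using assms by (simp add: I_def off_def T_def)
    fix t assume I: "I t" and b: "bval M t ?b"
    define l where "l = regs t 12"
    have r: "regs t 13 = off l" "regs t 14 = T l" "regs t 15 = l mod L" "regs t 5 = L" "regs t 11 = K"
      using I assms by (simp_all add: I_def l_def)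
    have lK: "l \<le> K" using b r KM by (simp add: l_def)
    have oM: "off l + 4 * T l + 1 < M" by (rule off_less_M[OF lK])
    have modL: "l mod L < L" using L_pos by simp
    have lM: "Suc (l mod L) < M" using modL L_le n_less_N N3_less_M(3) by linarith
    have mods: "4 * T l mod M = 4 * T l" "(off l + 4 * T l) mod M = off (Suc l)" "Suc l mod M = Suc l"
      "Suc (l mod L) mod M = Suc (l mod L)" "(T l + T l) mod M = 2 * T l"
      using oM lK KM lM by (simp_all add: off_Suc)
    define a where "a = (\<lambda>t. set_reg 15 (Suc (l mod L)) (set_reg 12 (Suc l) (set_reg 13 (off (Suc l))
        (set_cell 6 l (off l) (set_cell 5 l (T l) t)))))"
    have pre: "regs (a t) 15 = Suc (l mod L)" "regs (a t) 5 = L" "regs (a t) 14 = T l"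
      using r by (simp_all add: a_def)
    have ex: "exec M table_body (tick (bcost ?b) t) =
      exec M (Cond (Equal (Reg 15) (Reg 5)) (Seq (Assign 15 (Const 0)) (Assign 14 (Plus (Reg 14) (Reg 14)))) Skip)
        (tick 25 (a t))"
      using r mods by (simp add: table_body_def l_def[symmetric] a_def)
    have common: "I t'" if t': "regs t' = (regs t)(12 := Suc l, 13 := off (Suc l), 14 := T (Suc l), 15 := Suc l mod L)"
      "arrays t' = arrays (a t)" "time t' \<le> time t + 100" for t'
    proof -
      have "\<forall>j<Suc l. arrays t' 5 j = T j \<and> arrays t' 6 j = off j"
        using I unfolding t'(2) I_def a_def l_def[symmetric] by (simp add: less_Suc_eq)
      moreover have "\<forall>c. c \<notin> {5, 6} \<longrightarrow> arrays t' c = arrays s c"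
        using I unfolding t'(2) I_def a_def by simp
      ultimately show ?thesis
        using I lK t'(3) unfolding I_def t'(1) l_def[symmetric] by simp
    qed
    show "\<exists>s'. exec M table_body (tick (bcost ?b) t) = return_spmf s' \<and> I s' \<and> Suc K - regs s' 12 < Suc K - regs t 12"
    proof (cases "Suc (l mod L) = L")
      case True
      let ?t = "tick 34 (set_reg 14 (2 * T l) (set_reg 15 0 (a t)))"
      have "exec M table_body (tick (bcost ?b) t) = return_spmf ?t"
        unfolding ex using True pre mods(5) by simp
      moreover have "I ?t"
      proof (rule common)
        have "T (Suc l) = 2 * T l" "Suc l mod L = 0"
          using True by (simp_all add: T_def div_Suc mod_Suc)
        then show "regs ?t = (regs t)(12 := Suc l, 13 := off (Suc l), 14 := T (Suc l), 15 := Suc l mod L)"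
          by (simp add: a_def fun_upd_twist)
      qed (simp_all add: a_def)
      moreover have "Suc K - regs ?t 12 < Suc K - regs t 12" using lK by (simp add: a_def l_def[symmetric])
      ultimately show ?thesis by blast
    next
      case False
      let ?t = "tick 29 (a t)"
      have "exec M table_body (tick (bcost ?b) t) = return_spmf ?t"
        unfolding ex using False pre by simp
      moreover have "I ?t"
      proof (rule common)
        have *: "T (Suc l) = T l" "Suc l mod L = Suc (l mod L)"
          using False by (simp_all add: T_def div_Suc mod_Suc)
        have "(regs t)(14 := T l) = regs t" using r(2) by (metis fun_upd_triv)
        then have "(regs t)(12 := Suc l, 13 := off (Suc l), 14 := T l, 15 := Suc (l mod L)) =
           (regs t)(12 := Suc l, 13 := off (Suc l), 15 := Suc (l mod L))" using r(2)
          by (auto simp: fun_eq_iff)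
        then show "regs ?t = (regs t)(12 := Suc l, 13 := off (Suc l), 14 := T (Suc l), 15 := Suc l mod L)"
          unfolding * by (simp add: a_def fun_upd_twist)
      qed (simp_all add: a_def)
      moreover have "Suc K - regs ?t 12 < Suc K - regs t 12" using lK by (simp add: a_def l_def[symmetric])
      ultimately show ?thesis by blast
    qed
  qed
  then obtain s' where s': "exec M (While ?b table_body) s = return_spmf (tick (bcost ?b) s')" "I s'" "\<not> bval M s' ?b"
    by blast
  have "regs s' 11 = K" using s'(2) assms by (simp add: I_def)
  then have "regs s' 12 = Suc K" using s'(2,3) KM by (simp add: I_def)
  then show ?thesis
    using s'(1,2) by (intro exI[of _ "tick (bcost ?b) s'"]) (simp add: table_loop_def I_def less_Suc_eq_le)
qed

lemma exec_color:
  assumes "regs s 3 = n" "regs s 12 = 0"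
  shows "\<exists>s'. exec M color_loop s = return_spmf s' \<and>
    (\<forall>r. r \<noteq> 12 \<longrightarrow> regs s' r = regs s r) \<and> (\<forall>a. a \<noteq> 0 \<longrightarrow> arrays s' a = arrays s a) \<and>
    (\<forall>v<n. arrays s' 0 v = 1) \<and> time s' \<le> time s + 20 * n + 20"
proof -
  define I where "I = (\<lambda>t :: state. regs t 12 \<le> n \<and>
    (\<forall>r. r \<noteq> 12 \<longrightarrow> regs t r = regs s r) \<and> (\<forall>a. a \<noteq> 0 \<longrightarrow> arrays t a = arrays s a) \<and>
    (\<forall>v<regs t 12. arrays t 0 v = 1) \<and> time t \<le> time s + 20 * regs t 12)"
  let ?b = "Less (Reg 12) (Reg 3)"
  let ?body = "Seq (Store 0 (Reg 12) (Const 1)) (Assign 12 (Plus (Reg 12) (Const 1)))"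
  have "\<exists>s'. exec M (While ?b ?body) s = return_spmf (tick (bcost ?b) s') \<and> I s' \<and> \<not> bval M s' ?b"
  proof (rule exec_while_det[where I = I and m = "\<lambda>t. n - regs t 12"])
    show "I s" using assms by (simp add: I_def)
    fix t assume I: "I t" and b: "bval M t ?b"
    define i where "i = regs t 12"
    have r: "regs t 3 = n" using I assms by (simp add: I_def)
    have i: "i < n" using b r by (simp add: i_def)
    have iM: "Suc i mod M = Suc i" using i n_less_N N3_less_M(3) by simp
    let ?t = "tick 10 (set_reg 12 (Suc i) (set_cell 0 i 1 t))"
    have "exec M ?body (tick (bcost ?b) t) = return_spmf ?t"
      using r iM by (simp add: i_def[symmetric])
    moreover have "I ?t" using I i unfolding I_def by (simp add: i_def[symmetric] less_Suc_eq)
    moreover have "n - regs ?t 12 < n - regs t 12" using i by (simp add: i_def[symmetric])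
    ultimately show "\<exists>s'. exec M ?body (tick (bcost ?b) t) = return_spmf s' \<and> I s' \<and> n - regs s' 12 < n - regs t 12"
      by blast
  qed
  then obtain s' where s': "exec M (While ?b ?body) s = return_spmf (tick (bcost ?b) s')" "I s'" "\<not> bval M s' ?b"
    by blast
  have "regs s' 3 = n" using s'(2) assms by (simp add: I_def)
  then have "regs s' 12 = n" using s'(2,3) by (simp add: I_def)
  then show ?thesis
    using s'(1,2) by (intro exI[of _ "tick (bcost ?b) s'"]) (simp add: color_loop_def I_def)
qed

lemma exec_init:
  "\<exists>s. exec M init_com (start_state n) = return_spmf s \<and> skel {} (\<lambda>_. 0) {} s \<and>
     cinv {} (\<lambda>_. 0) {} {} s \<and> time s \<le> 20 * n + 20 * L + 100 * K + 300"
proof -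
  let ?s = "start_state n"
  have s: "regs ?s = (\<lambda>_. 0)(0 := n)" "arrays ?s = (\<lambda>_ _. 0)" "time ?s = 0" by (simp_all add: start_state_def)
  have NM: "Suc n * Suc n mod M = N" "Suc n mod M = Suc n"
  proof -
    have "N < N ^ 3"
      using power_strict_increasing[of 1 3 N] n_less_N n2 by simp
    then have "N < M" using N3_less_M(1) by simp
    moreover have "N = Suc n * Suc n" by (simp add: N_def power2_eq_square)
    ultimately show "Suc n * Suc n mod M = N" by simp
    show "Suc n mod M = Suc n" using \<open>N < M\<close> n_less_N by simp
  qed
  define s1 where "s1 = tick 12 (set_reg 10 1 (set_reg 4 N (set_reg 6 (Suc n) (set_reg 3 n ?s))))"
  have e1: "exec M (Assign 3 (Reg 0)) ?s = return_spmf (tick 2 (set_reg 3 n ?s))"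
    "exec M (Assign 6 (Plus (Reg 0) (Const 1))) (tick 2 (set_reg 3 n ?s)) =
        return_spmf (tick 6 (set_reg 6 (Suc n) (set_reg 3 n ?s)))"
    "exec M (Assign 4 (Times (Reg 6) (Reg 6))) (tick 6 (set_reg 6 (Suc n) (set_reg 3 n ?s))) =
        return_spmf (tick 10 (set_reg 4 N (set_reg 6 (Suc n) (set_reg 3 n ?s))))"
    "exec M (Assign 10 (Const 1)) (tick 10 (set_reg 4 N (set_reg 6 (Suc n) (set_reg 3 n ?s)))) = return_spmf s1"
    using s NM by (simp_all add: s1_def numeral_2_eq_2 del: mult_Suc mult_Suc_right)
  have r1: "regs s1 3 = n" "regs s1 10 = 1" "regs s1 5 = 0" by (simp_all add: s1_def s)
  obtain s2 where s2: "exec M size_loop s1 = return_spmf s2" "regs s2 5 = L"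
    "\<forall>r. r \<noteq> 5 \<and> r \<noteq> 10 \<longrightarrow> regs s2 r = regs s1 r" "arrays s2 = arrays s1" "time s2 \<le> time s1 + 20 * L + 20"
    using exec_size[OF r1] by blast
  have r2: "regs s2 3 = n" "regs s2 4 = N" "regs s2 6 = Suc n" "regs s2 7 = 0" "regs s2 13 = 0" "regs s2 15 = 0"
    using s2(3) by (simp_all add: s1_def s)
  have KM: "L * L mod M = K" using K_less_N N3_less_M(3) by (simp add: K_def)
  define s3 where "s3 = tick 8 (set_reg 14 1 (set_reg 12 0 (set_reg 11 K s2)))"
  have e3: "exec M (Assign 11 (Times (Reg 5) (Reg 5))) s2 = return_spmf (tick 4 (set_reg 11 K s2))"
    "exec M (Assign 12 (Const 0)) (tick 4 (set_reg 11 K s2)) = return_spmf (tick 6 (set_reg 12 0 (set_reg 11 K s2)))"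
    "exec M (Assign 14 (Const 1)) (tick 6 (set_reg 12 0 (set_reg 11 K s2))) = return_spmf s3"
    using s2(2) KM by (simp_all add: s3_def)
  have r3: "regs s3 5 = L" "regs s3 11 = K" "regs s3 12 = 0" "regs s3 13 = 0" "regs s3 14 = 1" "regs s3 15 = 0"
    using s2(2) r2 by (simp_all add: s3_def)
  obtain s4 where s4: "exec M table_loop s3 = return_spmf s4"
    "\<forall>r. r \<notin> {12, 13, 14, 15} \<longrightarrow> regs s4 r = regs s3 r" "\<forall>a. a \<notin> {5, 6} \<longrightarrow> arrays s4 a = arrays s3 a"
    "\<forall>l\<le>K. arrays s4 5 l = T l \<and> arrays s4 6 l = off l" "time s4 \<le> time s3 + 100 * Suc K + 20"
    using exec_table[OF r3] by blast
  define s5 where "s5 = tick 2 (set_reg 12 0 s4)"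
  have e5: "exec M (Assign 12 (Const 0)) s4 = return_spmf s5" by (simp add: s5_def numeral_2_eq_2)
  have r5: "regs s5 3 = n" "regs s5 12 = 0" using s4(2) r2 by (simp_all add: s5_def s3_def)
  obtain s6 where s6: "exec M color_loop s5 = return_spmf s6" "\<forall>r. r \<noteq> 12 \<longrightarrow> regs s6 r = regs s5 r"
    "\<forall>a. a \<noteq> 0 \<longrightarrow> arrays s6 a = arrays s5 a" "\<forall>v<n. arrays s6 0 v = 1" "time s6 \<le> time s5 + 20 * n + 20"
    using exec_color[OF r5] by blast
  have ex: "exec M init_com ?s = return_spmf s6"
    by (simp only: init_com_def exec.simps(5) e1 s2(1) e3 s4(1) e5 s6(1) return_bind_spmf)
  have a6: "arrays s6 a = (\<lambda>_. 0)" if "a \<in> {1, 2, 3, 4}" for a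
    using that s6(3) s4(3) s2(4) by (auto simp: s5_def s3_def s1_def s)
  have st: "static s6"
    using s6(2,3) s4(2,4) r2 unfolding static_def by (simp add: s5_def s3_def)
  have "rep n N (\<lambda>_. 0) (\<lambda>_. 0) (\<lambda>_. 0) (lbook {} (\<lambda>_. 0) {} {})"
    unfolding rep_def by (simp add: book_def)
  then have rp: "repS s6 (lbook {} (\<lambda>_. 0) {} {})" using a6 by (simp add: repS_def)
  have "skel {} (\<lambda>_. 0) {} s6"
    unfolding skel_def using st rp a6[of 1] by (simp add: graph_on_def stable_def deg_def)
  \<comment> \<open>All vertices start on level 0 with palette \<open>{1..<5}\<close>, which
    contains the initial color 1.\<close>
  moreover have "cinv {} (\<lambda>_. 0) {} {} s6"
    unfolding cinv_def using s6(4) by (simp add: palette_def off_def T_def)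
  moreover have "time s6 \<le> 20 * n + 20 * L + 100 * K + 300"
    using s6(5) s4(5) s2(5) by (simp add: s5_def s3_def s1_def s)
  ultimately show ?thesis using ex by blast
qed

end

section \<open>Processing an update sequence\<close>

definition level_com :: com where
  "level_com = Seq edge_com settle_com"

definition update_com :: com where
  "update_com = Seq level_com (Seq recolor_all_com refresh_com)"

text \<open>This storage is the scope of \<open>level_com\<close>, and
  \<open>recolor_all_com\<close> and \<open>refresh_com\<close> write to none of it. Agreement on it
  expresses that the levels are independent of the random choices.\<close>

definition low_eq :: "state \<Rightarrow> state \<Rightarrow> bool" where
  "low_eq s t \<longleftrightarrow> (\<forall>r\<in>{..<20}. regs s r = regs t r) \<and> (\<forall>a\<in>{1, 2, 3, 4, 5, 6, 9}. arrays s a = arrays t a)"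

lemma level_com_scope:
  "used_regs level_com \<subseteq> {..<20}" "used_arrays level_com \<subseteq> {1, 2, 3, 4, 5, 6, 9}"
  "written_regs level_com \<subseteq> {10..<20}" "written_arrays level_com \<subseteq> {1, 2, 3, 4, 9}"
  by (simp_all add: level_com_def edge_com_def settle_com_def settle_body_def move_com_def copy_com_def
      relocate_body_def add_com_def remove_com_def insert_com_def Let_def cnt_e_def pos_e_def slot_e_def row_e_def)

lemma color_com_scope:
  "written_regs recolor_all_com \<subseteq> {20..}" "written_arrays recolor_all_com \<subseteq> {0, 7, 8}"
  "written_regs refresh_com \<subseteq> {20..}" "written_arrays refresh_com \<subseteq> {0, 7, 8}"
  by (simp_all add: recolor_all_com_def recolor_all_body_def refresh_com_def recolor_com_def gather_com_def
      unmark_loop_def mark_loop_def list_loop_def)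

lemma low_eq_color:
  assumes "s' \<in> set_spmf (exec M c s)" "written_regs c \<subseteq> {20..}" "written_arrays c \<subseteq> {0, 7, 8}"
  shows "low_eq s' s"
proof -
  have "regs s' r = regs s r" if "r \<in> {..<20}" for r
  proof -
    have "r \<notin> written_regs c" using that assms(2) by auto
    then show ?thesis using exec_frame[OF assms(1)] by blast
  qed
  moreover have "arrays s' a = arrays s a" if "a \<in> {1, 2, 3, 4, 5, 6, 9}" for a
  proof -
    have "a \<notin> {0, 7, 8}" using that by auto
    then show ?thesis using exec_frame[OF assms(1)] assms(3) by blast
  qed
  ultimately show ?thesis unfolding low_eq_def by blast
qed

lemma low_eq_trans: "low_eq s t \<Longrightarrow> low_eq t w \<Longrightarrow> low_eq s w"
  unfolding low_eq_def by simp

lemma low_eq_sym: "low_eq s t \<Longrightarrow> low_eq t s"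
  unfolding low_eq_def by simp

lemma load_frame:
  "arrays (load_update x s) = arrays s" "time (load_update x s) = time s"
  "r \<notin> {0, 1, 2} \<Longrightarrow> regs (load_update x s) r = regs s r"
  "low_eq s t \<Longrightarrow> low_eq (load_update x s) (load_update x t)"
  by (cases x; simp add: low_eq_def)+

lemma load_update_cases:
  assumes "valid_update n E x" "graph_on n E"
  obtains u v where "u < n" "v < n" "u \<noteq> v"
    "\<And>s. regs (load_update x s) 1 = u" "\<And>s. regs (load_update x s) 2 = v"
    "\<And>s. regs (load_update x s) 0 = 1 \<and> {u, v} \<notin> E \<and> apply_update x E = insert {u, v} E \<or>
        regs (load_update x s) 0 = 0 \<and> {u, v} \<in> E \<and> apply_update x E = E - {{u, v}}"
proof (cases x)
  case (Insert u v)
  then show ?thesis using assms that[of u v] by simp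
next
  case (Delete u v)
  moreover have "u \<noteq> v" using assms Delete graph_onD[of n E u v] by simp
  ultimately show ?thesis using assms that[of u v] by simp
qed

context level_params
begin

text \<open>A single \<open>lev\<close> and a single \<open>F\<close> serve all outcomes in the
  support. This allows the pair bounds to be plain expectations over \<open>p\<close> with a fixed
  threshold, and the potential to be a number outside of the integral. Pairs on different levels
  need no bound, their palettes being disjoint.\<close>

definition run_inv :: "state spmf \<Rightarrow> nat set set \<Rightarrow> (nat \<Rightarrow> nat) \<Rightarrow> nat set \<Rightarrow> real \<Rightarrow> bool" where
  "run_inv p E lev F c \<longleftrightarrow> lossless_spmf p \<and>
     (\<forall>s\<in>set_spmf p. skel E lev F s \<and> cinv E lev {} {} s) \<and>
     (\<forall>s\<in>set_spmf p. \<forall>t\<in>set_spmf p. low_eq s t) \<and>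
     (\<forall>x y. x < n \<longrightarrow> y < n \<longrightarrow> x \<noteq> y \<longrightarrow> lev x = lev y \<longrightarrow>
        (\<integral>\<^sup>+ s. eqc x y s \<partial>measure_spmf p) \<le> ennreal (2 / real (T (lev x)))) \<and>
     (\<integral>\<^sup>+ s. ennreal (real (time s)) \<partial>measure_spmf p) + ennreal (real (pot E lev {} {})) \<le> ennreal c"

text \<open>The flags are obtained separately for each outcome; they coincide because the stored
  arrays determine them.\<close>

lemma repS_F_unique:
  assumes "repS s (lbook E lev {} F)" "repS s (lbook E lev' {} F')"
  shows "F = F'"
proof -
  have bkF: "{w. lbook E lev {} F (n + 1) w = Some 0} = F" for F lev by (auto simp: book_def)
  have "bij_betw (\<lambda>i. arrays s 3 (ix N (ix N (n + 1) 0) i)) {..<arrays s 2 (ix N (n + 1) 0)} F"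
    using rep_bij[OF assms(1)[unfolded repS_def] n_less_N(2) N_pos] unfolding bkF .
  moreover have "bij_betw (\<lambda>i. arrays s 3 (ix N (ix N (n + 1) 0) i)) {..<arrays s 2 (ix N (n + 1) 0)} F'"
    using rep_bij[OF assms(2)[unfolded repS_def] n_less_N(2) N_pos] unfolding bkF .
  ultimately show ?thesis unfolding bij_betw_def by blast
qed

text \<open>This phase leaves the colors alone. Afterwards they can be wrong only at flagged
  vertices, whose palette may have changed, and on the updated edge; these are the two exemptions of
  \<open>cinv\<close>.\<close>

lemma level_phase:
  assumes sk: "skel E lev F s" and ci: "cinv E lev {} {} s" and x: "valid_update n E x"
    and uv: "u < n" "v < n" "u \<noteq> v" "regs (load_update x s) 1 = u" "regs (load_update x s) 2 = v"
      "regs (load_update x s) 0 = 1 \<and> {u, v} \<notin> E \<and> apply_update x E = insert {u, v} E \<or>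
        regs (load_update x s) 0 = 0 \<and> {u, v} \<in> E \<and> apply_update x E = E - {{u, v}}"
  shows "\<exists>s1 F1. exec M level_com (load_update x s) = return_spmf s1 \<and>
     skel (apply_update x E) (arrays s1 1) F1 s1 \<and> cinv (apply_update x E) (arrays s1 1) {u, v} F1 s1 \<and>
     arrays s1 0 = arrays s 0 \<and> regs s1 1 = u \<and> regs s1 2 = v \<and>
     (\<forall>w<n. w \<notin> F1 \<longrightarrow> arrays s1 1 w = lev w) \<and>
     time s1 + pot (apply_update x E) (arrays s1 1) {} F1 \<le> time s + pot E lev {} {} + 200000 * K"
proof -
  let ?s = "load_update x s" and ?E = "apply_update x E"
  have sk': "skel E lev F ?s"
    by (rule skel_cong[OF sk]) (use load_frame in auto)
  have st: "static ?s" "repS ?s (lbook E lev {} F)" "arrays ?s 1 = lev" "\<forall>v<n. lev v \<le> K" "graph_on n E"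
    "\<forall>v<n. stable E lev v"
    using sk' unfolding skel_def by blast+
  obtain s1 F1 where s1: "exec M (Seq edge_com settle_com) ?s = return_spmf s1" "static s1" "F1 \<subseteq> {..<n}"
    "repS s1 (lbook ?E (arrays s1 1) {} F1)" "\<forall>v<n. arrays s1 1 v \<le> K \<and> stable ?E (arrays s1 1) v"
    "\<forall>v<n. v \<notin> F1 \<longrightarrow> arrays s1 1 v = lev v"
    "time s1 + pot ?E (arrays s1 1) {} F1 \<le> time ?s + pot E lev {} {} + 200000 * K"
    using exec_level_update[OF st(1-5) uv(4,5,1-3,6) st(6)] by blast
  have E': "graph_on n ?E"
    using st(5) uv unfolding graph_on_def by blast
  have in1: "s1 \<in> set_spmf (exec M level_com ?s)" using s1(1) by (simp add: level_com_def)
  have "0 \<notin> written_arrays level_com" "1 \<notin> written_regs level_com" "2 \<notin> written_regs level_com"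
    using level_com_scope(3,4) by auto
  then have fr: "arrays s1 0 = arrays ?s 0" "regs s1 1 = u" "regs s1 2 = v"
    using exec_frame[OF in1] uv by simp_all
  have col: "arrays s1 0 = arrays s 0" using fr load_frame by simp
  have "skel ?E (arrays s1 1) F1 s1" unfolding skel_def using s1 E' by blast
  moreover have "cinv ?E (arrays s1 1) {u, v} F1 s1"
  proof -
    have "arrays s1 0 w \<in> palette (arrays s1 1 w)" if "w < n" "w \<notin> F1" for w
      using ci that s1(6) unfolding cinv_def col by simp
    moreover have "arrays s1 0 x' \<noteq> arrays s1 0 y" if "{x', y} \<in> ?E" "{x', y} \<noteq> {u, v}" for x' y
    proof -
      have "?E = insert {u, v} E \<or> ?E = E - {{u, v}}" using uv(6) by metis
      then have "{x', y} \<in> E" using that by (elim disjE) simp_all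
      then show ?thesis using ci unfolding cinv_def col by blast
    qed
    ultimately show ?thesis unfolding cinv_def by blast
  qed
  moreover have "exec M level_com ?s = return_spmf s1" using s1(1) by (simp add: level_com_def)
  moreover have "time s1 + pot ?E (arrays s1 1) {} F1 \<le> time s + pot E lev {} {} + 200000 * K"
    using s1(7) load_frame(2) by simp
  ultimately show ?thesis using col fr(2,3) s1(6) by blast
qed

text \<open>The distribution \<open>q\<close>, after recoloring the flagged vertices and before the
  refresh, separates two effects: a change of level brings a fresh color with collision probability
  at most \<open>1 / T\<close>, and only the refresh has to cope with recolorings that depend on the
  colors.\<close>

lemma run_inv_step:
  assumes inv: "run_inv p E lev F c" and c: "0 \<le> c" and x: "valid_update n E x"
  shows "\<exists>lev' F'. run_inv (bind_spmf p (\<lambda>s. exec M update_com (load_update x s)))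
    (apply_update x E) lev' F' (c + 300000 * real K)"
proof -
  let ?E = "apply_update x E"
  have ll: "lossless_spmf p" and sk: "\<And>s. s \<in> set_spmf p \<Longrightarrow> skel E lev F s"
    and ci: "\<And>s. s \<in> set_spmf p \<Longrightarrow> cinv E lev {} {} s"
    and low: "\<And>s t. s \<in> set_spmf p \<Longrightarrow> t \<in> set_spmf p \<Longrightarrow> low_eq s t"
    and pair: "\<And>x y. x < n \<Longrightarrow> y < n \<Longrightarrow> x \<noteq> y \<Longrightarrow> lev x = lev y \<Longrightarrow>
        (\<integral>\<^sup>+ s. eqc x y s \<partial>measure_spmf p) \<le> ennreal (2 / real (T (lev x)))"
    and time: "(\<integral>\<^sup>+ s. ennreal (real (time s)) \<partial>measure_spmf p) + ennreal (real (pot E lev {} {})) \<le> ennreal c"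
    using inv unfolding run_inv_def by blast+
  have "set_spmf p \<noteq> {}"
  proof
    assume "set_spmf p = {}"
    then have "(\<integral>\<^sup>+ s. 1 \<partial>measure_spmf p) \<le> 0" by (intro nn_integral_spmf_le) simp
    then show False using nn_integral_lossless_const[OF ll, of 1] by simp
  qed
  then obtain s0 where s0: "s0 \<in> set_spmf p" by blast
  have E: "graph_on n E" using sk[OF s0] unfolding skel_def by blast
  obtain u v where uv: "u < n" "v < n" "u \<noteq> v"
    "\<And>s. regs (load_update x s) 1 = u" "\<And>s. regs (load_update x s) 2 = v"
    "\<And>s. regs (load_update x s) 0 = 1 \<and> {u, v} \<notin> E \<and> apply_update x E = insert {u, v} E \<or>
        regs (load_update x s) 0 = 0 \<and> {u, v} \<in> E \<and> apply_update x E = E - {{u, v}}"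
    using load_update_cases[OF x E] by blast
  have "\<forall>s\<in>set_spmf p. \<exists>s1. \<exists>F1. exec M level_com (load_update x s) = return_spmf s1 \<and>
     skel ?E (arrays s1 1) F1 s1 \<and> cinv ?E (arrays s1 1) {u, v} F1 s1 \<and>
     arrays s1 0 = arrays s 0 \<and> regs s1 1 = u \<and> regs s1 2 = v \<and>
     (\<forall>w<n. w \<notin> F1 \<longrightarrow> arrays s1 1 w = lev w) \<and>
     time s1 + pot ?E (arrays s1 1) {} F1 \<le> time s + pot E lev {} {} + 200000 * K"
    using level_phase[OF sk ci x uv(1-3) uv(4-6)] by blast
  then obtain a where a: "\<forall>s\<in>set_spmf p. \<exists>F1. exec M level_com (load_update x s) = return_spmf (a s) \<and>
     skel ?E (arrays (a s) 1) F1 (a s) \<and> cinv ?E (arrays (a s) 1) {u, v} F1 (a s) \<and>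
     arrays (a s) 0 = arrays s 0 \<and> regs (a s) 1 = u \<and> regs (a s) 2 = v \<and>
     (\<forall>w<n. w \<notin> F1 \<longrightarrow> arrays (a s) 1 w = lev w) \<and>
     time (a s) + pot ?E (arrays (a s) 1) {} F1 \<le> time s + pot E lev {} {} + 200000 * K"
    by (rule bchoice[THEN exE])
  then obtain Fa where Fa: "\<forall>s\<in>set_spmf p. exec M level_com (load_update x s) = return_spmf (a s) \<and>
     skel ?E (arrays (a s) 1) (Fa s) (a s) \<and> cinv ?E (arrays (a s) 1) {u, v} (Fa s) (a s) \<and>
     arrays (a s) 0 = arrays s 0 \<and> regs (a s) 1 = u \<and> regs (a s) 2 = v \<and>
     (\<forall>w<n. w \<notin> Fa s \<longrightarrow> arrays (a s) 1 w = lev w) \<and>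
     time (a s) + pot ?E (arrays (a s) 1) {} (Fa s) \<le> time s + pot E lev {} {} + 200000 * K"
    by (rule bchoice[THEN exE])
  \<comment> \<open>One outcome \<open>s0\<close> represents all: by noninterference its levels and
    flags are those of every other outcome.\<close>
  define lev' F' where "lev' = arrays (a s0) 1" and "F' = Fa s0"
  have lowa: "low_eq (a s) (a s0)" if s: "s \<in> set_spmf p" for s
  proof -
    have e: "exec M level_com (load_update x s) = return_spmf (a s)" "exec M level_com (load_update x s0) = return_spmf (a s0)"
      using Fa s s0 by blast+
    have "low_eq (load_update x s) (load_update x s0)" by (rule load_frame(4)[OF low[OF s s0]])
    then show ?thesis
      using exec_low_determined[OF level_com_scope(1,2) e] unfolding low_eq_def by blast
  qed
  have A: "exec M level_com (load_update x s) = return_spmf (a s)" "skel ?E lev' F' (a s)"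
     "cinv ?E lev' {u, v} F' (a s)" "arrays (a s) 0 = arrays s 0" "regs (a s) 1 = u" "regs (a s) 2 = v"
     "\<forall>w<n. w \<notin> F' \<longrightarrow> lev' w = lev w"
     "time (a s) + pot ?E lev' {} F' \<le> time s + pot E lev {} {} + 200000 * K"
    if s: "s \<in> set_spmf p" for s
  proof -
    have f: "exec M level_com (load_update x s) = return_spmf (a s)" "skel ?E (arrays (a s) 1) (Fa s) (a s)"
      "cinv ?E (arrays (a s) 1) {u, v} (Fa s) (a s)"
      "arrays (a s) 0 = arrays s 0" "regs (a s) 1 = u" "regs (a s) 2 = v"
      "\<forall>w<n. w \<notin> Fa s \<longrightarrow> arrays (a s) 1 w = lev w"
      "time (a s) + pot ?E (arrays (a s) 1) {} (Fa s) \<le> time s + pot E lev {} {} + 200000 * K"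
      using Fa s by blast+
    have l: "arrays (a s) 1 = lev'" using lowa[OF s] by (simp add: low_eq_def lev'_def)
    have "repS (a s0) (lbook ?E lev' {} F')" using Fa s0 unfolding lev'_def F'_def skel_def by blast
    then have "repS (a s) (lbook ?E lev' {} F')" using lowa[OF s] by (simp add: repS_def low_eq_def)
    moreover have "repS (a s) (lbook ?E lev' {} (Fa s))" using f(2) unfolding l skel_def by blast
    ultimately have F: "Fa s = F'" by (rule repS_F_unique[symmetric])
    show "exec M level_com (load_update x s) = return_spmf (a s)" "skel ?E lev' F' (a s)"
     "cinv ?E lev' {u, v} F' (a s)" "arrays (a s) 0 = arrays s 0" "regs (a s) 1 = u" "regs (a s) 2 = v"
     "\<forall>w<n. w \<notin> F' \<longrightarrow> lev' w = lev w"
     "time (a s) + pot ?E lev' {} F' \<le> time s + pot E lev {} {} + 200000 * K"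
      using f unfolding l F .
  qed
  define q where "q = bind_spmf p (\<lambda>s. exec M recolor_all_com (a s))"
  note rc = recolor_all_facts[OF A(2) A(3)]
  have final: "bind_spmf p (\<lambda>s. exec M update_com (load_update x s)) = bind_spmf q (exec M refresh_com)"
    unfolding q_def bind_spmf_assoc
  proof (rule bind_spmf_cong[OF refl])
    fix s assume "s \<in> set_spmf p"
    then show "exec M update_com (load_update x s) = bind_spmf (exec M recolor_all_com (a s)) (exec M refresh_com)"
      using A(1)[of s] by (simp add: update_com_def)
  qed
  have q_in: "\<exists>s\<in>set_spmf p. s2 \<in> set_spmf (exec M recolor_all_com (a s))" if "s2 \<in> set_spmf q" for s2
    using that unfolding q_def by (auto simp: set_bind_spmf)
  have qsk: "skel ?E lev' F' s2" "cinv ?E lev' {u, v} {} s2" "regs s2 1 = u" "regs s2 2 = v" "low_eq s2 (a s0)"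
    if s2: "s2 \<in> set_spmf q" for s2
  proof -
    obtain s where s: "s \<in> set_spmf p" "s2 \<in> set_spmf (exec M recolor_all_com (a s))" using q_in[OF s2] by blast
    show "skel ?E lev' F' s2" "cinv ?E lev' {u, v} {} s2" using rc(2)[OF s(1) s(1) s(2)] by blast+
    have "\<forall>r<20. regs s2 r = regs (a s) r" using rc(2)[OF s(1) s(1) s(2)] by blast
    then show "regs s2 1 = u" "regs s2 2 = v" using A(5,6)[OF s(1)] by simp_all
    have "low_eq s2 (a s)" by (rule low_eq_color[OF s(2) color_com_scope(1,2)])
    then show "low_eq s2 (a s0)" using lowa[OF s(1)] by (rule low_eq_trans)
  qed
  have qll: "lossless_spmf q" unfolding q_def using ll rc(1) by simp
  have qpair: "(\<integral>\<^sup>+ s. eqc y z s \<partial>measure_spmf q) \<le> ennreal (2 / real (T (lev' y)))"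
    if yz: "y < n" "z < n" "y \<noteq> z" "lev' y = lev' z" for y z
  proof -
    have int: "(\<integral>\<^sup>+ s. eqc y z s \<partial>measure_spmf q) =
       (\<integral>\<^sup>+ s. (\<integral>\<^sup>+ s2. eqc y z s2 \<partial>measure_spmf (exec M recolor_all_com (a s))) \<partial>measure_spmf p)"
      unfolding q_def by (rule nn_integral_measure_spmf_bind)
    show ?thesis
    proof (cases "y \<in> F' \<or> z \<in> F'")
      case True
      have "(\<integral>\<^sup>+ s. eqc y z s \<partial>measure_spmf q) \<le> ennreal (1 / real (T (lev' y)))"
        unfolding int
      proof (rule nn_integral_spmf_le)
        fix s assume s: "s \<in> set_spmf p"
        show "(\<integral>\<^sup>+ s2. eqc y z s2 \<partial>measure_spmf (exec M recolor_all_com (a s))) \<le> ennreal (1 / real (T (lev' y)))"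
          using rc(3)[OF s s yz] True by simp
      qed
      also have "\<dots> \<le> ennreal (2 / real (T (lev' y)))" by (intro ennreal_leI divide_right_mono) simp_all
      finally show ?thesis .
    next
      case False
      have "(\<integral>\<^sup>+ s. eqc y z s \<partial>measure_spmf q) \<le> (\<integral>\<^sup>+ s. eqc y z s \<partial>measure_spmf p)"
        unfolding int
      proof (rule nn_integral_spmf_mono)
        fix s assume s: "s \<in> set_spmf p"
        have "eqc y z (a s) = eqc y z s" using A(4)[OF s] by (simp add: eqc_def)
        then show "(\<integral>\<^sup>+ s2. eqc y z s2 \<partial>measure_spmf (exec M recolor_all_com (a s))) \<le> eqc y z s"
          using rc(3)[OF s s yz] False by simp
      qed
      \<comment> \<open>Unflagged vertices have the same level as before, so the old bound refers to
        the same threshold.\<close>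
      moreover have "lev' y = lev y" "lev' z = lev z" using A(7)[OF s0] False yz by blast+
      ultimately show ?thesis using pair[of y z] yz by (simp add: order.trans)
    qed
  qed
  \<comment> \<open>The pair bound holds for all pairs on a level, adjacent or not. It therefore
    applies to the ends of an edge that was fixed before the random choices; ends on different
    levels cannot conflict at all.\<close>
  have qconf: "(\<integral>\<^sup>+ s. eqc u v s \<partial>measure_spmf q) \<le> ennreal (2 / real (T (lev' u)))"
  proof (cases "lev' u = lev' v")
    case True
    then show ?thesis using qpair uv by blast
  next
    case False
    have "eqc u v s2 = 0" if "s2 \<in> set_spmf q" for s2
    proof -
      have "arrays s2 0 u \<in> palette (lev' u)" "arrays s2 0 v \<in> palette (lev' v)"
        using qsk(2)[OF that] uv unfolding cinv_def by blast+
      then have "arrays s2 0 u \<noteq> arrays s2 0 v" using palette_disjoint[OF False] by auto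
      then show ?thesis by (simp add: eqc_def ind_def)
    qed
    then show ?thesis by (intro nn_integral_spmf_le) simp
  qed
  have qtime: "(\<integral>\<^sup>+ s. ennreal (real (time s)) \<partial>measure_spmf q) + ennreal (real (pot ?E lev' {} {}))
      \<le> ennreal (c + 200000 * real K + 10)"
  proof -
    \<comment> \<open>The potential of the flags pays for the recoloring of \<open>F'\<close>: 2000
      per unit of threshold is released and at most 1000 is spent.\<close>
    have potF: "pot ?E lev' {} F' = pot ?E lev' {} {} + 2000 * (\<Sum>v\<in>F'. T (lev' v))" by (simp add: pot_def)
    let ?d = "real (pot E lev {} {}) + 200000 * real K + 10 - real (pot ?E lev' {} {})"
    have bound: "real (time s2) + real (pot ?E lev' {} {}) \<le> real (time s) + real (pot E lev {} {}) + 200000 * real K + 10"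
      if s: "s \<in> set_spmf p" and s2: "s2 \<in> set_spmf (exec M recolor_all_com (a s))" for s s2
    proof -
      have "time s2 \<le> time (a s) + 1000 * (\<Sum>v\<in>F'. T (lev' v)) + 10" using rc(2)[OF s s s2] by blast
      then have "time s2 + pot ?E lev' {} {} \<le> time s + pot E lev {} {} + 200000 * K + 10"
        using A(8)[OF s] unfolding potF by linarith
      then have "real (time s2 + pot ?E lev' {} {}) \<le> real (time s + pot E lev {} {} + 200000 * K + 10)"
        by (rule of_nat_mono)
      then show ?thesis by simp
    qed
    have w: "(\<integral>\<^sup>+ s. k \<partial>measure_spmf q) = k" "(\<integral>\<^sup>+ s. k \<partial>measure_spmf p) = k" for k
      by (rule nn_integral_lossless_const[OF qll], rule nn_integral_lossless_const[OF ll])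
    have "(\<integral>\<^sup>+ s. ennreal (real (time s)) \<partial>measure_spmf q) + ennreal (real (pot ?E lev' {} {})) =
       (\<integral>\<^sup>+ s. ennreal (real (time s)) + ennreal (real (pot ?E lev' {} {})) \<partial>measure_spmf q)"
      by (subst nn_integral_add) (simp_all only: w, simp_all)
    also have "\<dots> = (\<integral>\<^sup>+ s. (\<integral>\<^sup>+ s2. ennreal (real (time s2)) + ennreal (real (pot ?E lev' {} {}))
        \<partial>measure_spmf (exec M recolor_all_com (a s))) \<partial>measure_spmf p)"
      unfolding q_def by (rule nn_integral_measure_spmf_bind)
    also have "\<dots> \<le> (\<integral>\<^sup>+ s. ennreal (real (time s)) + ennreal (real (pot E lev {} {}) + 200000 * real K + 10) \<partial>measure_spmf p)"
    proof (rule nn_integral_spmf_mono)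
      fix s assume s: "s \<in> set_spmf p"
      show "(\<integral>\<^sup>+ s2. ennreal (real (time s2)) + ennreal (real (pot ?E lev' {} {}))
        \<partial>measure_spmf (exec M recolor_all_com (a s))) \<le> ennreal (real (time s)) + ennreal (real (pot E lev {} {}) + 200000 * real K + 10)"
      proof (rule nn_integral_spmf_le)
        fix s2 assume "s2 \<in> set_spmf (exec M recolor_all_com (a s))"
        from bound[OF s this]
        have "ennreal (real (time s2) + real (pot ?E lev' {} {})) \<le> ennreal (real (time s) + (real (pot E lev {} {}) + 200000 * real K + 10))"
          by (intro ennreal_leI) simp
        then show "ennreal (real (time s2)) + ennreal (real (pot ?E lev' {} {})) \<le>
           ennreal (real (time s)) + ennreal (real (pot E lev {} {}) + 200000 * real K + 10)"
          by (simp add: ennreal_plus[symmetric] del: ennreal_plus)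
      qed
    qed
    also have "\<dots> = (\<integral>\<^sup>+ s. ennreal (real (time s)) \<partial>measure_spmf p) + ennreal (real (pot E lev {} {}) + 200000 * real K + 10)"
      by (subst nn_integral_add) (simp_all only: w, simp_all)
    also have "\<dots> = (\<integral>\<^sup>+ s. ennreal (real (time s)) \<partial>measure_spmf p) + ennreal (real (pot E lev {} {})) + ennreal (200000 * real K + 10)"
      by (simp add: ennreal_plus[symmetric] add.assoc del: ennreal_plus)
    also have "\<dots> \<le> ennreal c + ennreal (200000 * real K + 10)" using time by (intro add_right_mono)
    also have "\<dots> = ennreal (c + 200000 * real K + 10)" using c by (simp add: ennreal_plus[symmetric] add.assoc del: ennreal_plus)
    finally show ?thesis .
  qed
  let ?p = "bind_spmf q (exec M refresh_com)"
  note rf = refresh_facts[OF qsk(1,2,3,4) uv(1-3)]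
  have pll: "lossless_spmf ?p" using qll rf(1) by simp
  have p_in: "\<exists>s\<in>set_spmf q. s2 \<in> set_spmf (exec M refresh_com s)" if "s2 \<in> set_spmf ?p" for s2
    using that by (auto simp: set_bind_spmf)
  have psk: "skel ?E lev' F' s3 \<and> cinv ?E lev' {} {} s3 \<and> low_eq s3 (a s0)" if s3: "s3 \<in> set_spmf ?p" for s3
  proof -
    obtain s2 where s2: "s2 \<in> set_spmf q" "s3 \<in> set_spmf (exec M refresh_com s2)" using p_in[OF s3] by blast
    have "low_eq s3 s2" by (rule low_eq_color[OF s2(2) color_com_scope(3,4)])
    then have "low_eq s3 (a s0)" using qsk(5)[OF s2(1)] by (rule low_eq_trans)
    then show ?thesis using rf(2)[OF s2(1) s2(1) s2(1) s2(1) s2(2)] by blast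
  qed
  have plow: "low_eq s t" if "s \<in> set_spmf ?p" "t \<in> set_spmf ?p" for s t
    using psk[OF that(1)] psk[OF that(2)] low_eq_sym low_eq_trans by blast
  have pint: "(\<integral>\<^sup>+ s. g s \<partial>measure_spmf ?p) = (\<integral>\<^sup>+ s2. (\<integral>\<^sup>+ s. g s \<partial>measure_spmf (exec M refresh_com s2)) \<partial>measure_spmf q)" for g
    by (rule nn_integral_measure_spmf_bind)
  have fresh: "(\<integral>\<^sup>+ s. eqc u y s \<partial>measure_spmf ?p) \<le> ennreal (2 / real (T (lev' u)))"
    if y: "y < n" "u \<noteq> y" "lev' u = lev' y" for y
  proof (cases "2 \<le> T (lev' u)")
    \<comment> \<open>For threshold 1 the bound \<open>2 / T\<close> is trivial.\<close>
    case False
    then have "T (lev' u) = 1" using T_pos[of "lev' u"] by linarith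
    moreover have "(\<integral>\<^sup>+ s. eqc u y s \<partial>measure_spmf ?p) \<le> 1"
      by (rule nn_integral_spmf_le) (simp add: eqc_def ind_le_1)
    ultimately show ?thesis by (simp add: order.trans[OF _ numeral_le_iff[THEN iffD2]] order.trans)
  next
    case True
    define t where "t = real (T (lev' u))"
    have t: "2 \<le> t" using True by (simp add: t_def)
    have "(\<integral>\<^sup>+ s. eqc u y s \<partial>measure_spmf ?p) \<le>
       (\<integral>\<^sup>+ s. ennreal (1 - 2 / t) * eqc u y s + ennreal (2 / t\<^sup>2) + ennreal (1 / t) * eqc u v s \<partial>measure_spmf q)"
      unfolding pint
    proof (rule nn_integral_spmf_mono)
      fix s assume s: "s \<in> set_spmf q"
      show "(\<integral>\<^sup>+ s3. eqc u y s3 \<partial>measure_spmf (exec M refresh_com s)) \<le>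
        ennreal (1 - 2 / t) * eqc u y s + ennreal (2 / t\<^sup>2) + ennreal (1 / t) * eqc u v s"
        unfolding t_def by (rule rf(5)[OF s s s s y True])
    qed
    also have "\<dots> = ennreal (1 - 2 / t) * (\<integral>\<^sup>+ s. eqc u y s \<partial>measure_spmf q) + (\<integral>\<^sup>+ s. ennreal (2 / t\<^sup>2) \<partial>measure_spmf q)
        + ennreal (1 / t) * (\<integral>\<^sup>+ s. eqc u v s \<partial>measure_spmf q)"
      by (simp add: nn_integral_add nn_integral_cmult)
    also have "\<dots> \<le> ennreal (1 - 2 / t) * ennreal (2 / t) + ennreal (2 / t\<^sup>2) + ennreal (1 / t) * ennreal (2 / t)"
      using qpair[OF uv(1) y] qconf unfolding t_def
      by (intro add_mono mult_left_mono nn_integral_spmf_const) simp_all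
    also have "\<dots> = ennreal ((1 - 2 / t) * (2 / t) + 2 / t\<^sup>2 + 1 / t * (2 / t))"
    proof -
      have nn: "0 \<le> 1 - 2 / t" "0 \<le> 2 / t" "0 \<le> 1 / t" "0 \<le> 2 / t\<^sup>2" using t by simp_all
      then show ?thesis by (simp only: ennreal_mult ennreal_plus add_nonneg_nonneg mult_nonneg_nonneg)
    qed
    \<comment> \<open>The invariant bound is a fixed point: the refresh removes
      \<open>4 / t\<^sup>2\<close>, while the new color and the conflict contribute
      \<open>2 / t\<^sup>2\<close> each.\<close>
    also have "(1 - 2 / t) * (2 / t) + 2 / t\<^sup>2 + 1 / t * (2 / t) = 2 / t"
      using t by (simp add: field_simps power2_eq_square)
    finally show ?thesis by (simp add: t_def)
  qed
  have ppair: "(\<integral>\<^sup>+ s. eqc y z s \<partial>measure_spmf ?p) \<le> ennreal (2 / real (T (lev' y)))"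
    if yz: "y < n" "z < n" "y \<noteq> z" "lev' y = lev' z" for y z
  proof -
    consider "y = u" | "z = u" | "u \<notin> {y, z}" by blast
    then show ?thesis
    proof cases
      case 1
      then show ?thesis using fresh[of z] yz by simp
    next
      case 2
      have "eqc y z = eqc z y" by (rule ext) (simp add: eqc_def eq_commute)
      then show ?thesis using fresh[of y] yz 2 by simp
    next
      case 3
      have "(\<integral>\<^sup>+ s. eqc y z s \<partial>measure_spmf ?p) \<le> (\<integral>\<^sup>+ s. eqc y z s \<partial>measure_spmf q)"
        unfolding pint
      proof (rule nn_integral_spmf_mono)
        fix s assume s: "s \<in> set_spmf q"
        show "(\<integral>\<^sup>+ s3. eqc y z s3 \<partial>measure_spmf (exec M refresh_com s)) \<le> eqc y z s"
          by (rule rf(4)[OF s s s s yz 3])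
      qed
      also have "\<dots> \<le> ennreal (2 / real (T (lev' y)))" by (rule qpair[OF yz])
      finally show ?thesis .
    qed
  qed
  have ptime: "(\<integral>\<^sup>+ s. ennreal (real (time s)) \<partial>measure_spmf ?p) + ennreal (real (pot ?E lev' {} {}))
      \<le> ennreal (c + 300000 * real K)"
  proof -
    define t where "t = real (T (lev' u))"
    have t: "0 < t" by (simp add: t_def)
    have "(\<integral>\<^sup>+ s. ennreal (real (time s)) \<partial>measure_spmf ?p) \<le>
       (\<integral>\<^sup>+ s. ennreal (real (time s) + 2000) + ennreal (900 * t) * eqc u v s \<partial>measure_spmf q)"
      unfolding pint
    proof (rule nn_integral_spmf_mono)
      fix s assume s: "s \<in> set_spmf q"
      show "(\<integral>\<^sup>+ s3. ennreal (real (time s3)) \<partial>measure_spmf (exec M refresh_com s)) \<le>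
        ennreal (real (time s) + 2000) + ennreal (900 * t) * eqc u v s"
        unfolding t_def by (rule rf(3)[OF s s s s])
    qed
    also have "\<dots> = (\<integral>\<^sup>+ s. ennreal (real (time s)) \<partial>measure_spmf q) + (\<integral>\<^sup>+ s. ennreal 2000 \<partial>measure_spmf q)
       + ennreal (900 * t) * (\<integral>\<^sup>+ s. eqc u v s \<partial>measure_spmf q)"
      by (simp add: nn_integral_add nn_integral_cmult)
    also have "\<dots> \<le> (\<integral>\<^sup>+ s. ennreal (real (time s)) \<partial>measure_spmf q) + ennreal 2000 + ennreal (900 * t) * ennreal (2 / t)"
      using qconf unfolding t_def by (intro add_mono mult_left_mono nn_integral_spmf_const) simp_all
    \<comment> \<open>Resolving a conflict costs \<open>O(t)\<close> and has probability at most
      \<open>2 / t\<close>, so it adds only a constant in expectation.\<close>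
    also have "ennreal (900 * t) * ennreal (2 / t) = ennreal 1800"
      using t by (simp add: ennreal_mult[symmetric])
    finally have "(\<integral>\<^sup>+ s. ennreal (real (time s)) \<partial>measure_spmf ?p) + ennreal (real (pot ?E lev' {} {})) \<le>
      (\<integral>\<^sup>+ s. ennreal (real (time s)) \<partial>measure_spmf q) + ennreal 2000 + ennreal 1800 + ennreal (real (pot ?E lev' {} {}))"
      by (rule add_right_mono)
    also have "\<dots> = (\<integral>\<^sup>+ s. ennreal (real (time s)) \<partial>measure_spmf q) + ennreal (real (pot ?E lev' {} {})) + (ennreal 2000 + ennreal 1800)"
      by (simp only: add_ac)
    also have "\<dots> \<le> ennreal (c + 200000 * real K + 10) + (ennreal 2000 + ennreal 1800)"
      using qtime by (rule add_right_mono)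
    also have "\<dots> = ennreal (c + 200000 * real K + 3810)"
      using c by (simp add: ennreal_plus[symmetric] del: ennreal_plus ennreal_numeral)
    also have "\<dots> \<le> ennreal (c + 300000 * real K)"
    proof -
      have "1 \<le> K" using L_pos by (simp add: K_def)
      then show ?thesis by (intro ennreal_leI) simp
    qed
    finally show ?thesis .
  qed
  have "run_inv ?p ?E lev' F' (c + 300000 * real K)"
    unfolding run_inv_def using pll psk plow ppair ptime by blast
  then show ?thesis unfolding final by blast
qed

end

section \<open>Levels and arboricity\<close>

lemma is_forest_mono: "is_forest F \<Longrightarrow> F' \<subseteq> F \<Longrightarrow> is_forest F'"
  unfolding is_forest_def cycle_in_def by blast

section \<open>The number of edges of forests\<close>

definition walk :: "'a set set \<Rightarrow> 'a set \<Rightarrow> 'a list \<Rightarrow> bool" where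
  "walk F S vs \<longleftrightarrow> vs \<noteq> [] \<and> distinct vs \<and> set vs \<subseteq> S \<and>
     (\<forall>i. Suc i < length vs \<longrightarrow> {vs ! i, vs ! Suc i} \<in> F)"

text \<open>All neighbours of the first vertex of a longest path are on the path.\<close>

lemma cycle_if_min_degree_2:
  assumes S: "finite S" "S \<noteq> {}" and F: "\<And>e. e \<in> F \<Longrightarrow> e \<subseteq> S"
    and deg: "\<And>v. v \<in> S \<Longrightarrow> \<exists>a b. a \<noteq> b \<and> a \<noteq> v \<and> b \<noteq> v \<and> {v, a} \<in> F \<and> {v, b} \<in> F"
  shows "\<not> is_forest F"
proof -
  obtain v0 where "v0 \<in> S" using S by blast
  then have w0: "walk F S [v0]" by (simp add: walk_def)
  have "\<forall>vs. walk F S vs \<longrightarrow> length vs < Suc (card S)"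
  proof (intro allI impI)
    fix vs assume "walk F S vs"
    then have "length vs = card (set vs)" "set vs \<subseteq> S" by (simp_all add: walk_def distinct_card)
    then show "length vs < Suc (card S)" using card_mono[OF S(1)] by (simp add: less_Suc_eq_le)
  qed
  then obtain vs where vs: "walk F S vs" "\<And>ws. walk F S ws \<Longrightarrow> length ws \<le> length vs"
    using ex_has_greatest_nat[of "walk F S", OF w0] by blast
  obtain x xs where x: "vs = x # xs" using vs(1) by (cases vs) (auto simp: walk_def)
  have xS: "x \<in> S" using vs(1) x by (simp add: walk_def)
  have on: "\<exists>i. 0 < i \<and> i < length vs \<and> vs ! i = y" if y: "{x, y} \<in> F" "y \<noteq> x" for y
  proof -
    have "y \<in> set vs"
    proof (rule ccontr)
      assume "y \<notin> set vs"
      have "{(y # vs) ! i, (y # vs) ! Suc i} \<in> F" if "Suc i < length (y # vs)" for i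
      proof (cases i)
        case 0
        then show ?thesis using y(1) x by (simp add: insert_commute)
      next
        case (Suc j)
        then show ?thesis using vs(1) that unfolding walk_def by simp
      qed
      then have "walk F S (y # vs)"
        using vs(1) \<open>y \<notin> set vs\<close> F[OF y(1)] unfolding walk_def by simp
      then show False using vs(2)[of "y # vs"] by simp
    qed
    then obtain i where "i < length vs" "vs ! i = y" by (auto simp: in_set_conv_nth)
    moreover have "i \<noteq> 0" using calculation y(2) x by (cases i) auto
    ultimately show ?thesis by blast
  qed
  obtain a b where ab: "a \<noteq> b" "a \<noteq> x" "b \<noteq> x" "{x, a} \<in> F" "{x, b} \<in> F" using deg[OF xS] by blast
  obtain i j where i: "0 < i" "i < length vs" "vs ! i = a" and j: "0 < j" "j < length vs" "vs ! j = b"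
    using on[OF ab(4,2)] on[OF ab(5,3)] by blast
  \<comment> \<open>The farther of the two neighbours closes the cycle; as both indices are positive
    and different, its index is at least 2 and the cycle has at least three vertices.\<close>
  define k where "k = max i j"
  have "i \<noteq> j" using i(3) j(3) ab(1) by blast
  then have k: "2 \<le> k" "k < length vs" using i j by (auto simp: k_def max_def)
  have kF: "{vs ! k, vs ! 0} \<in> F"
  proof -
    have "vs ! 0 = x" using x by simp
    moreover have "k = i \<or> k = j" by (simp add: k_def max_def)
    ultimately have "{x, vs ! k} \<in> F" using ab(4,5) i(3) j(3) by metis
    then show ?thesis using \<open>vs ! 0 = x\<close> by (simp only: insert_commute[of "vs ! k" x "{}"])
  qed
  have "cycle_in F (take (Suc k) vs)"
    unfolding cycle_in_def
  proof (intro conjI allI impI)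
    show "3 \<le> length (take (Suc k) vs)" "distinct (take (Suc k) vs)"
      using k vs(1) by (simp_all add: walk_def)
    fix m assume m: "m < length (take (Suc k) vs)"
    have len: "length (take (Suc k) vs) = Suc k" using k by simp
    show "{take (Suc k) vs ! m, take (Suc k) vs ! (Suc m mod length (take (Suc k) vs))} \<in> F"
    proof (cases "m = k")
      case True
      then show ?thesis unfolding len using kF by simp
    next
      case False
      then have "Suc m < Suc k" using m len by simp
      then show ?thesis unfolding len using vs(1) k unfolding walk_def by simp
    qed
  qed
  then show ?thesis unfolding is_forest_def by blast
qed

text \<open>Some vertex meets at most one edge, for otherwise there is a cycle; remove it. For
  nonempty \<open>S\<close> the sharp bound would be \<open>card S - 1\<close>, but a count up to
  constant factors is enough.\<close>

lemma forest_card: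
  assumes "finite S" "is_forest F" "\<And>e. e \<in> F \<Longrightarrow> e \<subseteq> S \<and> card e = 2"
  shows "card F \<le> card S"
  using assms
proof (induction "card S" arbitrary: S F)
  case 0
  then have "S = {}" by simp
  have "F = {}"
  proof (rule ccontr)
    assume "F \<noteq> {}"
    then obtain e where "e \<in> F" by blast
    from 0(4)[OF this] \<open>S = {}\<close> show False by auto
  qed
  then show ?case by simp
next
  case (Suc k)
  have "S \<noteq> {}" using Suc.hyps(2) by auto
  have FS: "F \<subseteq> Pow S" using Suc.prems(3) by blast
  then have finF: "finite F" using Suc.prems(1) finite_subset by blast
  have "\<exists>v\<in>S. \<forall>a b. {v, a} \<in> F \<longrightarrow> {v, b} \<in> F \<longrightarrow> a = b"
  proof (rule ccontr)
    assume n: "\<not> ?thesis"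
    have "\<exists>a b. a \<noteq> b \<and> a \<noteq> v \<and> b \<noteq> v \<and> {v, a} \<in> F \<and> {v, b} \<in> F" if v: "v \<in> S" for v
    proof -
      obtain a b where ab: "{v, a} \<in> F" "{v, b} \<in> F" "a \<noteq> b" using n v by blast
      have "card {v, a} = 2" "card {v, b} = 2" using Suc.prems(3) ab by blast+
      then have "a \<noteq> v" "b \<noteq> v" by auto
      then show ?thesis using ab by blast
    qed
    then have "\<not> is_forest F"
      using cycle_if_min_degree_2[OF Suc.prems(1) \<open>S \<noteq> {}\<close>] Suc.prems(3) by blast
    then show False using Suc.prems(2) by blast
  qed
  then obtain v where v: "v \<in> S" "\<And>a b. {v, a} \<in> F \<Longrightarrow> {v, b} \<in> F \<Longrightarrow> a = b" by blast
  let ?F = "{e \<in> F. v \<notin> e}" and ?G = "{e \<in> F. v \<in> e}"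
  have "card ?F \<le> card (S - {v})"
  proof (rule Suc.hyps(1))
    show "k = card (S - {v})" using Suc.hyps(2) v(1) Suc.prems(1) by simp
    show "finite (S - {v})" using Suc.prems(1) by simp
    show "is_forest ?F" by (rule is_forest_mono[OF Suc.prems(2)]) blast
    show "e \<subseteq> S - {v} \<and> card e = 2" if "e \<in> ?F" for e using that Suc.prems(3) by blast
  qed
  moreover have "card ?G \<le> 1"
  proof -
    have "e = e'" if e: "e \<in> ?G" "e' \<in> ?G" for e e'
    proof -
      have "\<exists>a. e = {v, a}" if "e \<in> ?G" for e
      proof -
        have "card e = 2" "v \<in> e" using that Suc.prems(3) by blast+
        then obtain p q where "e = {p, q}" by (auto simp: card_2_iff)
        then show ?thesis using \<open>v \<in> e\<close> by (auto simp: insert_commute)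
      qed
      then obtain a b where "e = {v, a}" "e' = {v, b}" using e by blast
      then show ?thesis using v(2)[of a b] e by simp
    qed
    moreover have "finite ?G" using finF by simp
    ultimately show ?thesis by (simp only: card_le_Suc0_iff_eq One_nat_def) blast
  qed
  moreover have "card F \<le> card ?F + card ?G"
  proof -
    have "F = ?F \<union> ?G" by blast
    then show ?thesis using card_Un_le[of ?F ?G] by simp
  qed
  ultimately show ?case using Suc.hyps(2) v(1) Suc.prems(1) by simp
qed

lemma graph_on_finite:
  assumes "graph_on n E"
  shows "finite E" "\<And>e. e \<in> E \<Longrightarrow> card e = 2"
proof -
  have *: "\<exists>u v. e = {u, v} \<and> u < n \<and> v < n \<and> u \<noteq> v" if "e \<in> E" for e
    using assms that unfolding graph_on_def by (rule bspec)
  have "e \<in> Pow {..<n}" if "e \<in> E" for e using *[OF that] by (elim exE conjE) simp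
  then have "E \<subseteq> Pow {..<n}" by (rule subsetI)
  then show "finite E" by (rule finite_subset) simp
  show "card e = 2" if "e \<in> E" for e using *[OF that] by (elim exE conjE) simp
qed

text \<open>The easy direction of the Nash-Williams formula: each of the forests has at most
  \<open>card S\<close> edges inside of \<open>S\<close>.\<close>

lemma arboricity_edges:
  assumes E: "graph_on n E" and S: "finite S"
  shows "card {e \<in> E. e \<subseteq> S} \<le> arboricity E * card S"
proof -
  obtain f where f: "forest_partition E (arboricity E) f"
    using arboricity_attained[OF graph_on_finite(1)[OF E]] by blast
  have "{e \<in> E. e \<subseteq> S} \<subseteq> (\<Union>i<arboricity E. {e \<in> E. f e = i \<and> e \<subseteq> S})"
    using f unfolding forest_partition_def by blast
  moreover have "finite (\<Union>i<arboricity E. {e \<in> E. f e = i \<and> e \<subseteq> S})"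
    using graph_on_finite(1)[OF E] by simp
  ultimately have "card {e \<in> E. e \<subseteq> S} \<le> card (\<Union>i<arboricity E. {e \<in> E. f e = i \<and> e \<subseteq> S})"
    by (rule card_mono[rotated])
  also have "\<dots> \<le> (\<Sum>i<arboricity E. card {e \<in> E. f e = i \<and> e \<subseteq> S})" by (rule card_UN_le) simp
  also have "\<dots> \<le> (\<Sum>i<arboricity E. card S)"
  proof (rule sum_mono)
    fix i assume "i \<in> {..<arboricity E}"
    then have "is_forest {e \<in> E. f e = i}" using f unfolding forest_partition_def by simp
    then have "is_forest {e \<in> E. f e = i \<and> e \<subseteq> S}" by (rule is_forest_mono) blast
    then show "card {e \<in> E. f e = i \<and> e \<subseteq> S} \<le> card S"
      by (rule forest_card[OF S]) (use graph_on_finite(2)[OF E] in blast)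
  qed
  finally show ?thesis by simp
qed

context level_params
begin

section \<open>Stable levels and the number of colors\<close>

definition upper :: "(nat \<Rightarrow> nat) \<Rightarrow> nat \<Rightarrow> nat set" where
  "upper lev l = {v. v < n \<and> l \<le> lev v}"

text \<open>Double counting: each vertex above level \<open>l\<close> has at least
  \<open>T l\<close> neighbours on level \<open>l\<close> or above, by stability at its own level
  and monotonicity of \<open>T\<close>. The edges inside of \<open>upper lev l\<close> number at
  most arboricity times its size, and each is seen from at most two ends.\<close>

lemma upper_shrinks:
  assumes E: "graph_on n E" and st: "\<forall>v<n. stable E lev v"
  shows "card (upper lev (Suc l)) * T l \<le> 2 * arboricity E * card (upper lev l)"
proof -
  let ?Z = "upper lev l" and ?Y = "upper lev (Suc l)"
  have fin: "finite ?Z" "finite ?Y" by (simp_all add: upper_def)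
  let ?N = "\<lambda>v. {w. {v, w} \<in> E \<and> l \<le> lev w}"
  have T: "T l \<le> card (?N v)" if v: "v \<in> ?Y" for v
  proof -
    have l: "v < n" "Suc l \<le> lev v" using v by (simp_all add: upper_def)
    have "T l \<le> T (lev v - 1)" by (rule T_mono) (use l in simp)
    also have "\<dots> \<le> deg E lev (lev v - 1) v" using st l unfolding stable_def by simp
    also have "\<dots> \<le> deg E lev l v" by (rule deg_mono[OF E _ E]) (use l in auto)
    finally show ?thesis by (simp add: deg_def)
  qed
  let ?P = "Sigma ?Y ?N" and ?EZ = "{e \<in> E. e \<subseteq> ?Z}"
  have finEZ: "finite ?EZ" using graph_on_finite(1)[OF E] by simp
  have "card ?Y * T l = (\<Sum>v\<in>?Y. T l)" by simp
  also have "\<dots> \<le> (\<Sum>v\<in>?Y. card (?N v))" by (rule sum_mono) (rule T)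
  also have "\<dots> = card ?P" using fin(2) E by (intro card_SigmaI[symmetric]) simp_all
  also have "\<dots> \<le> card (\<Union>e\<in>?EZ. {(v, w). {v, w} = e})"
  proof (rule card_mono)
    show "finite (\<Union>e\<in>?EZ. {(v, w). {v, w} = e})"
    proof (rule finite_subset)
      show "(\<Union>e\<in>?EZ. {(v, w). {v, w} = e}) \<subseteq> ?Z \<times> ?Z" by blast
    qed (simp add: fin)
    show "?P \<subseteq> (\<Union>e\<in>?EZ. {(v, w). {v, w} = e})"
    proof
      fix p assume "p \<in> ?P"
      then obtain v w where p: "p = (v, w)" "v \<in> ?Y" "{v, w} \<in> E" "l \<le> lev w" by blast
      have "w < n" using graph_onD[OF E p(3)] by blast
      then have "{v, w} \<subseteq> ?Z" using p by (simp add: upper_def)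
      then show "p \<in> (\<Union>e\<in>?EZ. {(v, w). {v, w} = e})" using p by blast
    qed
  qed
  also have "\<dots> \<le> (\<Sum>e\<in>?EZ. card {(v, w). {v, w} = e})" by (rule card_UN_le[OF finEZ])
  also have "\<dots> \<le> (\<Sum>e\<in>?EZ. 2)"
  proof (rule sum_mono)
    fix e assume "e \<in> ?EZ"
    then obtain a b where e: "e = {a, b}" using E unfolding graph_on_def by blast
    have "{(v, w). {v, w} = e} \<subseteq> {(a, b), (b, a)}" unfolding e by (auto simp: doubleton_eq_iff)
    then have "card {(v, w). {v, w} = e} \<le> card {(a, b), (b, a)}" by (intro card_mono) simp_all
    also have "\<dots> \<le> 2" by (rule card_insert_le_m1) simp_all
    finally show "card {(v, w). {v, w} = e} \<le> 2" .
  qed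
  also have "\<dots> = 2 * card ?EZ" by simp
  also have "\<dots> \<le> 2 * (arboricity E * card ?Z)" using arboricity_edges[OF E fin(1)] by simp
  finally show ?thesis by simp
qed

lemma level_bound:
  assumes E: "graph_on n E" and st: "\<forall>v<n. stable E lev v" and g: "4 * arboricity E \<le> 2 ^ g"
    and v: "v < n"
  shows "lev v < Suc g * L"
proof -
  have half: "2 * card (upper lev (Suc (g * L + i))) \<le> card (upper lev (g * L + i))" if i: "i < L" for i
  proof -
    have "T (g * L + i) = 2 ^ g" using i L_pos by (simp add: T_def)
    then have "card (upper lev (Suc (g * L + i))) * 2 ^ g * 2 \<le> 4 * arboricity E * card (upper lev (g * L + i))"
      using upper_shrinks[OF E st, of "g * L + i"] by (simp add: ac_simps)
    also have "\<dots> \<le> 2 ^ g * card (upper lev (g * L + i))" using g by (rule mult_le_mono1)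
    finally have "2 ^ g * (2 * card (upper lev (Suc (g * L + i)))) \<le> 2 ^ g * card (upper lev (g * L + i))"
      by (simp only: ac_simps)
    then show ?thesis by (simp only: mult_le_cancel1) simp
  qed
  have "i \<le> L \<Longrightarrow> 2 ^ i * card (upper lev (g * L + i)) \<le> n" for i
  proof (induction i)
    case 0
    have "card (upper lev (g * L)) \<le> card {..<n}" by (rule card_mono) (auto simp: upper_def)
    then show ?case by simp
  next
    case (Suc i)
    then have "2 ^ Suc i * card (upper lev (g * L + Suc i)) \<le> 2 ^ i * card (upper lev (g * L + i))"
      using half[of i] by (simp add: mult_le_mono2 mult.assoc mult.left_commute)
    then show ?case using Suc by linarith
  qed
  from this[of L] have "2 ^ L * card (upper lev (g * L + L)) \<le> n" by simp
  \<comment> \<open>A single vertex left after \<open>L\<close> halvings would contradict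
    \<open>n < 2 ^ L\<close>.\<close>
  then have "card (upper lev (g * L + L)) = 0" using n_less by (cases "card (upper lev (g * L + L))") auto
  then have "upper lev (g * L + L) = {}" by (simp add: upper_def)
  then have "\<not> g * L + L \<le> lev v" using v by (auto simp: upper_def)
  then show ?thesis by simp
qed

text \<open>The geometric sum \<open>off (m * L) = 4 * L * (2 ^ m - 1)\<close>, with the subtraction
  moved to the other side.\<close>

lemma off_group: "off (m * L) + 4 * L = 4 * L * 2 ^ m"
proof (induction m)
  case 0
  then show ?case by (simp add: off_def)
next
  case (Suc m)
  have "(\<Sum>i<L. 4 * T (m * L + i)) = 4 * L * 2 ^ m" using L_pos by (simp add: T_def)
  moreover have "off (m * L + k) = off (m * L) + (\<Sum>i<k. 4 * T (m * L + i))" for k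
    by (induction k) (simp_all add: off_Suc)
  ultimately have "off (Suc m * L) = off (m * L) + 4 * L * 2 ^ m" by (simp add: add.commute)
  then show ?case using Suc by simp
qed

lemma color_bound:
  assumes sk: "skel E lev F s" and ci: "cinv E lev {} {} s"
  shows "\<exists>C. C \<le> 64 * L * max 1 (arboricity E) \<and> proper_coloring n E C (color_array s)"
proof -
  have E: "graph_on n E" and st: "\<forall>v<n. stable E lev v" using sk unfolding skel_def by blast+
  \<comment> \<open>The least group whose threshold reaches four times the arboricity. By minimality
    \<open>2 ^ g\<close> is at most 8 times the arboricity (or 8, if that is 0), and the colors up
    to the end of this group number at most \<open>8 * L * 2 ^ g\<close>; this is the origin of
    64.\<close>
  define g where "g = (LEAST g. 4 * arboricity E \<le> 2 ^ g)"
  have "4 * arboricity E \<le> 2 ^ (4 * arboricity E)" using less_exp[of "4 * arboricity E"] by simp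
  then have g: "4 * arboricity E \<le> 2 ^ g" unfolding g_def by (rule LeastI)
  have g8: "2 ^ g \<le> 8 * max 1 (arboricity E)"
  proof (cases g)
    case (Suc h)
    have "\<not> 4 * arboricity E \<le> 2 ^ h"
      using Suc not_less_Least[of h "\<lambda>g. 4 * arboricity E \<le> 2 ^ g"] unfolding g_def by simp
    then show ?thesis unfolding Suc by simp
  qed simp
  define C where "C = off (Suc g * L)"
  have "C \<le> 4 * L * 2 ^ Suc g" using off_group[of "Suc g"] unfolding C_def by linarith
  also have "\<dots> = 8 * L * 2 ^ g" by simp
  also have "\<dots> \<le> 8 * L * (8 * max 1 (arboricity E))" using g8 by (rule mult_le_mono2)
  finally have "C \<le> 64 * L * max 1 (arboricity E)" by simp
  moreover have "proper_coloring n E C (color_array s)"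
    unfolding proper_coloring_def color_array_def
  proof (intro conjI allI impI)
    fix w assume w: "w < n"
    have "arrays s 0 w \<in> palette (lev w)" using ci w unfolding cinv_def by blast
    then have "1 \<le> arrays s 0 w" "arrays s 0 w \<le> off (Suc (lev w))" by (simp_all add: palette_def off_Suc)
    moreover have "off (Suc (lev w)) \<le> C"
      unfolding C_def by (rule off_mono) (use level_bound[OF E st g w] in simp)
    ultimately show "arrays s 0 w \<in> {1..C}" by simp
  next
    fix x y assume "{x, y} \<in> E"
    then show "arrays s 0 x \<noteq> arrays s 0 y" using ci unfolding cinv_def by blast
  qed
  ultimately show ?thesis by blast
qed

end

section \<open>The data structure\<close>

definition coloring_ds :: data_structure where
  "coloring_ds = \<lparr>init_prog = init_com, update_prog = update_com, word_factor = 10\<rparr>"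

lemma process_append:
  "process D n (xs @ ys) s = bind_spmf (process D n xs s) (process D n ys)"
proof (induction xs arbitrary: s)
  case (Cons x xs)
  have "process D n (xs @ ys) = (\<lambda>s. bind_spmf (process D n xs s) (process D n ys))"
    by (rule ext) (rule Cons.IH)
  then show ?case by (simp add: bind_spmf_assoc)
qed simp

text \<open>Allows induction at the end of the sequence, so that the invariant describes the
  distribution after every prefix.\<close>

lemma run_snoc:
  "run D n (us @ [x]) = bind_spmf (run D n us)
     (\<lambda>s. exec (num_words D n) (update_prog D) (load_update x s))"
proof -
  have "process D n [] = return_spmf" by (rule ext) simp
  then have "process D n [x] = (\<lambda>s. exec (num_words D n) (update_prog D) (load_update x s))"
    by (intro ext) simp
  then show ?thesis by (simp add: run_def process_append bind_spmf_assoc)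
qed

lemma valid_updates_snoc:
  "valid_updates n E (us @ [x]) \<longleftrightarrow> valid_updates n E us \<and> valid_update n (fold apply_update us E) x"
  by (induction us arbitrary: E) auto

context level_params
begin

lemma run_inv_run:
  assumes M: "num_words coloring_ds n = M" and us: "valid_updates n {} us"
  shows "\<exists>lev F. run_inv (run coloring_ds n us) (graph_after us) lev F (real (length us) * (300000 * real K))"
  using us
proof (induction us rule: rev_induct)
  case Nil
  obtain s where s: "exec M init_com (start_state n) = return_spmf s" "skel {} (\<lambda>_. 0) {} s"
    "cinv {} (\<lambda>_. 0) {} {} s"
    using exec_init by blast
  have run: "run coloring_ds n [] = return_spmf (s\<lparr>time := 0\<rparr>)"
    using s(1) by (simp add: run_def initialize_def M) (simp add: coloring_ds_def)
  have pot0: "pot {} (\<lambda>_. 0) {} {} = 0"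
    by (simp add: pot_def edge_pot_def edge_term_def debt_pot_def debt_def)
  have "skel {} (\<lambda>_. 0) {} (s\<lparr>time := 0\<rparr>)" by (rule skel_cong[OF s(2)]) simp_all
  moreover have "cinv {} (\<lambda>_. 0) {} {} (s\<lparr>time := 0\<rparr>)" using s(3) by (simp add: cinv_def)
  \<comment> \<open>On level 0 the threshold is 1, so that the pair bound is 2 and holds for any
    coloring.\<close>
  moreover have "eqc x y t \<le> ennreal (2 / real (T 0))" for x y t
  proof -
    have "eqc x y t \<le> 1" by (simp add: eqc_def ind_le_1)
    also have "(1 :: ennreal) \<le> ennreal (2 / real (T 0))" by (simp add: T_def)
    finally show ?thesis .
  qed
  ultimately have "run_inv (run coloring_ds n []) {} (\<lambda>_. 0) {} 0"
    unfolding run_inv_def run by (simp add: pot0 measure_spmf_return_spmf nn_integral_return low_eq_def)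
  then show ?case by (auto simp: graph_after_def)
next
  case (snoc x us)
  then have v: "valid_updates n {} us" "valid_update n (graph_after us) x"
    by (simp_all add: valid_updates_snoc graph_after_def)
  obtain lev F where inv: "run_inv (run coloring_ds n us) (graph_after us) lev F (real (length us) * (300000 * real K))"
    using snoc.IH[OF v(1)] by blast
  have "0 \<le> real (length us) * (300000 * real K)" by simp
  from run_inv_step[OF inv this v(2)] obtain lev' F' where
    "run_inv (bind_spmf (run coloring_ds n us) (\<lambda>s. exec M update_com (load_update x s)))
      (apply_update x (graph_after us)) lev' F' (real (length us) * (300000 * real K) + 300000 * real K)" by blast
  then have "run_inv (bind_spmf (run coloring_ds n us) (\<lambda>s. exec M update_com (load_update x s)))
      (apply_update x (graph_after us)) lev' F' (real (length (us @ [x])) * (300000 * real K))"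
    by (simp add: algebra_simps)
  moreover have "run coloring_ds n (us @ [x]) = bind_spmf (run coloring_ds n us) (\<lambda>s. exec M update_com (load_update x s))"
    unfolding run_snoc M by (simp add: coloring_ds_def)
  moreover have "graph_after (us @ [x]) = apply_update x (graph_after us)" by (simp add: graph_after_def)
  ultimately have "run_inv (run coloring_ds n (us @ [x])) (graph_after (us @ [x])) lev' F'
      (real (length (us @ [x])) * (300000 * real K))"
    by (simp only:)
  then show ?case by (intro exI)
qed

section \<open>Logarithmic bounds for the parameters\<close>

lemma L_log: "real L \<le> 2 * log 2 (real n)" "1 \<le> log 2 (real n)"
proof -
  show 1: "1 \<le> log 2 (real n)" using n2 by (simp add: le_log_iff)
  have "real (2 ^ L) \<le> real (2 * n)" using pow_le by (rule of_nat_mono)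
  then have "2 powr real L \<le> 2 * real n" by (simp add: powr_realpow)
  then have "real L \<le> log 2 (2 * real n)" using n2 by (simp add: le_log_iff)
  also have "\<dots> = 1 + log 2 (real n)" using n2 by (simp add: log_mult)
  finally show "real L \<le> 2 * log 2 (real n)" using 1 by simp
qed

lemma K_log: "real K \<le> 4 * (log 2 (real n))\<^sup>2"
proof -
  have "real K = (real L)\<^sup>2" by (simp add: K_def power2_eq_square)
  also have "\<dots> \<le> (2 * log 2 (real n))\<^sup>2" using L_log by (intro power_mono) auto
  finally show ?thesis by (simp add: power_mult_distrib)
qed

end

text \<open>Minimality of \<open>L\<close> gives \<open>2 ^ L \<le> 2 * n\<close>. The word factor
  10 makes the number of words at least \<open>(n + 1) ^ 10\<close>.\<close>

lemma level_params_exist: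
  assumes "2 \<le> n"
  shows "\<exists>L. level_params n L (num_words coloring_ds n)"
proof -
  define L where "L = (LEAST L. n < 2 ^ L)"
  have "n < 2 ^ n" by (rule less_exp)
  then have L: "n < 2 ^ L" unfolding L_def by (rule LeastI)
  obtain l where l: "L = Suc l" using L assms by (cases L) auto
  have "\<not> n < 2 ^ l" using l not_less_Least[of l "\<lambda>L. n < 2 ^ L"] unfolding L_def by simp
  then have le: "2 ^ L \<le> 2 * n" unfolding l by simp
  define b where "b = nat \<lceil>log 2 (real n + 1)\<rceil>"
  have "log 2 (real n + 1) \<le> real b" unfolding b_def by linarith
  then have "real n + 1 \<le> 2 powr real b" using log_le_iff[of 2 "real n + 1" "real b"] by simp
  then have "real (n + 1) \<le> real (2 ^ b)" by (simp add: powr_realpow)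
  then have "n + 1 \<le> 2 ^ b" by (simp only: of_nat_le_iff)
  then have "(n + 1) ^ 10 \<le> (2 ^ b) ^ 10" by (rule power_mono) simp
  also have "\<dots> = num_words coloring_ds n"
    by (simp add: num_words_def coloring_ds_def b_def power_mult[symmetric] mult.commute)
  finally show ?thesis using assms L le unfolding level_params_def by blast
qed

theorem theorem1:
  shows "\<exists>(D :: data_structure) (c :: real).
    c > 0 \<and> word_factor D \<ge> 1 \<and>
    maintains_coloring D (\<lambda>n \<alpha>. c * real (max 1 \<alpha>) * log 2 (real n)) \<and>
    expected_amortized_update_time D (\<lambda>n. c * (log 2 (real n))\<^sup>2) \<and>
    expected_init_time D (\<lambda>n. c * real n * (log 2 (real n))\<^sup>2)"
proof -
  \<comment> \<open>The requirements are at least \<open>64 * 2\<close> for the colors and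
    \<open>300000 * 4\<close> for the updates, both from the bound of \<open>L\<close> by twice the
    logarithm, and 740 for the initialization.\<close>
  define c :: real where "c = 2000000"
  have "maintains_coloring coloring_ds (\<lambda>n \<alpha>. c * real (max 1 \<alpha>) * log 2 (real n))"
    unfolding maintains_coloring_def
  proof (intro allI impI ballI)
    fix n us s assume n: "2 \<le> n" and us: "valid_updates n {} us" and s: "s \<in> set_spmf (run coloring_ds n us)"
    obtain L where "level_params n L (num_words coloring_ds n)" using level_params_exist[OF n] by blast
    then interpret level_params n L "num_words coloring_ds n" .
    obtain lev F where "run_inv (run coloring_ds n us) (graph_after us) lev F (real (length us) * (300000 * real K))"
      using run_inv_run[OF refl us] by blast
    then have "skel (graph_after us) lev F s" "cinv (graph_after us) lev {} {} s"
      using s unfolding run_inv_def by blast+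
    then obtain C where C: "C \<le> 64 * L * max 1 (arboricity (graph_after us))"
      "proper_coloring n (graph_after us) C (color_array s)"
      using color_bound by blast
    let ?a = "real (max 1 (arboricity (graph_after us)))"
    have "real C \<le> real (64 * L * max 1 (arboricity (graph_after us)))" using C(1) by (rule of_nat_mono)
    also have "\<dots> = 64 * ?a * real L" by simp
    also have "\<dots> \<le> 64 * ?a * (2 * log 2 (real n))" using L_log by (intro mult_left_mono) auto
    also have "\<dots> = 128 * (?a * log 2 (real n))" by simp
    also have "\<dots> \<le> c * (?a * log 2 (real n))"
      using L_log(2) by (intro mult_right_mono mult_nonneg_nonneg) (auto simp: c_def)
    finally have "real C \<le> c * ?a * log 2 (real n)" by (simp only: mult.assoc)
    then show "\<exists>C. real C \<le> c * ?a * log 2 (real n) \<and> proper_coloring n (graph_after us) C (color_array s)"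
      using C(2) by blast
  qed
  moreover have "expected_amortized_update_time coloring_ds (\<lambda>n. c * (log 2 (real n))\<^sup>2)"
    unfolding expected_amortized_update_time_def
  proof (intro allI impI)
    fix n us assume n: "2 \<le> n" and us: "valid_updates n {} us"
    obtain L where "level_params n L (num_words coloring_ds n)" using level_params_exist[OF n] by blast
    then interpret level_params n L "num_words coloring_ds n" .
    obtain lev F where inv: "run_inv (run coloring_ds n us) (graph_after us) lev F (real (length us) * (300000 * real K))"
      using run_inv_run[OF refl us] by blast
    then have ll: "lossless_spmf (run coloring_ds n us)" unfolding run_inv_def by blast
    have "expected_time (run coloring_ds n us) = (\<integral>\<^sup>+ s. ennreal (real (time s)) \<partial>measure_spmf (run coloring_ds n us))"
      using ll by (simp add: expected_time_def ennreal_of_nat_eq_real_of_nat)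
    \<comment> \<open>The final potential is nonnegative and is dropped.\<close>
    also have "\<dots> \<le> ennreal (real (length us) * (300000 * real K))"
      using inv unfolding run_inv_def by (auto intro: order.trans[OF le_iff_add[THEN iffD2]])
    also have "\<dots> \<le> ennreal (real (length us) * (c * (log 2 (real n))\<^sup>2))"
    proof (intro ennreal_leI mult_left_mono)
      have "300000 * real K \<le> 300000 * (4 * (log 2 (real n))\<^sup>2)" using K_log by (intro mult_left_mono) auto
      also have "\<dots> \<le> c * (log 2 (real n))\<^sup>2" by (simp add: c_def)
      finally show "300000 * real K \<le> c * (log 2 (real n))\<^sup>2" .
    qed simp
    finally show "expected_time (run coloring_ds n us) \<le> ennreal (real (length us) * (c * (log 2 (real n))\<^sup>2))" .
  qed
  moreover have "expected_init_time coloring_ds (\<lambda>n. c * real n * (log 2 (real n))\<^sup>2)"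
    unfolding expected_init_time_def
  proof (intro allI impI)
    fix n :: nat assume n: "2 \<le> n"
    obtain L where "level_params n L (num_words coloring_ds n)" using level_params_exist[OF n] by blast
    then interpret level_params n L "num_words coloring_ds n" .
    obtain s where s: "exec (num_words coloring_ds n) init_com (start_state n) = return_spmf s"
      "time s \<le> 20 * n + 20 * L + 100 * K + 300"
      using exec_init by blast
    have init: "initialize coloring_ds n = return_spmf s"
      using s(1) by (simp add: initialize_def) (simp add: coloring_ds_def)
    have "expected_time (initialize coloring_ds n) = ennreal (real (time s))"
      unfolding init by (simp add: expected_time_def measure_spmf_return_spmf nn_integral_return ennreal_of_nat_eq_real_of_nat)
    also have "\<dots> \<le> ennreal (c * real n * (log 2 (real n))\<^sup>2)"
    proof (rule ennreal_leI)
      let ?q = "(log 2 (real n))\<^sup>2"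
      have q: "1 \<le> ?q" using L_log(2) by simp
      have nq: "real n \<le> real n * ?q" using q n by simp
      have qn: "?q \<le> real n * ?q" using mult_right_mono[of 1 "real n" ?q] n by simp
      have "real (time s) \<le> real (20 * n + 20 * L + 100 * K + 300)" using s(2) by (rule of_nat_mono)
      also have "\<dots> \<le> 40 * real n + 400 * ?q + 300" using L_le K_log by simp
      also have "\<dots> \<le> 740 * (real n * ?q)" using nq qn q by linarith
      also have "\<dots> \<le> c * real n * ?q" using n by (simp add: c_def)
      finally show "real (time s) \<le> c * real n * ?q" .
    qed
    finally show "expected_time (initialize coloring_ds n) \<le> ennreal (c * real n * (log 2 (real n))\<^sup>2)" .
  qed
  moreover have "word_factor coloring_ds \<ge> 1" "c > 0" by (simp_all add: coloring_ds_def c_def)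
  ultimately show ?thesis by blast
qed

end
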